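(* Let $\tilde q_{n,k_n}=\frac12(q_{n,k_n}+q^*_{n,k_n})$ be the additive symmetrization of the top to bottom-$k$ shuffle on $S_n$, where $1<k_n\le n$. Then: (1) For every constant $C$ there is a constant $B(C)\in(0,\infty)$ such that, if $k_n\ge n-C$, then $$T(S_n,\tilde q_{n,k_n})\le T_2(S_n,\tilde q_{n,k_n})\le B(C)\,n\log n .$$ (2) For every $c\in(0,1)$ there is a constant $A(c)\in(0,\infty)$ such that, if $k_n\le cn$, then $$T_2(S_n,\tilde q_{n,k_n})\ge T(S_n,\tilde q_{n,k_n})\ge A(c)\,n^2$$ and $$T_2(S_n,\tilde q_{n,k_n})\ge \frac{A(c)\,n^3}{k_n^2}\log n .$$ (3) There is a universal constant $B\in(0,\infty)$ such that, for any $k_n$, $$T(S_n,\tilde q_{n,k_n})\le T_2(S_n,\tilde q_{n,k_n})\le B\,n^3\log n .$$ In particular, for every constant $C$ there is a constant $A(C)\in(0,\infty)$ such that, if $k_n\le C$, then $$A(C)\,n^3\log n\le T_2(S_n,\tilde q_{n,k_n})\le B\,n^3\log n .$$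
   Context: $S_n$ is the symmetric group; $\sigma\in S_n$ is viewed as an arrangement of a deck, $\sigma(i)=j$ meaning that position $i$ holds the card with label $j$. For $1\le l\le n$ let $\sigma_l=(1,2,\dots,l)$, i.e. $\sigma_l(i)=i+1$ for $1\le i\le l-1$, $\sigma_l(l)=1$, and $\sigma_l(i)=i$ otherwise. For $1<k_n\le n$ define the probability measure on $S_n$ $$q_{n,k_n}(\sigma)=\begin{cases}1/k_n,&\sigma=\sigma_l\text{ for some }n-k_n+1\le l\le n,\\0,&\text{otherwise,}\end{cases}$$ and $q^*_{n,k_n}(\sigma)=q_{n,k_n}(\sigma^{-1})$. Convolution powers of a probability measure $q$ on a finite group $G$: $q^0=\delta_e$, $q^m(g)=\sum_{h\in G}q^{m-1}(h)q(h^{-1}g)$. $\pi$ is the uniform distribution. $\|q-\pi\|_{\mathrm{TV}}=\frac12\sum_{g\in G}|q(g)-\pi(g)|$. Mixing times: $T(G,q)=\inf\{m:\|q^m-\pi\|_{\mathrm{TV}}\le\frac1{2e}\}$ and $T_2(G,q)=\inf\{m:\|\frac{q^m}{\pi}-1\|_{L^2(\pi)}\le\frac1e\}$, where $\|\frac{q}{\pi}-1\|_{L^2(\pi)}=\bigl(\sum_{g}|\frac{q(g)}{\pi(g)}-1|^2\pi(g)\bigr)^{1/2}$. Constants do not depend on $n$ (nor on the choice of $k_n$ within the stated range). *)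

theory Defs
  imports Complex_Main "HOL-Library.Extended_Real" "HOL-Algebra.Sym_Groups"
begin

text \<open>
  A probability measure on a finite group \<open>G\<close> is represented by its mass function, of which only
  the values on \<open>carrier G\<close> are used.
\<close>

fun conv_power :: "('a, 'b) monoid_scheme \<Rightarrow> ('a \<Rightarrow> real) \<Rightarrow> nat \<Rightarrow> 'a \<Rightarrow> real" where
  "conv_power G q 0 g = (if g = \<one>\<^bsub>G\<^esub> then 1 else 0)"
| "conv_power G q (Suc m) g =
     (\<Sum>h\<in>carrier G. conv_power G q m h * q (inv\<^bsub>G\<^esub> h \<otimes>\<^bsub>G\<^esub> g))"

definition uniform_mass :: "('a, 'b) monoid_scheme \<Rightarrow> 'a \<Rightarrow> real" where
  "uniform_mass G g = 1 / real (order G)"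

definition tv_dist :: "('a, 'b) monoid_scheme \<Rightarrow> ('a \<Rightarrow> real) \<Rightarrow> ('a \<Rightarrow> real) \<Rightarrow> real" where
  "tv_dist G p q = (1 / 2) * (\<Sum>g\<in>carrier G. \<bar>p g - q g\<bar>)"

text \<open>The norm of \<open>q / p - 1\<close> in \<open>L\<^sup>2(p)\<close>.\<close>

definition l2_dist :: "('a, 'b) monoid_scheme \<Rightarrow> ('a \<Rightarrow> real) \<Rightarrow> ('a \<Rightarrow> real) \<Rightarrow> real" where
  "l2_dist G q p = sqrt (\<Sum>g\<in>carrier G. \<bar>q g / p g - 1\<bar>^2 * p g)"

text \<open>
  Mixing times are extended natural numbers, so that the infimum is \<open>\<infinity>\<close> if the threshold is
  never reached.
\<close>

definition mix_time_tv :: "('a, 'b) monoid_scheme \<Rightarrow> ('a \<Rightarrow> real) \<Rightarrow> enat" where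
  "mix_time_tv G q =
     Inf (enat ` {m. tv_dist G (conv_power G q m) (uniform_mass G) \<le> 1 / (2 * exp 1)})"

definition mix_time_l2 :: "('a, 'b) monoid_scheme \<Rightarrow> ('a \<Rightarrow> real) \<Rightarrow> enat" where
  "mix_time_l2 G q =
     Inf (enat ` {m. l2_dist G (conv_power G q m) (uniform_mass G) \<le> 1 / exp 1})"

definition reversed :: "('a, 'b) monoid_scheme \<Rightarrow> ('a \<Rightarrow> real) \<Rightarrow> 'a \<Rightarrow> real" where
  "reversed G q g = q (inv\<^bsub>G\<^esub> g)"

definition additive_symmetrization ::
    "('a, 'b) monoid_scheme \<Rightarrow> ('a \<Rightarrow> real) \<Rightarrow> 'a \<Rightarrow> real" where
  "additive_symmetrization G q g = (1 / 2) * (q g + reversed G q g)"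

text \<open>The cycle \<open>(1, 2, \<dots>, l)\<close>, for \<open>l \<ge> 1\<close>.\<close>

definition top_cycle :: "nat \<Rightarrow> nat \<Rightarrow> nat" where
  "top_cycle l i = (if 1 \<le> i \<and> i < l then i + 1 else if i = l then 1 else i)"

definition top_to_bottom_k :: "nat \<Rightarrow> nat \<Rightarrow> (nat \<Rightarrow> nat) \<Rightarrow> real" where
  "top_to_bottom_k n k \<sigma> =
     (if \<exists>l. n - k + 1 \<le> l \<and> l \<le> n \<and> \<sigma> = top_cycle l then 1 / real k else 0)"

definition sym_top_to_bottom_k :: "nat \<Rightarrow> nat \<Rightarrow> (nat \<Rightarrow> nat) \<Rightarrow> real" where
  "sym_top_to_bottom_k n k = additive_symmetrization (sym_group n) (top_to_bottom_k n k)"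

definition shuffle_T :: "nat \<Rightarrow> nat \<Rightarrow> enat" where
  "shuffle_T n k = mix_time_tv (sym_group n) (sym_top_to_bottom_k n k)"

definition shuffle_T2 :: "nat \<Rightarrow> nat \<Rightarrow> enat" where
  "shuffle_T2 n k = mix_time_l2 (sym_group n) (sym_top_to_bottom_k n k)"

lemma top_cycle_permutes:
  assumes "1 \<le> l" "l \<le> n"
  shows "top_cycle l permutes {1..n}"
proof -
  have inj: "inj (top_cycle l)"
    using assms by (auto simp: inj_def top_cycle_def split: if_splits)
  have "top_cycle l ` {1..n} \<subseteq> {1..n}"
    using assms by (auto simp: top_cycle_def)
  with inj have "bij_betw (top_cycle l) {1..n} {1..n}"
    by (metis bij_betw_def endo_inj_surj finite_atLeastAtMost inj_on_subset top_greatest)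
  moreover have "top_cycle l i = i" if "i \<notin> {1..n}" for i
    using that assms by (auto simp: top_cycle_def)
  ultimately show ?thesis
    by (rule bij_imp_permutes)
qed

lemma inj_on_top_cycle: "inj_on top_cycle {1..}"
proof (rule linorder_inj_onI')
  fix a b :: nat assume "a \<in> {1..}" "a < b"
  then have "top_cycle a a \<noteq> top_cycle b a" by (simp add: top_cycle_def)
  then show "top_cycle a \<noteq> top_cycle b" by metis
qed

lemma top_to_bottom_k_sum:
  assumes "1 < k" "k \<le> n"
  shows "(\<Sum>\<sigma>\<in>carrier (sym_group n). top_to_bottom_k n k \<sigma>) = 1"
proof -
  let ?L = "{n - k + 1..n}"
  have fin: "finite (carrier (sym_group n))"
    by (simp add: sym_group_def finite_permutations)
  have sub: "top_cycle ` ?L \<subseteq> carrier (sym_group n)"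
    using top_cycle_permutes by (auto simp: sym_group_def)
  have "(\<Sum>\<sigma>\<in>carrier (sym_group n). top_to_bottom_k n k \<sigma>)
      = (\<Sum>\<sigma>\<in>top_cycle ` ?L. top_to_bottom_k n k \<sigma>)"
    by (rule sum.mono_neutral_right[OF fin sub]) (auto simp: top_to_bottom_k_def)
  also have "\<dots> = (\<Sum>\<sigma>\<in>top_cycle ` ?L. 1 / real k)"
    by (rule sum.cong) (auto simp: top_to_bottom_k_def)
  also have "\<dots> = real (card (top_cycle ` ?L)) / real k"
    by simp
  also have "card (top_cycle ` ?L) = k"
    using assms by (subst card_image) (auto intro: inj_on_subset[OF inj_on_top_cycle])
  finally show ?thesis using assms by simp
qed

end

theory Submission
  imports Defs "HOL-Analysis.L2_Norm" "HOL-Analysis.Function_Topology"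
begin

text \<open>
  Upper bounds. Let \<open>U r\<close> be the space of functions on the symmetric group whose sums over the
  cosets \<open>S\<^sub>Z \<sigma>\<close> vanish for all sets \<open>Z\<close> of \<open>n - r + 1\<close> labels (\<open>sym_null\<close> with the parameter
  \<open>n - r + 1\<close>). Every walk acting on positions preserves \<open>U r\<close>, and the unit mass at the
  identity is a constant plus a sum of vectors in \<open>U r\<close> for \<open>r = 1, \<dots>, n - 1\<close> of norm at most
  \<open>2 n^r / sqrt n!\<close>. So \<open>L\<^sup>2\<close> mixing within \<open>O(log n / \<kappa>)\<close> steps follows once the walk contracts \<open>U r\<close>
  by \<open>exp (- \<kappa> r)\<close>. On \<open>U r\<close> the sum of all transpositions is bounded by \<open>n (n - r - 1) / 2\<close>,
  because each star \<open>\<Sum>a\<noteq>k. (a k)\<close> is at most \<open>n - r - 1\<close>: this is the classical bound on the contents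
  of a Young diagram by the length of its first row, and it can be read off from a maximal eigenvector.
  Writing transpositions as words in the generators transfers the gap to the shuffle, and near \<open>k = n\<close>
  to its square, which also controls the negative eigenvalues.

  Lower bounds. Away from the ends a single card performs a simple random walk, so it needs order
  \<open>n\<^sup>2\<close> steps to move a distance of order \<open>n\<close>. The cyclic distance of two cards changes only when one
  of them is among the bottom \<open>k\<close>, so \<open>sin (2 \<pi> (x\<^sub>1 - x\<^sub>j) / n)\<close>, with \<open>x\<^sub>j\<close> the position of card
  \<open>j\<close>, loses only a fraction of order \<open>k\<^sup>2 / n\<^sup>3\<close> of its norm per step; there are \<open>n - 1\<close> nearly
  orthogonal functions of this kind.
\<close>

subsection \<open>Inner products of real functions on a finite set\<close>

text \<open>A spectral gap \<gamma> alone gives mixing after about log (n!) / \<gamma> steps, which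
  loses a factor n. The factor r in the rate on U r recovers it: the orthogonal complement of
  \<open>sym_null A (n - r)\<close> is spanned by at most n^(2 r) functions, and projecting the unit
  mass to it costs only the square root of this dimension, so n exp (- \<kappa> m) small settles all
  r at once. The spaces U r are nested, unlike the isotypic components that they stand for; this is
  harmless because the unit mass is split by telescoping projections and the pieces are added up by
  the triangle inequality. Characters and Young diagrams never enter. Words in single cycles need
  powers of length up to n, which is the origin of n^3. Two steps do better near k = n: a
  transposition of two positions beyond n - k is a product of two quotients of cycles, with no
  powers at all. Only the transpositions that meet the first n - k positions need longer words, and
  their length depends on n - k alone.\<close>

definition ip :: "'b set \<Rightarrow> ('b \<Rightarrow> real) \<Rightarrow> ('b \<Rightarrow> real) \<Rightarrow> real" where
  "ip G f g = (\<Sum>x\<in>G. f x * g x)"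

lemma ip_commute: "ip G f g = ip G g f"
  by (simp add: ip_def mult.commute)

lemma ip_add_left: "ip G (\<lambda>x. f x + g x) h = ip G f h + ip G g h"
  by (simp add: ip_def algebra_simps sum.distrib)

lemma ip_diff_left: "ip G (\<lambda>x. f x - g x) h = ip G f h - ip G g h"
  by (simp add: ip_def algebra_simps sum_subtractf)

lemma ip_add_right: "ip G h (\<lambda>x. f x + g x) = ip G h f + ip G h g"
  by (simp add: ip_def algebra_simps sum.distrib)

lemma ip_diff_right: "ip G h (\<lambda>x. f x - g x) = ip G h f - ip G h g"
  by (simp add: ip_def algebra_simps sum_subtractf)

lemma ip_scale_left: "ip G (\<lambda>x. c * f x) h = c * ip G f h"
  by (simp add: ip_def sum_distrib_left mult.assoc)

lemma ip_scale_right: "ip G h (\<lambda>x. c * f x) = c * ip G h f"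
  by (simp add: ip_def sum_distrib_left mult.left_commute)

lemma ip_sum_left: "ip G (\<lambda>x. \<Sum>i\<in>I. f i x) h = (\<Sum>i\<in>I. ip G (f i) h)"
  by (simp add: ip_def sum_distrib_right sum.swap[of _ I])

lemma ip_sum_right: "ip G h (\<lambda>x. \<Sum>i\<in>I. f i x) = (\<Sum>i\<in>I. ip G h (f i))"
  by (simp add: ip_def sum_distrib_left sum.swap[of _ I])

lemma ip_divide_left: "ip G (\<lambda>x. f x / c) h = ip G f h / c"
  by (simp add: ip_def sum_divide_distrib)

lemma ip_divide_right: "ip G h (\<lambda>x. f x / c) = ip G h f / c"
  by (simp add: ip_def sum_divide_distrib)

lemmas ip_linear = ip_add_left ip_add_right ip_diff_left ip_diff_right
  ip_scale_left ip_scale_right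

lemma ip_cong: "(\<And>x. x \<in> G \<Longrightarrow> f x = f' x) \<Longrightarrow> (\<And>x. x \<in> G \<Longrightarrow> g x = g' x) \<Longrightarrow> ip G f g = ip G f' g'"
  by (simp add: ip_def)

lemma ip_self_nonneg: "0 \<le> ip G f f"
  by (simp add: ip_def sum_nonneg)

lemma ip_self_eq_0_iff: "finite G \<Longrightarrow> ip G f f = 0 \<longleftrightarrow> (\<forall>x\<in>G. f x = 0)"
  by (simp add: ip_def sum_nonneg_eq_0_iff)

lemma L2_set_power2: "(L2_set f G)\<^sup>2 = ip G f f"
  by (simp add: L2_set_def ip_def sum_nonneg power2_eq_square)

lemma L2_set_eq_sqrt_ip: "L2_set f G = sqrt (ip G f f)"
  by (simp add: L2_set_def ip_def power2_eq_square)

lemma ip_le_L2_set: "\<bar>ip G f g\<bar> \<le> L2_set f G * L2_set g G"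
proof -
  have "\<bar>ip G f g\<bar> \<le> (\<Sum>x\<in>G. \<bar>f x\<bar> * \<bar>g x\<bar>)"
    unfolding ip_def by (rule order.trans[OF sum_abs]) (simp add: abs_mult)
  then show ?thesis using L2_set_mult_ineq[of f g G] by linarith
qed

lemma ip_power2_le: "(ip G f g)\<^sup>2 \<le> ip G f f * ip G g g"
proof -
  have "\<bar>ip G f g\<bar>\<^sup>2 \<le> (L2_set f G * L2_set g G)\<^sup>2"
    by (intro power_mono ip_le_L2_set) simp
  then show ?thesis by (simp add: power_mult_distrib L2_set_power2)
qed

lemma L2_set_scale: "L2_set (\<lambda>x. c * f x) G = \<bar>c\<bar> * L2_set f G"
  by (simp add: L2_set_eq_sqrt_ip ip_linear real_sqrt_mult flip: mult.assoc)

lemma L2_set_uminus: "L2_set (\<lambda>x. - f x) G = L2_set f G"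
  by (simp add: L2_set_def)

lemma L2_set_sum: "finite I \<Longrightarrow> L2_set (\<lambda>x. \<Sum>i\<in>I. f i x) G \<le> (\<Sum>i\<in>I. L2_set (f i) G)"
proof (induction I rule: finite_induct)
  case empty
  then show ?case by (simp add: L2_set_def)
next
  case (insert i I)
  then show ?case
    using L2_set_triangle_ineq[of "f i" "\<lambda>x. \<Sum>i\<in>I. f i x" G] by simp
qed

lemma continuous_on_ip:
  assumes "\<And>x. x \<in> G \<Longrightarrow> continuous_on UNIV (\<lambda>f. F f x)" "\<And>x. x \<in> G \<Longrightarrow> continuous_on UNIV (\<lambda>f. H f x)"
  shows "continuous_on UNIV (\<lambda>f. ip G (F f) (H f))"
  unfolding ip_def using assms by (intro continuous_intros) auto

section \<open>Maximal eigenvectors and orthonormal systems\<close>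

lemma compact_supported_cube:
  fixes G :: "'b set"
  shows "compact {f::'b \<Rightarrow> real. (\<forall>x\<in>G. f x \<in> {-1..1}) \<and> (\<forall>x. x \<notin> G \<longrightarrow> f x = 0)}"
proof -
  have "compactin (product_topology (\<lambda>_. euclidean) UNIV)
          (PiE UNIV (\<lambda>x. if x \<in> G then {-1..1::real} else {0}))"
    by (subst compactin_PiE) auto
  moreover have "PiE UNIV (\<lambda>x. if x \<in> G then {-1..1::real} else {0}) =
     {f. (\<forall>x\<in>G. f x \<in> {-1..1}) \<and> (\<forall>x. x \<notin> G \<longrightarrow> f x = 0)}"
    by (auto simp: PiE_UNIV_domain Pi_def split: if_splits)
  ultimately show ?thesis
    by (simp add: euclidean_product_topology)
qed

text \<open>The quadratic form of T attains its maximum on the unit sphere of U, and first-order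
  optimality makes the maximizer an eigenvector. Members of U vanish off G: this makes the sphere
  compact in the product topology and lets the eigenvalue equation hold everywhere, not only on
  G.\<close>

lemma exists_max_eigenvector:
  fixes U :: "('b \<Rightarrow> real) set" and T :: "('b \<Rightarrow> real) \<Rightarrow> 'b \<Rightarrow> real"
  assumes fin: "finite G" and clU: "closed U"
    and supp: "\<And>f x. f \<in> U \<Longrightarrow> x \<notin> G \<Longrightarrow> f x = 0"
    and sub: "\<And>f g c. f \<in> U \<Longrightarrow> g \<in> U \<Longrightarrow> (\<lambda>x. f x + c * g x) \<in> U"
    and nz: "f0 \<in> U" "ip G f0 f0 \<noteq> 0"
    and TU: "\<And>f. f \<in> U \<Longrightarrow> T f \<in> U"
    and lin: "\<And>f g c. T (\<lambda>x. f x + c * g x) = (\<lambda>x. T f x + c * T g x)"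
    and sym: "\<And>f g. f \<in> U \<Longrightarrow> g \<in> U \<Longrightarrow> ip G (T f) g = ip G f (T g)"
    and cont: "\<And>x. continuous_on UNIV (\<lambda>f. T f x)"
  obtains \<theta> f where "f \<in> U" "ip G f f = 1" "T f = (\<lambda>x. \<theta> * f x)"
    "\<And>g. g \<in> U \<Longrightarrow> ip G (T g) g \<le> \<theta> * ip G g g"
proof -
  define K where "K = U \<inter> {f. ip G f f = 1}"
  define C where "C = {f::'b \<Rightarrow> real. (\<forall>x\<in>G. f x \<in> {-1..1}) \<and> (\<forall>x. x \<notin> G \<longrightarrow> f x = 0)}"
  have zero: "(\<lambda>x. 0) \<in> U" using sub[OF nz(1) nz(1), of "-1"] by simp
  have scale: "(\<lambda>x. c * g x) \<in> U" if "g \<in> U" for g c using sub[OF zero that] by simp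
  have contq: "continuous_on UNIV (\<lambda>f::'b \<Rightarrow> real. ip G f f)"
    by (intro continuous_on_ip continuous_on_product_coordinates)
  have "closed {f::'b \<Rightarrow> real. ip G f f = 1}"
    using continuous_closed_preimage[OF contq closed_UNIV, of "{1}"] by (simp add: vimage_def)
  then have clK: "closed K" unfolding K_def using clU by blast
  have "K \<subseteq> C"
  proof
    fix f assume f: "f \<in> K"
    have "\<bar>f x\<bar> \<le> 1" if "x \<in> G" for x
    proof -
      have "f x * f x \<le> (\<Sum>x\<in>G. f x * f x)"
        using member_le_sum[OF that, of "\<lambda>x. f x * f x"] fin by simp
      also have "\<dots> = 1" using f by (simp add: K_def ip_def)
      finally have "(f x)\<^sup>2 \<le> 1" by (simp add: power2_eq_square)
      then show ?thesis by (simp add: abs_square_le_1)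
    qed
    then show "f \<in> C" using f supp by (auto simp: C_def K_def abs_le_iff minus_le_iff)
  qed
  then have cK: "compact K"
    using compact_Int_closed[OF compact_supported_cube[of G] clK] by (simp add: C_def Int_absorb1)
  have normal: "(\<lambda>x. (1 / L2_set g G) * g x) \<in> K" if "g \<in> U" "ip G g g \<noteq> 0" for g
  proof -
    have "L2_set g G \<noteq> 0" using that by (metis L2_set_power2 power_zero_numeral)
    moreover have "ip G (\<lambda>x. (1 / L2_set g G) * g x) (\<lambda>x. (1 / L2_set g G) * g x)
        = (L2_set g G)\<^sup>2 / (L2_set g G)\<^sup>2"
      by (simp only: ip_scale_left ip_scale_right L2_set_power2[symmetric])
         (simp add: power2_eq_square)
    ultimately show ?thesis
      using scale[OF that(1), of "1 / L2_set g G"] unfolding K_def by simp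
  qed
  have "K \<noteq> {}" using normal[OF nz] by blast
  moreover have contT: "continuous_on K (\<lambda>f. ip G (T f) f)"
    by (rule continuous_on_subset[OF _ subset_UNIV])
       (intro continuous_on_ip cont continuous_on_product_coordinates)
  ultimately obtain f where f: "f \<in> K" and max: "\<And>g. g \<in> K \<Longrightarrow> ip G (T g) g \<le> ip G (T f) f"
    using continuous_attains_sup[OF cK] by blast
  define \<theta> where "\<theta> = ip G (T f) f"
  have fU: "f \<in> U" and f1: "ip G f f = 1" using f by (auto simp: K_def)
  have Tscale: "T (\<lambda>x. c * g x) = (\<lambda>x. c * T g x)" for c g
  proof -
    have T0: "T (\<lambda>x. 0) = (\<lambda>x. 0)" using lin[of g "-1" g] by simp
    show ?thesis using lin[of "\<lambda>x. 0" c g] by (simp add: T0)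
  qed
  have ray: "ip G (T g) g \<le> \<theta> * ip G g g" if g: "g \<in> U" for g
  proof (cases "ip G g g = 0")
    case True
    then have "ip G (T g) g = 0" using fin by (simp add: ip_self_eq_0_iff) (simp add: ip_def)
    then show ?thesis using True by simp
  next
    case False
    let ?c = "L2_set g G"
    have c: "?c \<noteq> 0" using False by (metis L2_set_power2 power_zero_numeral)
    have "ip G (T g) g / ?c\<^sup>2 \<le> \<theta>"
      using max[OF normal[OF g False]]
      unfolding Tscale ip_scale_left ip_scale_right \<theta>_def[symmetric] by (simp add: power2_eq_square)
    then show ?thesis using c by (simp add: divide_le_eq L2_set_power2[symmetric])
  qed
  \<comment> \<open>The residual of the eigenvalue equation. Moving from f in the direction h raises
    the form above \<theta> times the squared norm by 2 \<epsilon> |h|^2 to first order, so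
    maximality forces h = 0.\<close>
  define h where "h = (\<lambda>x. T f x + (- \<theta>) * f x)"
  have hU: "h \<in> U" unfolding h_def by (intro sub TU fU)
  have quad: "0 \<le> - 2 * \<epsilon> * ip G h h + \<epsilon>\<^sup>2 * (\<theta> * ip G h h - ip G (T h) h)" for \<epsilon> :: real
  proof -
    have *: "ip G h g = ip G (T f) g - \<theta> * ip G f g" for g
      unfolding h_def ip_add_left ip_scale_left by simp
    have "ip G (T f) h = ip G h h + \<theta> * ip G f h" using *[of h] by simp
    moreover have "ip G (T h) f = ip G (T f) h"
      using sym[OF hU fU] by (simp add: ip_commute)
    moreover have "ip G (T (\<lambda>x. f x + \<epsilon> * h x)) (\<lambda>x. f x + \<epsilon> * h x) \<le>
       \<theta> * ip G (\<lambda>x. f x + \<epsilon> * h x) (\<lambda>x. f x + \<epsilon> * h x)"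
      by (intro ray sub fU hU)
    ultimately show ?thesis
      using f1 \<theta>_def[symmetric] ip_commute[of G h f]
      by (simp add: lin ip_linear power2_eq_square algebra_simps)
  qed
  have "ip G h h = 0"
  proof (rule ccontr)
    assume "ip G h h \<noteq> 0"
    then have hp: "ip G h h > 0" using ip_self_nonneg[of G h] by simp
    define b where "b = \<theta> * ip G h h - ip G (T h) h"
    \<comment> \<open>Small enough for the quadratic term to be at most half of the linear
      one.\<close>
    define e where "e = ip G h h / (\<bar>b\<bar> + 1)"
    have e: "e > 0" using hp by (simp add: e_def)
    have "0 \<le> e * (- 2 * ip G h h + e * b)" using quad[of e] by (simp add: b_def power2_eq_square algebra_simps)
    then have "2 * ip G h h \<le> e * b" using e by (simp add: zero_le_mult_iff)
    also have "e * b \<le> e * (\<bar>b\<bar> + 1)" using e by (intro mult_left_mono) auto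
    also have "\<dots> = ip G h h" by (simp add: e_def)
    finally show False using hp by simp
  qed
  then have "h x = 0" for x using fin hU supp by (cases "x \<in> G") (auto simp: ip_self_eq_0_iff)
  then have "T f = (\<lambda>x. \<theta> * f x)" by (auto simp: h_def fun_eq_iff)
  then show thesis using that fU f1 ray by blast
qed

text \<open>The last clause says dually that each e i lies in the span of the \<phi> k. The \<phi> k
  may be dependent, hence only d at most card I; this suffices for the dimension count of the unit
  mass.\<close>

lemma gram_schmidt:
  fixes \<phi> :: "'i \<Rightarrow> 'b \<Rightarrow> real"
  assumes "finite G" "finite I"
  shows "\<exists>(d::nat) e. d \<le> card I \<and>
    (\<forall>i<d. \<forall>j<d. ip G (e i) (e j) = (if i = j then 1 else 0)) \<and>
    (\<forall>k\<in>I. \<exists>c. \<forall>x\<in>G. \<phi> k x = (\<Sum>i<d. c i * e i x)) \<and>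
    (\<forall>u. (\<forall>k\<in>I. ip G (\<phi> k) u = 0) \<longrightarrow> (\<forall>i<d. ip G (e i) u = 0))"
  using assms(2)
proof (induction I rule: finite_induct)
  case empty
  then show ?case by (intro exI[of _ 0]) auto
next
  case (insert k I)
  from insert.IH obtain d e where d: "d \<le> card I"
    and on': "\<forall>i<d. \<forall>j<d. ip G (e i) (e j) = (if i = j then 1 else 0)"
    and sp': "\<forall>k\<in>I. \<exists>c. \<forall>x\<in>G. \<phi> k x = (\<Sum>i<d. c i * e i x)"
    and orth': "\<forall>u. (\<forall>k\<in>I. ip G (\<phi> k) u = 0) \<longrightarrow> (\<forall>i<d. ip G (e i) u = 0)"
    by (elim exE conjE)
  have on: "ip G (e i) (e j) = (if i = j then 1 else 0)" if "i < d" "j < d" for i j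
    using on' that by blast
  have sp: "\<exists>c. \<forall>x\<in>G. \<phi> k x = (\<Sum>i<d. c i * e i x)" if "k \<in> I" for k
    using sp' that by blast
  have orth: "ip G (e i) u = 0" if "\<forall>k\<in>I. ip G (\<phi> k) u = 0" "i < d" for u i
    using orth' that by blast
  define c where "c i = ip G (\<phi> k) (e i)" for i
  define r where "r x = \<phi> k x - (\<Sum>i<d. c i * e i x)" for x
  have r_orth: "ip G r (e j) = 0" if "j < d" for j
  proof -
    have "ip G r (e j) = c j - (\<Sum>i<d. c i * ip G (e i) (e j))"
      unfolding r_def by (simp add: ip_diff_left ip_sum_left ip_scale_left c_def)
    also have "(\<Sum>i<d. c i * ip G (e i) (e j)) = (\<Sum>i<d. if i = j then c i else 0)"
      using that by (intro sum.cong) (auto simp: on)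
    finally show ?thesis using that by simp
  qed
  show ?case
  proof (cases "ip G r r = 0")
    case True
    then have "\<phi> k x = (\<Sum>i<d. c i * e i x)" if "x \<in> G" for x
      using that assms(1) by (auto simp: ip_self_eq_0_iff r_def)
    then have "\<exists>c. \<forall>x\<in>G. \<phi> k x = (\<Sum>i<d. c i * e i x)" by blast
    then show ?thesis using d on sp orth insert.hyps by (intro exI[of _ d] exI[of _ e]) auto
  next
    case False
    define N where "N = L2_set r G"
    have N: "N \<noteq> 0" using False by (metis L2_set_power2 power_zero_numeral N_def)
    define e' where "e' i = (if i < d then e i else (\<lambda>x. (1/N) * r x))" for i
    have "ip G (e' i) (e' j) = (if i = j then 1 else 0)" if "i < Suc d" "j < Suc d" for i j
    proof -
      have "ip G (\<lambda>x. (1/N) * r x) (\<lambda>x. (1/N) * r x) = N\<^sup>2 / N\<^sup>2"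
        by (simp only: ip_scale_left ip_scale_right N_def L2_set_power2[symmetric])
           (simp add: power2_eq_square)
      then show ?thesis
        using that N r_orth[of i] r_orth[of j] ip_commute[of G "e i" r]
        by (cases "i < d"; cases "j < d") (simp_all add: e'_def on ip_divide_left ip_divide_right)
    qed
    moreover have "\<exists>c. \<forall>x\<in>G. \<phi> k' x = (\<Sum>i<Suc d. c i * e' i x)" if "k' \<in> insert k I" for k'
    proof (cases "k' = k")
      case True
      have "\<phi> k x = (\<Sum>i<Suc d. (if i < d then c i else N) * e' i x)" for x
        using N by (simp add: e'_def r_def)
      then show ?thesis unfolding True by (intro exI[of _ "\<lambda>i. if i < d then c i else N"]) blast
    next
      case False
      then obtain c' where c': "\<forall>x\<in>G. \<phi> k' x = (\<Sum>i<d. c' i * e i x)" using sp \<open>k' \<in> insert k I\<close> by blast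
      have "\<forall>x\<in>G. \<phi> k' x = (\<Sum>i<Suc d. (if i < d then c' i else 0) * e' i x)"
        using c' by (simp add: e'_def)
      then show ?thesis by (intro exI[of _ "\<lambda>i. if i < d then c' i else 0"])
    qed
    moreover have "ip G (e' i) u = 0" if u: "\<forall>k'\<in>insert k I. ip G (\<phi> k') u = 0" and i: "i < Suc d" for u i
    proof -
      have *: "ip G (e i) u = 0" if "i < d" for i using u orth that by auto
      have "ip G r u = ip G (\<phi> k) u - (\<Sum>i<d. c i * ip G (e i) u)"
        unfolding r_def by (simp add: ip_diff_left ip_sum_left ip_scale_left)
      also have "\<dots> = 0" using u * by simp
      finally show ?thesis using * i by (auto simp: e'_def ip_divide_left)
    qed
    ultimately show ?thesis using d insert.hyps by (intro exI[of _ "Suc d"] exI[of _ e']) auto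
  qed
qed

subsection \<open>Functions on a symmetric group\<close>

abbreviation perms :: "'a set \<Rightarrow> ('a \<Rightarrow> 'a) set" where
  "perms A \<equiv> {\<sigma>. \<sigma> permutes A}"

lemma sum_permutes_comp_right:
  assumes "\<tau> permutes A"
  shows "(\<Sum>\<sigma> | \<sigma> permutes A. F (\<sigma> \<circ> \<tau>)) = (\<Sum>\<sigma> | \<sigma> permutes A. F \<sigma>)"
  by (rule sum.reindex_bij_witness[of _ "\<lambda>\<sigma>. \<sigma> \<circ> inv' \<tau>" "\<lambda>\<sigma>. \<sigma> \<circ> \<tau>"])
     (use assms in \<open>auto simp: permutes_compose permutes_inv permutes_inv_o comp_assoc\<close>)

lemma sum_permutes_comp_left:
  assumes "\<tau> permutes A"
  shows "(\<Sum>\<sigma> | \<sigma> permutes A. F (\<tau> \<circ> \<sigma>)) = (\<Sum>\<sigma> | \<sigma> permutes A. F \<sigma>)"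
  by (rule sum.reindex_bij_witness[of _ "\<lambda>\<sigma>. inv' \<tau> \<circ> \<sigma>" "\<lambda>\<sigma>. \<tau> \<circ> \<sigma>"])
     (use assms in \<open>auto simp: permutes_compose permutes_inv permutes_inv_o simp flip: comp_assoc\<close>)

lemma sum_permutes_inv:
  "(\<Sum>\<sigma> | \<sigma> permutes A. F (inv' \<sigma>)) = (\<Sum>\<sigma> | \<sigma> permutes A. F \<sigma>)"
  by (rule sum.reindex_bij_witness[of _ inv' inv']) (auto simp: permutes_inv permutes_inv_inv)

lemma sum_permutes_conj:
  fixes \<tau> :: "'a \<Rightarrow> 'a"
  assumes "bij \<tau>"
  shows "(\<Sum>\<rho> | \<rho> permutes (\<tau> ` Z). F \<rho>) = (\<Sum>\<rho> | \<rho> permutes Z. F (\<tau> \<circ> \<rho> \<circ> inv' \<tau>))"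
proof (rule sum.reindex_bij_witness[of _ "\<lambda>\<rho>. \<tau> \<circ> \<rho> \<circ> inv' \<tau>" "\<lambda>\<rho>. inv' \<tau> \<circ> \<rho> \<circ> \<tau>"])
  have i1: "inv' \<tau> (\<tau> x) = x" for x using assms by (simp add: bij_is_inj)
  have i2: "\<tau> (inv' \<tau> x) = x" for x using assms by (simp add: bij_is_surj surj_f_inv_f)
  have conj: "\<alpha> \<circ> \<rho> \<circ> \<beta> permutes (\<alpha> ` Z)"
    if \<rho>: "\<rho> permutes Z" and ab: "\<And>x. \<alpha> (\<beta> x) = x" "\<And>x. \<beta> (\<alpha> x) = x" for \<alpha> \<beta> \<rho> :: "'a \<Rightarrow> 'a" and Z
  proof -
    have "\<beta> \<circ> \<alpha> = id" "\<alpha> \<circ> \<beta> = id" using ab by auto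
    then have "bij \<alpha>" "bij \<beta>" by (auto intro: o_bij)
    then have "bij (\<alpha> \<circ> \<rho> \<circ> \<beta>)" using permutes_bij[OF \<rho>] by (intro bij_comp)
    moreover have "(\<alpha> \<circ> \<rho> \<circ> \<beta>) x = x" if "x \<notin> \<alpha> ` Z" for x
    proof -
      have "\<beta> x \<notin> Z" using that ab(1)[of x] by (metis image_eqI)
      then show ?thesis using \<rho> ab by (simp add: permutes_not_in)
    qed
    ultimately show ?thesis unfolding permutes_def bij_iff by blast
  qed
  fix \<rho> :: "'a \<Rightarrow> 'a"
  show "\<tau> \<circ> (inv' \<tau> \<circ> \<rho> \<circ> \<tau>) \<circ> inv' \<tau> = \<rho>" by (auto simp: fun_eq_iff i1 i2)
  then show "F (\<tau> \<circ> (inv' \<tau> \<circ> \<rho> \<circ> \<tau>) \<circ> inv' \<tau>) = F \<rho>" by simp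
  show "inv' \<tau> \<circ> (\<tau> \<circ> \<rho> \<circ> inv' \<tau>) \<circ> \<tau> = \<rho>" by (auto simp: fun_eq_iff i1 i2)
  show "\<tau> \<circ> \<rho> \<circ> inv' \<tau> \<in> {\<rho>. \<rho> permutes \<tau> ` Z}" if "\<rho> \<in> perms Z"
    using conj[of \<rho> Z \<tau> "inv' \<tau>"] that i1 i2 by simp
  show "inv' \<tau> \<circ> \<rho> \<circ> \<tau> \<in> perms Z" if "\<rho> \<in> {\<rho>. \<rho> permutes \<tau> ` Z}"
    using conj[of \<rho> "\<tau> ` Z" "inv' \<tau>" \<tau>] that i1 i2 by (simp add: image_image)
qed

section \<open>Coset sums over label subgroups, and stars of transpositions\<close>

definition symz :: "'a set \<Rightarrow> (('a \<Rightarrow> 'a) \<Rightarrow> real) \<Rightarrow> ('a \<Rightarrow> 'a) \<Rightarrow> real" where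
  "symz Z f \<sigma> = (\<Sum>\<rho> | \<rho> permutes Z. f (\<rho> \<circ> \<sigma>))"

text \<open>When k is the largest label in an initial segment X, this is the action of a
  Jucys-Murphy element, whose eigenvalues are contents of boxes in Young diagrams.\<close>

definition star_sum :: "'a set \<Rightarrow> 'a \<Rightarrow> (('a \<Rightarrow> 'a) \<Rightarrow> real) \<Rightarrow> ('a \<Rightarrow> 'a) \<Rightarrow> real" where
  "star_sum X k f \<sigma> = (\<Sum>a\<in>X - {k}. f (transpose a k \<circ> \<sigma>))"

lemma symz_comp:
  assumes "\<rho> permutes Z"
  shows "symz Z f (\<rho> \<circ> \<sigma>) = symz Z f \<sigma>"
  unfolding symz_def using sum_permutes_comp_right[OF assms, of "\<lambda>\<rho>. f (\<rho> \<circ> \<sigma>)"]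
  by (simp add: comp_assoc)

lemma symz_comp_absorb:
  assumes "\<rho> permutes Z"
  shows "symz Z (\<lambda>\<sigma>. f (\<rho> \<circ> \<sigma>)) \<sigma> = symz Z f \<sigma>"
  unfolding symz_def using sum_permutes_comp_left[OF assms, of "\<lambda>\<rho>. f (\<rho> \<circ> \<sigma>)"]
  by (simp add: comp_assoc)

text \<open>Up to the order of the subgroup, \<open>symz\<close> is the orthogonal projection to the
  functions invariant under relabelling within the set; the larger subgroup absorbs the smaller
  one.\<close>

lemma symz_symz_subset:
  assumes "finite Z" "Z' \<subseteq> Z"
  shows "symz Z (symz Z' f) \<sigma> = fact (card Z') * symz Z f \<sigma>"
proof -
  have fin: "finite Z'" using assms finite_subset by blast
  have "symz Z (symz Z' f) \<sigma> = (\<Sum>\<rho>' | \<rho>' permutes Z'. symz Z (\<lambda>\<sigma>. f (\<rho>' \<circ> \<sigma>)) \<sigma>)"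
    unfolding symz_def by (rule sum.swap)
  also have "\<dots> = (\<Sum>\<rho>' | \<rho>' permutes Z'. symz Z f \<sigma>)"
    using assms by (intro sum.cong refl symz_comp_absorb) (auto intro: permutes_subset)
  finally show ?thesis using card_permutations[OF refl fin] by simp
qed

lemma symz_cong:
  assumes "Z \<subseteq> A" "\<sigma> permutes A" "\<And>\<sigma>. \<sigma> permutes A \<Longrightarrow> f \<sigma> = g \<sigma>"
  shows "symz Z f \<sigma> = symz Z g \<sigma>"
  unfolding symz_def using assms by (intro sum.cong refl) (auto intro: permutes_compose permutes_subset)

lemma symz_zero_mono:
  assumes "finite A" "Z \<subseteq> A" "Z' \<subseteq> Z" and "\<And>\<sigma>. \<sigma> permutes A \<Longrightarrow> symz Z' f \<sigma> = 0" and "\<sigma> permutes A"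
  shows "symz Z f \<sigma> = 0"
proof -
  have "symz Z (symz Z' f) \<sigma> = symz Z (\<lambda>_. 0) \<sigma>"
    using assms by (intro symz_cong) auto
  then show ?thesis
    using assms by (subst (asm) symz_symz_subset) (auto simp: symz_def intro: finite_subset)
qed

lemma symz_singleton [simp]: "symz {a} f = f"
proof
  have "{\<rho>. \<rho> permutes {a}} = {id}" by auto
  then show "symz {a} f \<sigma> = f \<sigma>" for \<sigma> by (simp add: symz_def)
qed

lemma symz_commute_disjoint:
  assumes "Y \<inter> Z = {}"
  shows "symz Y (symz Z f) \<sigma> = symz Z (symz Y f) \<sigma>"
proof -
  have *: "\<rho> \<circ> \<rho>' = \<rho>' \<circ> \<rho>" if "\<rho> permutes Y" "\<rho>' permutes Z" for \<rho> \<rho>'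
  proof
    fix x
    have Y: "\<rho> y = y" if "y \<notin> Y" for y using that \<open>\<rho> permutes Y\<close> by (simp add: permutes_not_in)
    have Z: "\<rho>' y = y" if "y \<notin> Z" for y using that \<open>\<rho>' permutes Z\<close> by (simp add: permutes_not_in)
    have "\<rho> x \<in> Y \<longleftrightarrow> x \<in> Y" "\<rho>' x \<in> Z \<longleftrightarrow> x \<in> Z" using that by (auto simp: permutes_in_image)
    moreover have "y \<notin> Z" if "y \<in> Y" for y using that assms by blast
    ultimately show "(\<rho> \<circ> \<rho>') x = (\<rho>' \<circ> \<rho>) x"
      using Y[of x] Z[of x] Y[of "\<rho>' x"] Z[of "\<rho> x"]
      by (cases "x \<in> Y"; cases "x \<in> Z") auto
  qed
  have "symz Y (symz Z f) \<sigma> = (\<Sum>\<rho> | \<rho> permutes Z. \<Sum>\<rho>' | \<rho>' permutes Y. f (\<rho> \<circ> (\<rho>' \<circ> \<sigma>)))"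
    unfolding symz_def by (rule sum.swap)
  also have "\<dots> = (\<Sum>\<rho> | \<rho> permutes Z. \<Sum>\<rho>' | \<rho>' permutes Y. f (\<rho>' \<circ> (\<rho> \<circ> \<sigma>)))"
  proof (intro sum.cong refl)
    fix \<rho> \<rho>' assume "\<rho> \<in> perms Z" "\<rho>' \<in> {\<rho>'. \<rho>' permutes Y}"
    then have "\<rho>' \<circ> \<rho> = \<rho> \<circ> \<rho>'" by (intro *) auto
    then show "f (\<rho> \<circ> (\<rho>' \<circ> \<sigma>)) = f (\<rho>' \<circ> (\<rho> \<circ> \<sigma>))" by (simp only: comp_assoc[symmetric])
  qed
  finally show ?thesis unfolding symz_def .
qed

text \<open>The transpositions \<open>transpose k b\<close> with b in \<open>insert k Y\<close>
  represent the cosets of the smaller group in the larger: b = k gives the first summand, b in Y the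
  star. Thus a nonzero coset sum over Y whose extension by k vanishes exhibits the eigenvalue -1 of
  the star.\<close>

lemma symz_insert:
  assumes "finite Y" "k \<notin> Y"
  shows "symz (insert k Y) f \<sigma> = symz Y f \<sigma> + symz Y (star_sum (insert k Y) k f) \<sigma>"
proof -
  let ?g = "\<lambda>(b, \<rho>). transpose k b \<circ> \<rho>"
  have inj: "inj_on ?g (insert k Y \<times> perms Y)"
  proof (rule inj_onI, clarify)
    fix b \<rho> b' \<rho>'
    assume \<rho>: "\<rho> permutes Y" "\<rho>' permutes Y" and eq: "transpose k b \<circ> \<rho> = transpose k b' \<circ> \<rho>'"
    have "\<rho> k = k" "\<rho>' k = k" using \<rho> assms by (auto simp: permutes_not_in)
    then have "b = b'" using fun_cong[OF eq, of k] by simp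
    moreover have "transpose k b \<circ> (transpose k b \<circ> \<rho>) = transpose k b \<circ> (transpose k b \<circ> \<rho>')"
      using eq \<open>b = b'\<close> by simp
    then have "\<rho> = \<rho>'" by (simp flip: comp_assoc)
    ultimately show "b = b' \<and> \<rho> = \<rho>'" by simp
  qed
  have "symz (insert k Y) f \<sigma>
      = (\<Sum>(b, \<rho>) \<in> insert k Y \<times> perms Y. f (transpose k b \<circ> \<rho> \<circ> \<sigma>))"
  proof -
    have "{\<rho>. \<rho> permutes insert k Y} = ?g ` (insert k Y \<times> perms Y)"
      unfolding permutes_insert by (rule arg_cong[of _ _ "image ?g"]) blast
    then show ?thesis
      unfolding symz_def by (simp only: sum.reindex[OF inj]) (simp add: case_prod_beta)
  qed
  also have "\<dots> = (\<Sum>b\<in>insert k Y. symz Y (\<lambda>\<sigma>. f (transpose k b \<circ> \<sigma>)) \<sigma>)"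
    by (simp add: symz_def comp_assoc flip: sum.cartesian_product)
  also have "\<dots> = symz Y f \<sigma> + (\<Sum>b\<in>Y. symz Y (\<lambda>\<sigma>. f (transpose k b \<circ> \<sigma>)) \<sigma>)"
    using assms by simp
  also have "(\<Sum>b\<in>Y. symz Y (\<lambda>\<sigma>. f (transpose k b \<circ> \<sigma>)) \<sigma>) = symz Y (star_sum (insert k Y) k f) \<sigma>"
    using assms unfolding symz_def star_sum_def
    by (subst sum.swap) (simp add: transpose_commute comp_assoc)
  finally show ?thesis .
qed

text \<open>A permutation \<rho> that fixes k conjugates \<open>transpose a k\<close> to
  \<open>transpose (\<rho> a) k\<close>, so it only permutes the terms of the star.\<close>

lemma star_sum_symz_commute:
  assumes "Y \<subseteq> X - {k}"
  shows "star_sum X k (symz Y f) \<sigma> = symz Y (star_sum X k f) \<sigma>"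
proof -
  have *: "(\<Sum>a\<in>X - {k}. f (\<rho> \<circ> (transpose a k \<circ> \<sigma>))) = (\<Sum>a\<in>X - {k}. f (transpose a k \<circ> (\<rho> \<circ> \<sigma>)))"
    if \<rho>: "\<rho> permutes Y" for \<rho>
  proof -
    have \<rho>X: "\<rho> permutes (X - {k})" using \<rho> assms by (rule permutes_subset)
    have k: "\<rho> k = k" using \<rho>X by (simp add: permutes_not_in)
    have "transpose (\<rho> a) k \<circ> \<rho> = \<rho> \<circ> transpose a k" for a
      using transpose_comp_eq[OF permutes_bij[OF \<rho>], of "\<rho> a" k] permutes_inv_eq[OF \<rho>, of k k] k
      by (simp add: permutes_inverses[OF \<rho>])
    then have "(\<Sum>a\<in>X - {k}. f (\<rho> \<circ> (transpose a k \<circ> \<sigma>))) = (\<Sum>a\<in>X - {k}. f (transpose (\<rho> a) k \<circ> (\<rho> \<circ> \<sigma>)))"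
      by (simp flip: comp_assoc)
    also have "\<dots> = (\<Sum>a\<in>\<rho> ` (X - {k}). f (transpose a k \<circ> (\<rho> \<circ> \<sigma>)))"
      using permutes_inj_on[OF \<rho>X] by (subst sum.reindex) auto
    finally show ?thesis using permutes_image[OF \<rho>X] by simp
  qed
  have "star_sum X k (symz Y f) \<sigma> = (\<Sum>\<rho> | \<rho> permutes Y. \<Sum>a\<in>X - {k}. f (\<rho> \<circ> (transpose a k \<circ> \<sigma>)))"
    unfolding symz_def star_sum_def by (rule sum.swap)
  also have "\<dots> = symz Y (star_sum X k f) \<sigma>"
    unfolding symz_def star_sum_def
    by (rule sum.cong[OF refl]) (use * in blast)
  finally show ?thesis .
qed

text \<open>Conjugation by \<open>transpose b k\<close> exchanges the groups of
  \<open>insert k Y\<close> and \<open>insert b Y\<close>. It turns the unwanted terms of a star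
  into coset sums over \<open>insert b Y\<close>, which vanish when Y is maximal.\<close>

lemma symz_transpose:
  assumes "b \<notin> Y" "k \<notin> Y"
  shows "symz (insert k Y) f (transpose b k \<circ> \<sigma>) = symz (insert b Y) (\<lambda>\<sigma>. f (transpose b k \<circ> \<sigma>)) \<sigma>"
proof -
  have "transpose b k ` insert k Y = insert b Y"
    using assms by (auto simp: image_iff transpose_def)
  moreover have "transpose b k \<circ> ((transpose b k \<circ> \<rho> \<circ> transpose b k) \<circ> \<sigma>) = \<rho> \<circ> (transpose b k \<circ> \<sigma>)" for \<rho>
    by (auto simp: fun_eq_iff)
  ultimately show ?thesis
    unfolding symz_def using sum_permutes_conj[of "transpose b k" "\<lambda>\<rho>. f (transpose b k \<circ> (\<rho> \<circ> \<sigma>))" "insert k Y"]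
    by simp
qed

lemma ip_comp_left:
  assumes "\<tau> permutes A"
  shows "ip (perms A) (\<lambda>\<sigma>. f (\<tau> \<circ> \<sigma>)) g = ip (perms A) f (\<lambda>\<sigma>. g (inv' \<tau> \<circ> \<sigma>))"
  unfolding ip_def
  using sum_permutes_comp_left[OF assms, of "\<lambda>\<sigma>. f \<sigma> * g (inv' \<tau> \<circ> \<sigma>)"] permutes_inv_o(2)[OF assms]
  by (simp flip: comp_assoc)

lemma ip_comp_right:
  assumes "\<tau> permutes A"
  shows "ip (perms A) (\<lambda>\<sigma>. f (\<sigma> \<circ> \<tau>)) g = ip (perms A) f (\<lambda>\<sigma>. g (\<sigma> \<circ> inv' \<tau>))"
  unfolding ip_def
  using sum_permutes_comp_right[OF assms, of "\<lambda>\<sigma>. f \<sigma> * g (\<sigma> \<circ> inv' \<tau>)"] permutes_inv_o(1)[OF assms]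
  by (simp add: comp_assoc)

lemma ip_symz:
  assumes "Z \<subseteq> A"
  shows "ip (perms A) (symz Z f) g = ip (perms A) f (symz Z g)"
proof -
  have "ip (perms A) (symz Z f) g
      = (\<Sum>\<rho> | \<rho> permutes Z. ip (perms A) f (\<lambda>\<sigma>. g (inv' \<rho> \<circ> \<sigma>)))"
    unfolding symz_def ip_sum_left
    using assms by (intro sum.cong refl ip_comp_left) (auto intro: permutes_subset)
  also have "\<dots> = (\<Sum>\<rho> | \<rho> permutes Z. ip (perms A) f (\<lambda>\<sigma>. g (\<rho> \<circ> \<sigma>)))"
    by (rule sum_permutes_inv[of "\<lambda>\<rho>. ip (perms A) f (\<lambda>\<sigma>. g (\<rho> \<circ> \<sigma>))"])
  also have "\<dots> = ip (perms A) f (symz Z g)"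
    unfolding symz_def by (rule ip_sum_right[symmetric])
  finally show ?thesis .
qed

lemma ip_star_sum:
  assumes "X \<subseteq> A" "k \<in> X"
  shows "ip (perms A) (star_sum X k f) g = ip (perms A) f (star_sum X k g)"
  unfolding star_sum_def ip_sum_left ip_sum_right
proof (intro sum.cong refl)
  fix a assume "a \<in> X - {k}"
  then have "transpose a k permutes A" using assms by (intro permutes_swap_id) auto
  from ip_comp_left[OF this, of f g]
  show "ip (perms A) (\<lambda>\<sigma>. f (transpose a k \<circ> \<sigma>)) g = ip (perms A) f (\<lambda>\<sigma>. g (transpose a k \<circ> \<sigma>))"
    by simp
qed

lemma star_sum_cong:
  assumes "X \<subseteq> A" "k \<in> X" "\<sigma> permutes A" "\<And>\<sigma>. \<sigma> permutes A \<Longrightarrow> f \<sigma> = g \<sigma>"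
  shows "star_sum X k f \<sigma> = star_sum X k g \<sigma>"
  unfolding star_sum_def
  using assms by (intro sum.cong refl assms(4) permutes_compose permutes_swap_id) auto

lemma permutes_comp_iff:
  assumes "\<tau> permutes A"
  shows "\<tau> \<circ> \<sigma> permutes A \<longleftrightarrow> \<sigma> permutes A"
proof
  assume "\<tau> \<circ> \<sigma> permutes A"
  then have "inv' \<tau> \<circ> (\<tau> \<circ> \<sigma>) permutes A"
    by (rule permutes_compose[OF _ permutes_inv[OF assms]])
  moreover have "inv' \<tau> \<circ> (\<tau> \<circ> \<sigma>) = \<sigma>"
    by (simp add: fun_eq_iff permutes_inverses[OF assms])
  ultimately show "\<sigma> permutes A" by simp
qed (use assms in \<open>auto intro: permutes_compose\<close>)

text \<open>
  By invariance it suffices to bound the eigenvalue \<open>\<theta>\<close> of a maximal eigenvector \<open>h\<close> in the space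
  of admissible functions. Let \<open>Y \<subseteq> X - {k}\<close> be as large as possible with \<open>symz Y h \<noteq> 0\<close>. If
  \<open>symz (insert k Y) h \<noteq> 0\<close>, pairing it with \<open>h\<close> gives \<open>\<theta> = card Y\<close>. Otherwise the star on
  \<open>insert k Y\<close> acts on \<open>symz Y h\<close> as \<open>-1\<close>, so the star on \<open>X - Y\<close> acts as \<open>\<theta> + 1\<close> and the induction
  hypothesis applies.
\<close>

lemma star_sum_le:
  fixes f :: "('a \<Rightarrow> 'a) \<Rightarrow> real"
  assumes finA: "finite A" and XA: "X \<subseteq> A" and kX: "k \<in> X"
    and vanish: "\<And>Z \<sigma>. Z \<subseteq> X \<Longrightarrow> card Z = Suc s \<Longrightarrow> \<sigma> permutes A \<Longrightarrow> symz Z f \<sigma> = 0"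
  shows "ip (perms A) (star_sum X k f) f \<le> (real s - 1) * ip (perms A) f f"
  using XA kX vanish
\<comment> \<open>The group stays that of A while X shrinks, so the induction hypothesis speaks
  about the same function space.\<close>
proof (induction "card X" arbitrary: X f rule: less_induct)
  case less
  define G where "G = (perms A)"
  have finG: "finite G" unfolding G_def using finA by (rule finite_permutations)
  have finX: "finite X" using less.prems(1) finA finite_subset by blast
  define U where "U = (\<Inter>\<sigma>\<in>-G. {f::('a\<Rightarrow>'a)\<Rightarrow>real. f \<sigma> = 0}) \<inter>
     (\<Inter>Z\<in>{Z. Z \<subseteq> X \<and> card Z = Suc s}. \<Inter>\<sigma>\<in>G. {f. symz Z f \<sigma> = 0})"
  have U: "f \<in> U \<longleftrightarrow> (\<forall>\<sigma>. \<sigma> \<notin> G \<longrightarrow> f \<sigma> = 0) \<and>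
     (\<forall>Z. Z \<subseteq> X \<longrightarrow> card Z = Suc s \<longrightarrow> (\<forall>\<sigma>\<in>G. symz Z f \<sigma> = 0))" for f
    unfolding U_def by auto
  have subG: "Z \<subseteq> A" if "Z \<subseteq> X" for Z using that less.prems(1) by blast
  define f' where "f' \<sigma> = (if \<sigma> \<in> G then f \<sigma> else 0)" for \<sigma>
  have ff': "f' \<sigma> = f \<sigma>" if "\<sigma> permutes A" for \<sigma> using that by (simp add: f'_def G_def)
  have f'U: "f' \<in> U"
    unfolding U using less.prems symz_cong[OF subG, of _ _ f' f] ff' by (auto simp: f'_def G_def)
  have ipff': "ip G f f = ip G f' f'" "ip G (star_sum X k f) f = ip G (star_sum X k f') f'"
    using ff' star_sum_cong[OF less.prems(1,2), of _ f' f] by (auto intro!: ip_cong simp: G_def)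
  show ?case
  proof (cases "ip G f' f' = 0")
    case True
    then have "ip G (star_sum X k f') f' = 0"
      using finG by (simp add: ip_self_eq_0_iff) (simp add: ip_def)
    then show ?thesis using True ipff' unfolding G_def by simp
  next
    case False
    obtain \<theta> h where hU: "h \<in> U" and h1: "ip G h h = 1" and eig: "star_sum X k h = (\<lambda>x. \<theta> * h x)"
      and max: "\<And>g. g \<in> U \<Longrightarrow> ip G (star_sum X k g) g \<le> \<theta> * ip G g g"
    proof (rule exists_max_eigenvector[of G U f' "star_sum X k"])
      show "closed U"
        unfolding U_def symz_def
        by (intro closed_Int closed_INT ballI closed_Collect_eq continuous_intros continuous_on_product_coordinates)
      show "(\<lambda>x. f x + c * g x) \<in> U" if "f \<in> U" "g \<in> U" for f g c
        using that unfolding U by (auto simp: symz_def sum.distrib simp flip: sum_distrib_left)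
      show "star_sum X k f \<in> U" if f: "f \<in> U" for f
        unfolding U
      proof (intro conjI allI impI ballI)
        fix \<sigma> assume "\<sigma> \<notin> G"
        then have "transpose a k \<circ> \<sigma> \<notin> G" if "a \<in> X" for a
          unfolding G_def using that less.prems(1,2) permutes_comp_iff[OF permutes_swap_id[of a A k]] by auto
        then show "star_sum X k f \<sigma> = 0" using f unfolding U by (auto simp: star_sum_def)
      next
        fix Z \<sigma> assume Z: "Z \<subseteq> X" "card Z = Suc s" and \<sigma>: "\<sigma> \<in> G"
        have "symz Z (star_sum X k f) \<sigma> = (\<Sum>a\<in>X - {k}. symz Z (\<lambda>\<sigma>. f (transpose a k \<circ> \<sigma>)) \<sigma>)"
          unfolding symz_def star_sum_def by (rule sum.swap)
        also have "\<dots> = 0"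
        proof (intro sum.neutral ballI)
          fix a assume a: "a \<in> X - {k}"
          let ?t = "transpose a k"
          have "?t permutes A" using a less.prems by (intro permutes_swap_id) auto
          then have t: "?t \<circ> \<sigma> \<in> G" using \<sigma> by (auto simp: G_def intro: permutes_compose)
          have "?t ` Z \<subseteq> X" using Z(1) a less.prems(2) by (auto simp: transpose_def)
          moreover have "card (?t ` Z) = Suc s" using Z(2) by (simp add: card_image)
          ultimately have "symz (?t ` Z) f (?t \<circ> \<sigma>) = 0" using f t unfolding U by blast
          moreover have "(?t \<circ> \<rho> \<circ> ?t) \<circ> (?t \<circ> \<sigma>) = ?t \<circ> (\<rho> \<circ> \<sigma>)" for \<rho>
            by (simp add: fun_eq_iff)
          ultimately show "symz Z (\<lambda>\<sigma>. f (?t \<circ> \<sigma>)) \<sigma> = 0"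
            unfolding symz_def
            using sum_permutes_conj[of ?t "\<lambda>\<rho>. f (\<rho> \<circ> (?t \<circ> \<sigma>))" Z] by simp
        qed
        finally show "symz Z (star_sum X k f) \<sigma> = 0" .
      qed
      show "star_sum X k (\<lambda>x. f x + c * g x) = (\<lambda>x. star_sum X k f x + c * star_sum X k g x)" for f g c
        by (simp add: star_sum_def sum.distrib sum_distrib_left fun_eq_iff)
      show "ip G (star_sum X k f) g = ip G f (star_sum X k g)" for f g
        unfolding G_def by (rule ip_star_sum[OF less.prems(1,2)])
      show "continuous_on UNIV (\<lambda>f. star_sum X k f x)" for x
        unfolding star_sum_def by (intro continuous_intros continuous_on_product_coordinates)
    qed (use finG f'U False U in auto)
    have hnz: "\<exists>\<sigma>\<in>G. h \<sigma> \<noteq> 0" using h1 ip_self_eq_0_iff[OF finG, of h] by auto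
    have hvan: "symz Z h \<sigma> = 0" if "Z \<subseteq> X" "card Z \<ge> Suc s" "\<sigma> \<in> G" for Z \<sigma>
    proof -
      from that(2) obtain Z' where Z': "Z' \<subseteq> Z" "card Z' = Suc s"
        using obtain_subset_with_card_n by metis
      have "\<forall>\<sigma>\<in>G. symz Z' h \<sigma> = 0" using hU Z' that(1) unfolding U by blast
      then show ?thesis
        using symz_zero_mono[OF finA subG[OF that(1)] Z'(1), of h \<sigma>] that(3) by (auto simp: G_def)
    qed
    have "\<theta> \<le> real s - 1"
    proof (cases "X = {k}")
      case True
      then have "\<theta> * h \<sigma> = 0" for \<sigma> using fun_cong[OF eig, of \<sigma>] by (simp add: star_sum_def)
      then have "\<theta> = 0" using hnz by auto
      \<comment> \<open>The bound s - 1 must not be negative here. For s = 0 the vanishing on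
        singletons would be h = 0.\<close>
      moreover have "s \<noteq> 0"
      proof
        assume "s = 0"
        then have "symz {k} h \<sigma> = 0" if "\<sigma> \<in> G" for \<sigma> using that hvan[of "{k}" \<sigma>] True by simp
        then show False using hnz by auto
      qed
      ultimately show ?thesis by simp
    next
      case False
      define P where "P t \<longleftrightarrow> (\<exists>Y. Y \<subseteq> X - {k} \<and> card Y = t \<and> (\<exists>\<sigma>\<in>G. symz Y h \<sigma> \<noteq> 0))" for t
      have bound: "t \<le> card X" if "P t" for t
        using that finX unfolding P_def by (meson card_mono Diff_subset order_trans)
      obtain a where "a \<in> X - {k}" using False less.prems(2) by auto
      \<comment> \<open>A coset sum over a singleton is h itself, so the maximal Y is nonempty and X
        - Y is strictly smaller than X.\<close>
      then have P1: "P 1" unfolding P_def using hnz by (intro exI[of _ "{a}"]) auto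
      define t where "t = (GREATEST t. P t)"
      have Pt: "P t" unfolding t_def using P1 bound by (rule GreatestI_nat)
      have tmax: "t' \<le> t" if "P t'" for t' unfolding t_def using that bound by (rule Greatest_le_nat)
      have t1: "t \<ge> 1" using tmax[OF P1] .
      obtain Y where Y: "Y \<subseteq> X - {k}" "card Y = t" and gnz: "\<exists>\<sigma>\<in>G. symz Y h \<sigma> \<noteq> 0"
        using Pt unfolding P_def by blast
      have finY: "finite Y" and kY: "k \<notin> Y" using Y(1) finX finite_subset by auto
      define g where "g = symz Y h"
      define g' where "g' = symz (insert k Y) h"
      have kYX: "insert k Y \<subseteq> X" using Y(1) less.prems(2) by auto
      have van: "symz (insert b Y) h \<sigma> = 0" if "b \<in> X - insert k Y" "\<sigma> \<in> G" for b \<sigma>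
      proof (rule ccontr)
        assume "symz (insert b Y) h \<sigma> \<noteq> 0"
        then have "P (Suc t)" unfolding P_def using that Y finY
          by (intro exI[of _ "insert b Y"]) auto
        then show False using tmax by fastforce
      qed
      have gg': "g' \<sigma> = g \<sigma> + star_sum (insert k Y) k g \<sigma>" for \<sigma>
        unfolding g'_def g_def using symz_insert[OF finY kY, of h \<sigma>] star_sum_symz_commute[of Y "insert k Y" k h \<sigma>] kY by auto
      have split: "star_sum X k u \<sigma> = star_sum (insert k Y) k u \<sigma> + star_sum (X - Y) k u \<sigma>" for u \<sigma>
      proof -
        have "X - {k} = (insert k Y - {k}) \<union> ((X - Y) - {k})" using Y(1) by auto
        then show ?thesis unfolding star_sum_def
          using finX finY by (simp only:) (rule sum.union_disjoint, auto)
      qed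
      show ?thesis
      proof (cases "\<exists>\<sigma>\<in>G. g' \<sigma> \<noteq> 0")
        case True
        have "t < s"
        proof (rule ccontr)
          assume "\<not> t < s"
          then have "card (insert k Y) \<ge> Suc s" using finY kY Y(2) by simp
          then show False using True hvan[OF kYX] by (auto simp: g'_def)
        qed
        \<comment> \<open>The star is moved to g', where the labels in Y contribute t by invariance.
          The other labels contribute coset sums of h that vanish by the choice of Y.\<close>
        have "\<theta> * ip G h g' = ip G (star_sum X k h) g'" by (simp add: eig ip_scale_left)
        also have "\<dots> = ip G h (star_sum X k g')"
          unfolding G_def by (rule ip_star_sum[OF less.prems(1,2)])
        also have "star_sum X k g' = (\<lambda>\<sigma>. real t * g' \<sigma> + star_sum (X - Y) k g' \<sigma>)"
        proof
          fix \<sigma>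
          have "g' (transpose a k \<circ> \<sigma>) = g' \<sigma>" if "a \<in> Y" for a
            unfolding g'_def using that by (intro symz_comp permutes_swap_id) auto
          then have "star_sum (insert k Y) k g' \<sigma> = real t * g' \<sigma>"
            using kY Y(2) by (simp add: star_sum_def)
          then show "star_sum X k g' \<sigma> = real t * g' \<sigma> + star_sum (X - Y) k g' \<sigma>"
            using split[of g' \<sigma>] by simp
        qed
        also have "ip G h (\<lambda>\<sigma>. real t * g' \<sigma> + star_sum (X - Y) k g' \<sigma>)
           = real t * ip G h g' + ip G h (star_sum (X - Y) k g')"
          by (simp add: ip_linear)
        also have "ip G h (star_sum (X - Y) k g') = 0"
          unfolding star_sum_def ip_sum_right
        proof (intro sum.neutral ballI)
          fix b assume b: "b \<in> X - Y - {k}"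
          have "ip G h (\<lambda>\<sigma>. g' (transpose b k \<circ> \<sigma>))
              = ip G h (symz (insert b Y) (\<lambda>\<sigma>. h (transpose b k \<circ> \<sigma>)))"
            unfolding g'_def using b kY by (simp add: symz_transpose)
          also have "\<dots> = ip G (symz (insert b Y) h) (\<lambda>\<sigma>. h (transpose b k \<circ> \<sigma>))"
            unfolding G_def using b Y(1) less.prems(1) by (intro ip_symz[symmetric]) auto
          also have "\<dots> = 0" using van[of b] b by (simp add: ip_def)
          finally show "ip G h (\<lambda>\<sigma>. g' (transpose b k \<circ> \<sigma>)) = 0" .
        qed
        finally have "\<theta> * ip G h g' = real t * ip G h g'" by simp
        \<comment> \<open>g' is a positive multiple of an orthogonal projection of h, so this
          product is a positive multiple of the squared norm of g'.\<close>
        moreover have "ip G h g' \<noteq> 0"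
        proof
          assume z: "ip G h g' = 0"
          have "ip G g' g' = ip G h (symz (insert k Y) g')"
            unfolding g'_def G_def using kYX less.prems(1) by (intro ip_symz) auto
          also have "symz (insert k Y) g' = (\<lambda>\<sigma>. fact (card (insert k Y)) * g' \<sigma>)"
            unfolding g'_def using finY by (auto simp: symz_symz_subset)
          finally have "ip G g' g' = 0" using z by (simp add: ip_scale_right)
          then show False using True finG by (simp add: ip_self_eq_0_iff)
        qed
        ultimately show ?thesis using \<open>t < s\<close> by simp
      next
        case False
        have star_g: "star_sum X k g \<sigma> = \<theta> * g \<sigma>" for \<sigma>
          unfolding g_def star_sum_symz_commute[OF Y(1)] eig by (simp add: symz_def sum_distrib_left)
        have "star_sum (X - Y) k g \<sigma> = (\<theta> + 1) * g \<sigma>" if "\<sigma> \<in> G" for \<sigma>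
          using split[of g \<sigma>] gg'[of \<sigma>] False that star_g[of \<sigma>] by (simp add: algebra_simps)
        then have "ip G (star_sum (X - Y) k g) g = (\<theta> + 1) * ip G g g"
          by (subst ip_scale_left[symmetric]) (rule ip_cong, auto)
        moreover have "ip G (star_sum (X - Y) k g) g \<le> (real s - 1) * ip G g g"
          unfolding G_def
        proof (rule less.hyps)
          have "X - Y \<subset> X" using t1 Y proof -
            have "Y \<noteq> {}" using t1 Y(2) by auto
            then show ?thesis using Y(1) by auto
          qed
          then show "card (X - Y) < card X" using finX by (rule psubset_card_mono[rotated])
          show "X - Y \<subseteq> A" "k \<in> X - Y" using less.prems kY by auto
          fix Z \<sigma> assume Z: "Z \<subseteq> X - Y" "card Z = Suc s" and \<sigma>: "\<sigma> permutes A"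
          have "symz Z g \<sigma> = symz Y (symz Z h) \<sigma>"
            unfolding g_def using Z(1) by (intro symz_commute_disjoint) auto
          also have "\<dots> = symz Y (\<lambda>_. 0) \<sigma>"
          proof (rule symz_cong[OF _ \<sigma>])
            show "Y \<subseteq> A" using Y(1) less.prems(1) by auto
            show "symz Z h \<sigma>' = 0" if "\<sigma>' permutes A" for \<sigma>'
              using hvan[of Z \<sigma>'] Z that by (auto simp: G_def)
          qed
          finally show "symz Z g \<sigma> = 0" by (simp add: symz_def)
        qed
        moreover have "ip G g g > 0"
          using gnz finG ip_self_nonneg[of G g] ip_self_eq_0_iff[of G g] unfolding g_def by force
        ultimately have "\<theta> + 1 \<le> real s - 1" by simp
        then show ?thesis by simp
      qed
    qed
    then have "\<theta> * ip G f' f' \<le> (real s - 1) * ip G f' f'"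
      by (intro mult_right_mono ip_self_nonneg)
    then have "ip G (star_sum X k f) f \<le> (real s - 1) * ip G f f"
      unfolding ipff' by (rule order.trans[OF max[OF f'U]])
    then show ?thesis unfolding G_def .
  qed
qed

subsection \<open>The spectral gap of random transpositions\<close>

text \<open>Orthogonality to all functions of the positions of card A - j labels. In terms of
  representations: only the components whose Young diagram has a first row shorter than j.\<close>

definition sym_null :: "'a set \<Rightarrow> nat \<Rightarrow> (('a \<Rightarrow> 'a) \<Rightarrow> real) \<Rightarrow> bool" where
  "sym_null A j f \<longleftrightarrow> (\<forall>Z \<sigma>. Z \<subseteq> A \<longrightarrow> card Z = j \<longrightarrow> \<sigma> permutes A \<longrightarrow> symz Z f \<sigma> = 0)"

lemma sym_null_mono:
  assumes "finite A" "sym_null A j f" "j \<le> j'"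
  shows "sym_null A j' f"
  unfolding sym_null_def
proof (intro allI impI)
  fix Z \<sigma> assume Z: "Z \<subseteq> A" "card Z = j'" and \<sigma>: "\<sigma> permutes A"
  obtain Z' where Z': "Z' \<subseteq> Z" "card Z' = j"
    using assms(3) Z(2) obtain_subset_with_card_n by metis
  then show "symz Z f \<sigma> = 0"
    using symz_zero_mono[OF assms(1) Z(1) Z'(1) _ \<sigma>, of f] assms(2) Z(1)
    unfolding sym_null_def by blast
qed

lemma sym_null_diff:
  "sym_null A j f \<Longrightarrow> sym_null A j g \<Longrightarrow> sym_null A j (\<lambda>\<sigma>. f \<sigma> - g \<sigma>)"
  by (simp add: sym_null_def symz_def sum_subtractf)

definition id_mass :: "('a \<Rightarrow> 'a) \<Rightarrow> real" where
  "id_mass \<sigma> = (if \<sigma> = id then 1 else 0)"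

text \<open>As a function of s this is a length on the group: symmetric, subadditive, zero at the
  identity. Half its square is the contribution of s to a Dirichlet form, so comparing two walks
  amounts to bounding lengths of words.\<close>

definition disp :: "'a set \<Rightarrow> ('a \<Rightarrow> 'a) \<Rightarrow> (('a \<Rightarrow> 'a) \<Rightarrow> real) \<Rightarrow> real" where
  "disp A s f = L2_set (\<lambda>\<sigma>. f \<sigma> - f (\<sigma> \<circ> s)) (perms A)"

lemma disp_nonneg [simp]: "0 \<le> disp A s f"
  by (simp add: disp_def)

lemma L2_set_comp_right:
  assumes "s permutes A"
  shows "L2_set (\<lambda>\<sigma>. f (\<sigma> \<circ> s)) (perms A) = L2_set f (perms A)"
  unfolding L2_set_def using sum_permutes_comp_right[OF assms, of "\<lambda>\<sigma>. (f \<sigma>)\<^sup>2"] by simp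

lemma disp_power2:
  assumes "s permutes A"
  shows "(disp A s f)\<^sup>2 = 2 * (ip (perms A) f f - ip (perms A) (\<lambda>\<sigma>. f (\<sigma> \<circ> s)) f)"
proof -
  have "ip (perms A) (\<lambda>\<sigma>. f (\<sigma> \<circ> s)) (\<lambda>\<sigma>. f (\<sigma> \<circ> s)) = ip (perms A) f f"
    using L2_set_comp_right[OF assms, of f] by (simp flip: L2_set_power2)
  then show ?thesis
    unfolding disp_def L2_set_power2 ip_linear
    using ip_commute[of "perms A" f "\<lambda>\<sigma>. f (\<sigma> \<circ> s)"] by simp
qed

lemma disp_id [simp]: "disp A id f = 0"
  by (simp add: disp_def L2_set_def)

lemma disp_comp:
  assumes "s permutes A"
  shows "disp A (s \<circ> t) f \<le> disp A s f + disp A t f"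
proof -
  have "disp A (s \<circ> t) f = L2_set (\<lambda>\<sigma>. (f \<sigma> - f (\<sigma> \<circ> s)) + (f (\<sigma> \<circ> s) - f (\<sigma> \<circ> s \<circ> t))) (perms A)"
    by (simp add: disp_def comp_assoc)
  also have "\<dots> \<le> disp A s f + L2_set (\<lambda>\<sigma>. f (\<sigma> \<circ> s) - f (\<sigma> \<circ> s \<circ> t)) (perms A)"
    unfolding disp_def by (rule L2_set_triangle_ineq)
  also have "L2_set (\<lambda>\<sigma>. f (\<sigma> \<circ> s) - f (\<sigma> \<circ> s \<circ> t)) (perms A) = disp A t f"
    unfolding disp_def using L2_set_comp_right[OF assms, of "\<lambda>\<sigma>. f \<sigma> - f (\<sigma> \<circ> t)"] by simp
  finally show ?thesis .
qed

lemma disp_inv: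
  assumes "s permutes A"
  shows "disp A (inv' s) f = disp A s f"
proof -
  have "disp A (inv' s) f = L2_set (\<lambda>\<sigma>. f (\<sigma> \<circ> s) - f (\<sigma> \<circ> s \<circ> inv' s)) (perms A)"
    unfolding disp_def using L2_set_comp_right[OF assms, of "\<lambda>\<sigma>. f \<sigma> - f (\<sigma> \<circ> inv' s)"] by simp
  also have "\<dots> = L2_set (\<lambda>\<sigma>. - (f \<sigma> - f (\<sigma> \<circ> s))) (perms A)"
    by (simp add: comp_assoc permutes_inv_o(1)[OF assms])
  finally show ?thesis unfolding L2_set_uminus disp_def .
qed

lemma disp_power:
  assumes "s permutes A"
  shows "disp A (s ^^ j) f \<le> real j * disp A s f"
proof (induction j)
  case (Suc j)
  have "disp A (s ^^ Suc j) f \<le> disp A s f + disp A (s ^^ j) f"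
    unfolding funpow.simps(2) by (rule disp_comp[OF assms])
  also have "\<dots> \<le> disp A s f + real j * disp A s f"
    using Suc by simp
  also have "\<dots> = real (Suc j) * disp A s f" by (simp add: algebra_simps)
  finally show ?case .
qed (simp only: funpow.simps(1) disp_id of_nat_0 mult_zero_left order_refl)

text \<open>Multiplying \<sigma> on the right by a transposition of positions is multiplying it on
  the left by the transposition of the labels found there. Over all pairs both sums agree, which
  carries the bound on stars, a statement about labels, to walks on positions.\<close>

lemma sum_star_sum:
  assumes "finite A" "\<sigma> permutes A"
  shows "(\<Sum>a\<in>A. \<Sum>b\<in>A. f (\<sigma> \<circ> transpose a b)) = (\<Sum>k\<in>A. f \<sigma> + star_sum A k f \<sigma>)"
proof -
  have "\<sigma> \<circ> transpose a b = transpose (\<sigma> a) (\<sigma> b) \<circ> \<sigma>" for a b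
    using transpose_comp_eq[OF permutes_bij[OF assms(2)], of "\<sigma> a" "\<sigma> b"]
    by (simp add: permutes_inverses[OF assms(2)])
  then have "(\<Sum>a\<in>A. \<Sum>b\<in>A. f (\<sigma> \<circ> transpose a b)) = (\<Sum>a\<in>A. \<Sum>b\<in>A. f (transpose (\<sigma> a) (\<sigma> b) \<circ> \<sigma>))"
    by simp
  also have "\<dots> = (\<Sum>a\<in>A. \<Sum>b\<in>A. f (transpose a b \<circ> \<sigma>))"
    using assms(2)
      sum.permute[OF assms(2), of "\<lambda>a. \<Sum>b\<in>A. f (transpose a b \<circ> \<sigma>)"]
      sum.permute[OF assms(2), of "\<lambda>b. f (transpose (\<sigma> _) b \<circ> \<sigma>)"]
    by (simp add: o_def)
  also have "\<dots> = (\<Sum>k\<in>A. \<Sum>a\<in>A. f (transpose a k \<circ> \<sigma>))" by (rule sum.swap)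
  also have "\<dots> = (\<Sum>k\<in>A. f \<sigma> + star_sum A k f \<sigma>)"
    using assms(1) by (intro sum.cong refl) (simp add: star_sum_def sum.remove)
  finally show ?thesis .
qed

text \<open>Each of the n stars is at most n - r - 1 and the diagonal pairs add 1 for each k, so all
  ordered pairs together act by at most n (n - r), which leaves n r out of n^2. The factor 2 is that
  of \<open>disp_power2\<close>.\<close>

lemma transposition_gap:
  assumes "finite A" "r \<le> card A" "sym_null A (Suc (card A - r)) f"
  shows "(\<Sum>a\<in>A. \<Sum>b\<in>A. (disp A (transpose a b) f)\<^sup>2)
    \<ge> 2 * real (card A) * real r * ip (perms A) f f"
proof -
  let ?G = "perms A" and ?n = "card A"
  have "(\<Sum>a\<in>A. \<Sum>b\<in>A. (disp A (transpose a b) f)\<^sup>2)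
      = (\<Sum>a\<in>A. \<Sum>b\<in>A. 2 * (ip ?G f f - ip ?G (\<lambda>\<sigma>. f (\<sigma> \<circ> transpose a b)) f))"
    by (intro sum.cong refl disp_power2 permutes_swap_id)
  also have "\<dots> = 2 * (real ?n * real ?n * ip ?G f f - (\<Sum>a\<in>A. \<Sum>b\<in>A. ip ?G (\<lambda>\<sigma>. f (\<sigma> \<circ> transpose a b)) f))"
    by (simp add: sum_subtractf flip: sum_distrib_left)
  finally have eq: "(\<Sum>a\<in>A. \<Sum>b\<in>A. (disp A (transpose a b) f)\<^sup>2)
      = 2 * (real ?n * real ?n * ip ?G f f - (\<Sum>a\<in>A. \<Sum>b\<in>A. ip ?G (\<lambda>\<sigma>. f (\<sigma> \<circ> transpose a b)) f))" .
  have "(\<Sum>a\<in>A. \<Sum>b\<in>A. ip ?G (\<lambda>\<sigma>. f (\<sigma> \<circ> transpose a b)) f)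
     = ip ?G (\<lambda>\<sigma>. \<Sum>a\<in>A. \<Sum>b\<in>A. f (\<sigma> \<circ> transpose a b)) f"
    by (simp add: ip_sum_left)
  also have "\<dots> = ip ?G (\<lambda>\<sigma>. \<Sum>k\<in>A. f \<sigma> + star_sum A k f \<sigma>) f"
    using sum_star_sum[OF assms(1)] by (intro ip_cong) auto
  also have "\<dots> = (\<Sum>k\<in>A. ip ?G f f + ip ?G (star_sum A k f) f)"
    by (simp add: ip_sum_left ip_add_left)
  also have "\<dots> \<le> (\<Sum>k\<in>A. ip ?G f f + (real (?n - r) - 1) * ip ?G f f)"
    using assms by (intro sum_mono add_left_mono star_sum_le) (auto simp: sym_null_def)
  finally have *: "(\<Sum>a\<in>A. \<Sum>b\<in>A. ip ?G (\<lambda>\<sigma>. f (\<sigma> \<circ> transpose a b)) f)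
     \<le> real ?n * real (?n - r) * ip ?G f f"
    by (simp add: algebra_simps)
  have "2 * real ?n * real r * ip ?G f f = 2 * (real ?n * real ?n * ip ?G f f - real ?n * real (?n - r) * ip ?G f f)"
    using assms(2) by (simp add: of_nat_diff algebra_simps)
  also have "\<dots> \<le> 2 * (real ?n * real ?n * ip ?G f f - (\<Sum>a\<in>A. \<Sum>b\<in>A. ip ?G (\<lambda>\<sigma>. f (\<sigma> \<circ> transpose a b)) f))"
    using * by simp
  finally show ?thesis unfolding eq .
qed

text \<open>The orthogonal projection p of the unit mass to the span of the \<phi> k has squared
  norm p id, the sum of the squares of an orthonormal basis at the identity. The span is invariant
  under right translations, so no point has a smaller sum, and averaging over the group bounds it by
  the dimension over n!.\<close>

lemma exists_projection_id_mass:
  fixes \<phi> :: "'i \<Rightarrow> ('a \<Rightarrow> 'a) \<Rightarrow> real"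
  assumes finA: "finite A" and finI: "finite I"
    and inv: "\<And>k s. k \<in> I \<Longrightarrow> s permutes A \<Longrightarrow> \<exists>k'\<in>I. \<forall>\<tau>. \<tau> permutes A \<longrightarrow> \<phi> k (\<tau> \<circ> s) = \<phi> k' \<tau>"
  shows "\<exists>p. (\<forall>k\<in>I. ip (perms A) (\<phi> k) (\<lambda>\<sigma>. id_mass \<sigma> - p \<sigma>) = 0) \<and>
    fact (card A) * ip (perms A) p p \<le> real (card I)"
proof -
  define G where "G = (perms A)"
  have finG: "finite G" unfolding G_def using finA by (rule finite_permutations)
  have idG: "id \<in> G" by (simp add: G_def permutes_id)
  from gram_schmidt[OF finG finI, of \<phi>]
  obtain d :: nat and e where d: "d \<le> card I"
    and on': "\<forall>i<d. \<forall>j<d. ip G (e i) (e j) = (if i = j then 1 else 0)"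
    and sp: "\<forall>k\<in>I. \<exists>c. \<forall>x\<in>G. \<phi> k x = (\<Sum>i<d. c i * e i x)"
    and orth: "\<forall>u. (\<forall>k\<in>I. ip G (\<phi> k) u = 0) \<longrightarrow> (\<forall>i<d. ip G (e i) u = 0)"
    by (elim exE conjE)
  have on: "ip G (e i) (e j) = (if i = j then 1 else 0)" if "i < d" "j < d" for i j
    using on' that by blast
  have coef: "ip G (\<lambda>x. \<Sum>i<d. a i * e i x) (e j) = a j" if "j < d" for a j
  proof -
    have "ip G (\<lambda>x. \<Sum>i<d. a i * e i x) (e j) = (\<Sum>i<d. if i = j then a i else 0)"
      unfolding ip_sum_left ip_scale_left using that by (intro sum.cong) (auto simp: on)
    then show ?thesis using that by simp
  qed
  have phi_perp: "ip G (\<phi> k) u = 0" if "k \<in> I" and u: "\<And>i. i < d \<Longrightarrow> ip G (e i) u = 0" for k u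
  proof -
    obtain c where "\<forall>x\<in>G. \<phi> k x = (\<Sum>i<d. c i * e i x)" using sp \<open>k \<in> I\<close> by blast
    then have "ip G (\<phi> k) u = ip G (\<lambda>x. \<Sum>i<d. c i * e i x) u" by (intro ip_cong) auto
    then show ?thesis using u by (simp add: ip_sum_left ip_scale_left)
  qed
  define p where "p x = (\<Sum>i<d. e i id * e i x)" for x
  have ip_id: "ip G (e i) id_mass = e i id" for i
  proof -
    have "ip G (e i) id_mass = (\<Sum>x\<in>G. if x = id then e i x else 0)"
      unfolding ip_def id_mass_def by (intro sum.cong) auto
    then show ?thesis using finG idG by (simp add: sum.delta)
  qed
  have ip_p: "ip G p (e i) = e i id" if "i < d" for i
    unfolding p_def using coef[OF that, of "\<lambda>i. e i id"] .
  have perp: "ip G (\<phi> k) (\<lambda>\<sigma>. id_mass \<sigma> - p \<sigma>) = 0" if "k \<in> I" for k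
    using that by (rule phi_perp) (simp add: ip_diff_right ip_id ip_commute[of G "e _" p] ip_p)
  define P where "P = p id"
  have pp: "ip G p p = P"
  proof -
    have "p = (\<lambda>x. \<Sum>i<d. e i id * e i x)" by (simp add: p_def fun_eq_iff)
    from arg_cong[OF this, of "ip G p"] show ?thesis
      by (simp add: ip_sum_right ip_scale_right ip_p P_def p_def)
  qed
  have "P\<^sup>2 \<le> P * (\<Sum>i<d. (e i \<sigma>)\<^sup>2)" if \<sigma>: "\<sigma> \<in> G" for \<sigma>
  proof -
    have \<sigma>p: "\<sigma> permutes A" using \<sigma> by (simp add: G_def)
    \<comment> \<open>The translate of p to \<sigma>: it has squared norm P and takes the value P at
      \<sigma>. Cauchy-Schwarz for its coefficients compares this with the basis at
      \<sigma>.\<close>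
    define f where "f \<tau> = p (\<tau> \<circ> inv' \<sigma>)" for \<tau>
    define a where "a i = ip G f (e i)" for i
    \<comment> \<open>The span is accessible through orthogonality only, so f is shown to lie in it
      by proving its residual z orthogonal to both f and the e i, hence to itself.\<close>
    define z where "z \<tau> = f \<tau> - (\<Sum>i<d. a i * e i \<tau>)" for \<tau>
    have ez: "ip G (e i) z = 0" if "i < d" for i
      using coef[OF that, of a] unfolding z_def[abs_def] ip_commute[of G "e i"] by (simp add: ip_diff_left a_def)
    have "ip G (\<phi> k) (\<lambda>\<tau>. z (\<tau> \<circ> \<sigma>)) = 0" if k: "k \<in> I" for k
    proof -
      have "ip G (\<phi> k) (\<lambda>\<tau>. z (\<tau> \<circ> \<sigma>)) = ip G (\<lambda>\<tau>. \<phi> k (\<tau> \<circ> inv' \<sigma>)) z"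
        unfolding G_def using ip_comp_right[OF \<sigma>p, of z "\<phi> k"] by (simp add: ip_commute)
      also obtain k' where k': "k' \<in> I" "\<forall>\<tau>. \<tau> permutes A \<longrightarrow> \<phi> k (\<tau> \<circ> inv' \<sigma>) = \<phi> k' \<tau>"
        using inv[OF k permutes_inv[OF \<sigma>p]] by blast
      have "ip G (\<lambda>\<tau>. \<phi> k (\<tau> \<circ> inv' \<sigma>)) z = ip G (\<phi> k') z"
        using k' by (intro ip_cong) (auto simp: G_def)
      also have "\<dots> = 0" using k' ez by (intro phi_perp) auto
      finally show ?thesis .
    qed
    then have "ip G (e i) (\<lambda>\<tau>. z (\<tau> \<circ> \<sigma>)) = 0" if "i < d" for i using orth that by blast
    then have "ip G p (\<lambda>\<tau>. z (\<tau> \<circ> \<sigma>)) = 0" unfolding p_def by (simp add: ip_sum_left ip_scale_left)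
    then have "ip G f z = 0"
      unfolding f_def G_def using ip_comp_right[OF permutes_inv[OF \<sigma>p], of p z] permutes_inv_inv[OF \<sigma>p] by simp
    moreover have "ip G (\<lambda>\<tau>. \<Sum>i<d. a i * e i \<tau>) z = 0"
      using ez by (simp add: ip_sum_left ip_scale_left)
    ultimately have "ip G z z = 0" unfolding z_def[abs_def] by (simp add: ip_diff_left)
    then have fexp: "f \<tau> = (\<Sum>i<d. a i * e i \<tau>)" if "\<tau> \<in> G" for \<tau>
      using that finG by (simp add: ip_self_eq_0_iff z_def)
    have "ip G f f = ip G p p"
      unfolding f_def G_def using L2_set_comp_right[OF permutes_inv[OF \<sigma>p], of p]
      by (simp flip: L2_set_power2)
    moreover have "ip G f f = ip G f (\<lambda>\<tau>. \<Sum>i<d. a i * e i \<tau>)" using fexp by (intro ip_cong) auto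
    then have "ip G f f = (\<Sum>i<d. (a i)\<^sup>2)"
      by (simp add: ip_sum_right ip_scale_right a_def power2_eq_square)
    moreover have "P = (\<Sum>i<d. a i * e i \<sigma>)"
      using fexp[OF \<sigma>] permutes_inv_o(1)[OF \<sigma>p] by (simp add: f_def P_def)
    moreover have "(\<Sum>i<d. a i * e i \<sigma>)\<^sup>2 \<le> (\<Sum>i<d. (a i)\<^sup>2) * (\<Sum>i<d. (e i \<sigma>)\<^sup>2)"
      using ip_power2_le[of "{..<d}" a "\<lambda>i. e i \<sigma>"] by (simp add: ip_def power2_eq_square)
    ultimately show ?thesis using pp by simp
  qed
  then have "(\<Sum>\<sigma>\<in>G. P\<^sup>2) \<le> (\<Sum>\<sigma>\<in>G. P * (\<Sum>i<d. (e i \<sigma>)\<^sup>2))" by (intro sum_mono)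
  moreover have "(\<Sum>\<sigma>\<in>G. \<Sum>i<d. (e i \<sigma>)\<^sup>2) = (\<Sum>i<d. ip G (e i) (e i))"
    unfolding ip_def by (subst sum.swap) (simp add: power2_eq_square)
  moreover have "(\<Sum>i<d. ip G (e i) (e i)) = real d" by (simp add: on)
  moreover have cG: "card G = fact (card A)" unfolding G_def by (rule card_permutations[OF refl finA])
  ultimately have "fact (card A) * P\<^sup>2 \<le> P * real d"
    by (simp flip: sum_distrib_left)
  then have *: "P * (fact (card A) * P) \<le> P * real d" by (simp add: power2_eq_square mult_ac)
  have "P \<ge> 0" using pp ip_self_nonneg[of G p] by simp
  then have "fact (card A) * P \<le> real d"
    using * by (cases "P = 0") auto
  then have "fact (card A) * ip G p p \<le> real (card I)" using d pp by simp
  then show ?thesis using perp unfolding G_def by blast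
qed

subsection \<open>Random walks on a symmetric group\<close>

definition walk :: "'a set \<Rightarrow> (('a \<Rightarrow> 'a) \<Rightarrow> real) \<Rightarrow> (('a \<Rightarrow> 'a) \<Rightarrow> real) \<Rightarrow> ('a \<Rightarrow> 'a) \<Rightarrow> real" where
  "walk A q f \<sigma> = (\<Sum>s | s permutes A. q s * f (\<sigma> \<circ> s))"

lemma walk_diff: "walk A q (\<lambda>\<sigma>. f \<sigma> - g \<sigma>) = (\<lambda>\<sigma>. walk A q f \<sigma> - walk A q g \<sigma>)"
  by (simp add: walk_def fun_eq_iff algebra_simps sum_subtractf)

lemma walk_sum: "walk A q (\<lambda>\<sigma>. \<Sum>i\<in>I. f i \<sigma>) = (\<lambda>\<sigma>. \<Sum>i\<in>I. walk A q (f i) \<sigma>)"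
proof
  show "walk A q (\<lambda>\<sigma>. \<Sum>i\<in>I. f i \<sigma>) \<sigma> = (\<Sum>i\<in>I. walk A q (f i) \<sigma>)" for \<sigma>
    unfolding walk_def sum_distrib_left by (rule sum.swap)
qed

lemma walk_const:
  "(\<Sum>s | s permutes A. q s) = 1 \<Longrightarrow> walk A q (\<lambda>_. c) = (\<lambda>_. c)"
  by (simp add: walk_def fun_eq_iff flip: sum_distrib_right)

lemma walk_cong:
  "\<sigma> permutes A \<Longrightarrow> (\<And>\<sigma>. \<sigma> permutes A \<Longrightarrow> f \<sigma> = g \<sigma>) \<Longrightarrow> walk A q f \<sigma> = walk A q g \<sigma>"
  unfolding walk_def by (intro sum.cong) (auto intro: permutes_compose)

lemma walk_power_diff:
  "(walk A q ^^ m) (\<lambda>\<sigma>. f \<sigma> - g \<sigma>) = (\<lambda>\<sigma>. (walk A q ^^ m) f \<sigma> - (walk A q ^^ m) g \<sigma>)"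
  by (induction m) (auto simp: walk_diff)

lemma walk_power_sum:
  "(walk A q ^^ m) (\<lambda>\<sigma>. \<Sum>i\<in>I. f i \<sigma>) = (\<lambda>\<sigma>. \<Sum>i\<in>I. (walk A q ^^ m) (f i) \<sigma>)"
  by (induction m) (auto simp: walk_sum)

lemma walk_power_const:
  "(\<Sum>s | s permutes A. q s) = 1 \<Longrightarrow> (walk A q ^^ m) (\<lambda>_. c) = (\<lambda>_. c)"
  by (induction m) (auto simp: walk_const)

lemma walk_power_cong:
  "\<sigma> permutes A \<Longrightarrow> (\<And>\<sigma>. \<sigma> permutes A \<Longrightarrow> f \<sigma> = g \<sigma>) \<Longrightarrow> (walk A q ^^ m) f \<sigma> = (walk A q ^^ m) g \<sigma>"
proof (induction m arbitrary: \<sigma>)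
  case (Suc m)
  then show ?case by (auto intro!: walk_cong)
qed simp

lemma ip_walk:
  assumes "\<And>s. s permutes A \<Longrightarrow> q (inv' s) = q s"
  shows "ip (perms A) (walk A q f) g = ip (perms A) f (walk A q g)"
proof -
  let ?G = "perms A"
  have "ip ?G (walk A q f) g = (\<Sum>s\<in>?G. q s * ip ?G (\<lambda>\<sigma>. f (\<sigma> \<circ> s)) g)"
    unfolding walk_def ip_sum_left ip_scale_left ..
  also have "\<dots> = (\<Sum>s\<in>?G. q (inv' s) * ip ?G f (\<lambda>\<sigma>. g (\<sigma> \<circ> inv' s)))"
    by (intro sum.cong refl arg_cong2[where f = "(*)"]) (auto simp: assms ip_comp_right)
  also have "\<dots> = (\<Sum>s\<in>?G. q s * ip ?G f (\<lambda>\<sigma>. g (\<sigma> \<circ> s)))"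
    by (rule sum_permutes_inv[of "\<lambda>s. q s * ip ?G f (\<lambda>\<sigma>. g (\<sigma> \<circ> s))"])
  also have "\<dots> = ip ?G f (walk A q g)"
    unfolding walk_def ip_sum_right ip_scale_right ..
  finally show ?thesis .
qed

text \<open>Relabelling multiplies on the left and the walk on the right, so coset sums pass through
  the walk.\<close>

lemma sym_null_walk:
  assumes "sym_null A j f"
  shows "sym_null A j (walk A q f)"
  unfolding sym_null_def
proof (intro allI impI)
  fix Z \<sigma> assume Z: "Z \<subseteq> A" "card Z = j" "\<sigma> permutes A"
  have "symz Z (walk A q f) \<sigma> = (\<Sum>s | s permutes A. q s * symz Z f (\<sigma> \<circ> s))"
    unfolding symz_def walk_def sum_distrib_left comp_assoc by (rule sum.swap)
  also have "\<dots> = 0"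
    using assms Z by (intro sum.neutral) (auto simp: sym_null_def permutes_compose)
  finally show "symz Z (walk A q f) \<sigma> = 0" .
qed

lemma L2_set_walk_power_le:
  assumes contr: "\<And>f. sym_null A j f \<Longrightarrow> L2_set (walk A q f) (perms A) \<le> c * L2_set f (perms A)"
    and "0 \<le> c" "sym_null A j f"
  shows "sym_null A j ((walk A q ^^ m) f) \<and>
    L2_set ((walk A q ^^ m) f) (perms A) \<le> c ^ m * L2_set f (perms A)"
proof (induction m)
  case (Suc m)
  have "L2_set ((walk A q ^^ Suc m) f) (perms A) \<le> c * L2_set ((walk A q ^^ m) f) (perms A)"
    using contr Suc by simp
  also have "\<dots> \<le> c * (c ^ m * L2_set f (perms A))"
    using Suc assms(2) by (intro mult_left_mono) auto
  finally show ?case using Suc sym_null_walk[of A j "(walk A q ^^ m) f" q] by (simp add: mult.assoc)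
qed (use assms in simp)

text \<open>The functions spanning the orthogonal complement of \<open>sym_null\<close> are indicators of
  \<open>\<tau> (x i) = c i\<close> for \<open>i = 1, \<dots>, r\<close>; allowing arbitrary, possibly inconsistent, lists
  makes them easy to count.\<close>

lemma exists_sym_null_projection:
  assumes finA: "finite A" and r: "r \<le> card A"
  shows "\<exists>p. sym_null A (card A - r) (\<lambda>\<sigma>. id_mass \<sigma> - p \<sigma>) \<and>
    sqrt (fact (card A)) * L2_set p (perms A) \<le> real (card A) ^ r"
proof -
  let ?G = "perms A"
  define I where "I = {xs::('a \<times> 'a) list. set xs \<subseteq> A \<times> A \<and> length xs = r}"
  define \<phi> :: "('a \<times> 'a) list \<Rightarrow> ('a \<Rightarrow> 'a) \<Rightarrow> real" where
    "\<phi> xs \<tau> = (if \<forall>(x, c)\<in>set xs. \<tau> x = c then 1 else 0)" for xs \<tau>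
  have finI: "finite I" and cI: "card I = (card A * card A) ^ r"
    unfolding I_def using finA
    by (simp_all add: finite_lists_length_eq card_lists_length_eq card_cartesian_product)
  have inv: "\<exists>k'\<in>I. \<forall>\<tau>. \<tau> permutes A \<longrightarrow> \<phi> k (\<tau> \<circ> s) = \<phi> k' \<tau>" if k: "k \<in> I" and s: "s permutes A" for k s
  proof (intro bexI allI impI)
    show "map (\<lambda>(x, c). (s x, c)) k \<in> I" using k s by (auto simp: I_def permutes_in_image)
    show "\<phi> k (\<tau> \<circ> s) = \<phi> (map (\<lambda>(x, c). (s x, c)) k) \<tau>" for \<tau>
      by (auto simp: \<phi>_def split: prod.splits)
  qed
  obtain p where p: "\<And>k. k \<in> I \<Longrightarrow> ip ?G (\<phi> k) (\<lambda>\<sigma>. id_mass \<sigma> - p \<sigma>) = 0"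
    and pb: "fact (card A) * ip ?G p p \<le> real (card I)"
    using exists_projection_id_mass[OF finA finI inv] by blast
  have "sym_null A (card A - r) (\<lambda>\<sigma>. id_mass \<sigma> - p \<sigma>)"
    unfolding sym_null_def
  proof (intro allI impI)
    fix Z \<sigma> assume Z: "Z \<subseteq> A" "card Z = card A - r" and \<sigma>: "\<sigma> permutes A"
    define u where "u \<sigma> = id_mass \<sigma> - p \<sigma>" for \<sigma>
    obtain cs where cs: "set cs = A - Z" "distinct cs" using finite_distinct_list[of "A - Z"] finA by auto
    have "card (A - Z) = r"
      using Z finA r by (simp add: card_Diff_subset finite_subset)
    then have len: "length cs = r" using cs distinct_card by metis
    \<comment> \<open>A permutation lies in the coset of \<sigma> exactly if it puts each of the r
      labels outside Z at the position where \<sigma> has it. So the coset indicator is one of the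
      \<phi>.\<close>
    define xs where "xs = map (\<lambda>c. (inv' \<sigma> c, c)) cs"
    have "inv' \<sigma> c \<in> A" if "c \<in> A" for c
      using permutes_in_image[OF permutes_inv[OF \<sigma>]] that by simp
    then have xsI: "xs \<in> I" using cs len by (auto simp: xs_def I_def)
    have in_iff: "\<tau> \<circ> inv' \<sigma> permutes Z \<longleftrightarrow> \<tau> permutes A \<and> (\<forall>(x, c)\<in>set xs. \<tau> x = c)" for \<tau>
    proof
      assume *: "\<tau> \<circ> inv' \<sigma> permutes Z"
      have "(\<tau> \<circ> inv' \<sigma>) \<circ> \<sigma> permutes A"
        using permutes_compose[OF \<sigma> permutes_subset[OF * Z(1)]] .
      then have "\<tau> permutes A" by (simp add: comp_assoc permutes_inv_o(2)[OF \<sigma>])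
      moreover have "\<tau> (inv' \<sigma> c) = c" if "c \<notin> Z" for c using permutes_not_in[OF * that] by simp
      ultimately show "\<tau> permutes A \<and> (\<forall>(x, c)\<in>set xs. \<tau> x = c)" by (auto simp: xs_def cs)
    next
      assume *: "\<tau> permutes A \<and> (\<forall>(x, c)\<in>set xs. \<tau> x = c)"
      have "\<tau> \<circ> inv' \<sigma> permutes A" using * \<sigma> by (auto intro: permutes_compose permutes_inv)
      then show "\<tau> \<circ> inv' \<sigma> permutes Z"
        by (rule permutes_superset) (use * in \<open>auto simp: xs_def cs\<close>)
    qed
    have "ip ?G (\<phi> xs) u = (\<Sum>\<tau> | \<tau> permutes A. if \<tau> \<circ> inv' \<sigma> permutes Z then u \<tau> else 0)"
      unfolding ip_def by (intro sum.cong refl) (auto simp: \<phi>_def in_iff)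
    also have "\<dots> = (\<Sum>\<tau> | \<tau> permutes A. if \<tau> permutes Z then u (\<tau> \<circ> \<sigma>) else 0)"
      using sum_permutes_comp_right[OF \<sigma>, of "\<lambda>\<tau>. if \<tau> \<circ> inv' \<sigma> permutes Z then u \<tau> else 0"]
      by (simp add: comp_assoc permutes_inv_o(1)[OF \<sigma>])
    also have "\<dots> = symz Z u \<sigma>"
    proof -
      have "perms Z \<subseteq> (perms A)" using Z(1) by (auto intro: permutes_subset)
      then show ?thesis unfolding symz_def
        using finite_permutations[OF finA] by (simp add: sum.If_cases Int_absorb1)
    qed
    finally have "symz Z u \<sigma> = 0" using p[OF xsI] unfolding u_def[abs_def] by simp
    then show "symz Z (\<lambda>\<sigma>. id_mass \<sigma> - p \<sigma>) \<sigma> = 0" unfolding u_def[abs_def] .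
  qed
  moreover have "sqrt (fact (card A)) * L2_set p ?G \<le> real (card A) ^ r"
  proof -
    have "sqrt (fact (card A)) * L2_set p ?G = sqrt (fact (card A) * ip ?G p p)"
      by (simp add: L2_set_eq_sqrt_ip real_sqrt_mult)
    \<comment> \<open>Each of the r pairs of a position and a label has n^2 choices; the root turns
      n^(2 r) into n^r.\<close>
    also have "\<dots> \<le> sqrt ((real (card A) ^ r)\<^sup>2)"
      using pb by (intro real_sqrt_le_mono) (simp add: cI power_mult_distrib power2_eq_square)
    finally show ?thesis by simp
  qed
  ultimately show ?thesis by blast
qed

text \<open>The projections p r lead from the uniform mass at r = 0 to the unit mass at r = n - 1.
  Raising r by one costs a factor n in the norm and gains a factor exp (- \<kappa> m) in the
  contraction, so the increments are dominated by a geometric series of ratio x.\<close>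

lemma walk_L2_bound:
  assumes finA: "finite A" and n: "card A = n" "n \<ge> 1"
    and mass: "(\<Sum>s | s permutes A. q s) = 1"
    and contr: "\<And>r f. 1 \<le> r \<Longrightarrow> r < n \<Longrightarrow> sym_null A (Suc (n - r)) f \<Longrightarrow>
      L2_set (walk A q f) (perms A) \<le> exp (- \<kappa> * real r) * L2_set f (perms A)"
    and m: "real n * exp (- \<kappa> * real m) \<le> 1 / 16"
  shows "sqrt (fact n) * L2_set (\<lambda>\<sigma>. (walk A q ^^ m) id_mass \<sigma> - 1 / fact n) (perms A) \<le> 2 / 15"
proof -
  let ?G = "perms A" and ?N = "fact n :: real"
  define x where "x = real n * exp (- \<kappa> * real m)"
  have idA: "id permutes A" by (rule permutes_id)
  have cG: "card ?G = fact n" using card_permutations[OF n(1) finA] by simp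
  have "\<exists>p. sym_null A (n - r) (\<lambda>\<sigma>. id_mass \<sigma> - p \<sigma>) \<and> sqrt ?N * L2_set p ?G \<le> real n ^ r" if "r < n" for r
    using exists_sym_null_projection[OF finA, of r] n that by simp
  then have "\<forall>r. \<exists>p. r < n \<longrightarrow> sym_null A (n - r) (\<lambda>\<sigma>. id_mass \<sigma> - p \<sigma>) \<and> sqrt ?N * L2_set p ?G \<le> real n ^ r"
    by blast
  then obtain p0 where "\<forall>r. r < n \<longrightarrow> sym_null A (n - r) (\<lambda>\<sigma>. id_mass \<sigma> - p0 r \<sigma>) \<and> sqrt ?N * L2_set (p0 r) ?G \<le> real n ^ r"
    by (rule choice[THEN exE])
  then have p0: "\<And>r. r < n \<Longrightarrow> sym_null A (n - r) (\<lambda>\<sigma>. id_mass \<sigma> - p0 r \<sigma>)"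
    "\<And>r. r < n \<Longrightarrow> sqrt ?N * L2_set (p0 r) ?G \<le> real n ^ r" by blast+
  \<comment> \<open>For r = 0 the existence statement does not identify the function that it
    provides; the uniform mass is put in by hand so that the telescoping sum starts there.\<close>
  define p where "p r = (if r = 0 then (\<lambda>_. 1 / ?N) else p0 r)" for r
  have pnull: "sym_null A (n - r) (\<lambda>\<sigma>. id_mass \<sigma> - p r \<sigma>)" if "r < n" for r
  proof (cases "r = 0")
    case True
    have "symz A (\<lambda>\<sigma>. id_mass \<sigma> - 1 / ?N) \<sigma> = 0" if \<sigma>: "\<sigma> permutes A" for \<sigma>
    proof -
      have "symz A (\<lambda>\<sigma>. id_mass \<sigma> - 1 / ?N) \<sigma> = (\<Sum>\<rho>\<in>?G. id_mass \<rho> - 1 / ?N)"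
        unfolding symz_def by (rule sum_permutes_comp_right[OF \<sigma>])
      also have "\<dots> = 0"
        using finite_permutations[OF finA] idA by (simp add: sum_subtractf cG id_mass_def sum.delta)
      finally show ?thesis .
    qed
    moreover have "Z = A" if "Z \<subseteq> A" "card Z = n" for Z using that n finA by (simp add: card_subset_eq)
    ultimately show ?thesis using True by (auto simp: sym_null_def p_def)
  next
    case False
    then show ?thesis using p0(1)[OF that] by (simp add: p_def)
  qed
  have pnorm: "sqrt ?N * L2_set (p r) ?G \<le> real n ^ r" if "r < n" for r
  proof (cases "r = 0")
    case True
    have "L2_set (\<lambda>_. 1 / ?N) ?G = sqrt ?N * (1 / ?N)"
      unfolding L2_set_constant cG by simp
    then show ?thesis using True by (simp add: p_def)
  next
    case False
    then show ?thesis using p0(2)[OF that] by (simp add: p_def)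
  qed
  define w where "w r \<sigma> = p r \<sigma> - p (r - 1) \<sigma>" for r \<sigma>
  \<comment> \<open>The increment is a difference of two residuals. The one for r - 1 has the
    parameter n - r + 1 by construction, the one for r by monotonicity.\<close>
  have wnull: "sym_null A (Suc (n - r)) (w r)" if "1 \<le> r" "r < n" for r
  proof -
    have e: "n - (r - 1) = Suc (n - r)" using that by simp
    have n1: "sym_null A (Suc (n - r)) (\<lambda>\<sigma>. id_mass \<sigma> - p r \<sigma>)"
      by (rule sym_null_mono[OF finA pnull]) (use that in auto)
    have n2: "sym_null A (Suc (n - r)) (\<lambda>\<sigma>. id_mass \<sigma> - p (r - 1) \<sigma>)"
      using pnull[of "r - 1"] that e by simp
    have "sym_null A (Suc (n - r)) (\<lambda>\<sigma>. (id_mass \<sigma> - p (r - 1) \<sigma>) - (id_mass \<sigma> - p r \<sigma>))"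
      by (rule sym_null_diff[OF n2 n1])
    then show ?thesis by (simp add: w_def[abs_def])
  qed
  have wnorm: "sqrt ?N * L2_set (w r) ?G \<le> 2 * real n ^ r" if "1 \<le> r" "r < n" for r
  proof -
    have "L2_set (w r) ?G \<le> L2_set (p r) ?G + L2_set (p (r - 1)) ?G"
      using L2_set_triangle_ineq[of "p r" "\<lambda>\<sigma>. - p (r - 1) \<sigma>" ?G]
      by (simp add: w_def[abs_def] L2_set_uminus)
    then have "sqrt ?N * L2_set (w r) ?G \<le> sqrt ?N * L2_set (p r) ?G + sqrt ?N * L2_set (p (r - 1)) ?G"
      by (simp flip: distrib_left)
    also have "\<dots> \<le> real n ^ r + real n ^ (r - 1)" using that by (intro add_mono pnorm) auto
    also have "real n ^ (r - 1) \<le> real n ^ r" using n by (intro power_increasing) auto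
    finally show ?thesis by simp
  qed
  have telescope: "(\<Sum>r=1..<j. w r \<sigma>) = p (j - 1) \<sigma> - p 0 \<sigma>" if "j \<ge> 1" for j \<sigma>
    using that by (induction j rule: dec_induct) (auto simp: w_def)
  \<comment> \<open>With a single free label the coset sum is the value itself, so the last residual
    vanishes pointwise.\<close>
  have last: "p (n - 1) \<sigma> = id_mass \<sigma>" if \<sigma>: "\<sigma> permutes A" for \<sigma>
  proof -
    obtain a where a: "a \<in> A" using n finA by fastforce
    have "sym_null A 1 (\<lambda>\<sigma>. id_mass \<sigma> - p (n - 1) \<sigma>)"
      using pnull[of "n - 1"] n by simp
    then have "symz {a} (\<lambda>\<sigma>. id_mass \<sigma> - p (n - 1) \<sigma>) \<sigma> = 0"
      using a \<sigma> unfolding sym_null_def by (elim allE[of _ "{a}"] allE[of _ \<sigma>]) simp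
    then show ?thesis by simp
  qed
  have "(walk A q ^^ m) id_mass \<sigma> - 1 / ?N = (\<Sum>r=1..<n. (walk A q ^^ m) (w r) \<sigma>)" if \<sigma>: "\<sigma> permutes A" for \<sigma>
  proof -
    have "(walk A q ^^ m) id_mass \<sigma> - 1 / ?N = (walk A q ^^ m) (\<lambda>\<sigma>. id_mass \<sigma> - 1 / ?N) \<sigma>"
      unfolding walk_power_diff walk_power_const[OF mass] ..
    also have "\<dots> = (walk A q ^^ m) (\<lambda>\<sigma>. \<Sum>r=1..<n. w r \<sigma>) \<sigma>"
      using telescope[OF n(2)] last by (intro walk_power_cong[OF \<sigma>]) (simp add: p_def)
    finally show ?thesis unfolding walk_power_sum .
  qed
  then have "L2_set (\<lambda>\<sigma>. (walk A q ^^ m) id_mass \<sigma> - 1 / ?N) ?G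
      = L2_set (\<lambda>\<sigma>. \<Sum>r=1..<n. (walk A q ^^ m) (w r) \<sigma>) ?G"
    by (intro L2_set_cong) auto
  also have "\<dots> \<le> (\<Sum>r=1..<n. L2_set ((walk A q ^^ m) (w r)) ?G)" by (rule L2_set_sum) simp
  finally have "sqrt ?N * L2_set (\<lambda>\<sigma>. (walk A q ^^ m) id_mass \<sigma> - 1 / ?N) ?G
      \<le> (\<Sum>r=1..<n. sqrt ?N * L2_set ((walk A q ^^ m) (w r)) ?G)"
    by (simp flip: sum_distrib_left)
  also have "\<dots> \<le> (\<Sum>r=1..<n. 2 * x ^ r)"
  proof (intro sum_mono)
    fix r assume r: "r \<in> {1..<n}"
    have "L2_set ((walk A q ^^ m) (w r)) ?G \<le> exp (- \<kappa> * real r) ^ m * L2_set (w r) ?G"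
      using L2_set_walk_power_le[of A "Suc (n - r)" q "exp (- \<kappa> * real r)" "w r" m] contr wnull r by auto
    then have "sqrt ?N * L2_set ((walk A q ^^ m) (w r)) ?G \<le> exp (- \<kappa> * real r) ^ m * (sqrt ?N * L2_set (w r) ?G)"
      by (simp add: mult.left_commute)
    also have "\<dots> \<le> exp (- \<kappa> * real r) ^ m * (2 * real n ^ r)"
      using wnorm r by (intro mult_left_mono) auto
    also have "exp (- \<kappa> * real r) ^ m = exp (- \<kappa> * real m) ^ r"
      by (simp add: mult_ac flip: exp_of_nat_mult)
    finally show "sqrt ?N * L2_set ((walk A q ^^ m) (w r)) ?G \<le> 2 * x ^ r"
      by (simp add: x_def power_mult_distrib mult_ac)
  qed
  \<comment> \<open>Any ratio x with 2 x / (1 - x) at most 1 / e would serve; 1 / 16 is convenient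
    because ln (16 n) is at most 5 ln n for n at least 2.\<close>
  also have "\<dots> \<le> (\<Sum>r=1..<n. 2 * (1 / 16) ^ r)"
    using m by (intro sum_mono mult_left_mono power_mono) (auto simp: x_def)
  also have "\<dots> \<le> 2 / 15"
  proof -
    have "(\<Sum>r=1..<j. 2 * (1 / 16) ^ r) = 2 / 15 - 32 / 15 * (1 / 16 :: real) ^ j" if "j \<ge> 1" for j
      using that by (induction j rule: dec_induct) auto
    then show ?thesis using n(2) by simp
  qed
  finally show ?thesis .
qed

text \<open>Replacing h by \<sigma> \<circ> h turns a convolution step into an average over right
  multiplication in which q is evaluated at inverses; symmetry of q removes them.\<close>

lemma conv_power_eq_walk:
  assumes sym: "\<And>s. s permutes {1..n} \<Longrightarrow> q (inv' s) = q s" and "\<sigma> permutes {1..n}"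
  shows "conv_power (sym_group n) q m \<sigma> = (walk {1..n} q ^^ m) id_mass \<sigma>"
  using assms(2)
proof (induction m arbitrary: \<sigma>)
  case 0
  show ?case unfolding conv_power.simps(1) sym_group_one funpow_0 id_mass_def ..
next
  case (Suc m)
  let ?G = "perms {1..n}"
  have "conv_power (sym_group n) q (Suc m) \<sigma> = (\<Sum>h\<in>?G. conv_power (sym_group n) q m h * q (inv' h \<circ> \<sigma>))"
  proof -
    have "carrier (sym_group n) = ?G" by (auto simp: sym_group_carrier)
    moreover have "inv\<^bsub>sym_group n\<^esub> h \<otimes>\<^bsub>sym_group n\<^esub> \<sigma> = inv' h \<circ> \<sigma>" if "h \<in> ?G" for h
      using that by (simp add: sym_group_carrier sym_group_mult)
    ultimately show ?thesis by simp
  qed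
  also have "\<dots> = (\<Sum>h\<in>?G. (walk {1..n} q ^^ m) id_mass h * q (inv' h \<circ> \<sigma>))"
    using Suc.IH by simp
  also have "\<dots> = (\<Sum>h\<in>?G. (walk {1..n} q ^^ m) id_mass (\<sigma> \<circ> h) * q (inv' (\<sigma> \<circ> h) \<circ> \<sigma>))"
    by (rule sum_permutes_comp_left[OF Suc.prems, symmetric])
  also have "\<dots> = (\<Sum>h\<in>?G. q h * (walk {1..n} q ^^ m) id_mass (\<sigma> \<circ> h))"
  proof (intro sum.cong refl)
    fix h assume "h \<in> ?G"
    then have h: "h permutes {1..n}" by simp
    have "inv' (\<sigma> \<circ> h) \<circ> \<sigma> = inv' h"
      using o_inv_distrib[OF permutes_bij[OF Suc.prems] permutes_bij[OF h]] permutes_inv_o(2)[OF Suc.prems]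
      by (simp add: comp_assoc)
    then show "(walk {1..n} q ^^ m) id_mass (\<sigma> \<circ> h) * q (inv' (\<sigma> \<circ> h) \<circ> \<sigma>) = q h * (walk {1..n} q ^^ m) id_mass (\<sigma> \<circ> h)"
      using sym[OF h] by simp
  qed
  also have "\<dots> = (walk {1..n} q ^^ Suc m) id_mass \<sigma>"
    unfolding funpow.simps(2) o_apply walk_def[of _ _ "(walk {1..n} q ^^ m) id_mass"] ..
  finally show ?case .
qed

subsection \<open>Mixing times of the shuffle\<close>

lemma tv_dist_le_l2_dist:
  assumes "finite (carrier G)" "carrier G \<noteq> {}"
  shows "tv_dist G p (uniform_mass G) \<le> l2_dist G p (uniform_mass G) / 2"
proof -
  let ?N = "real (order G)"
  have N: "?N > 0" using assms by (simp add: order_def card_gt_0_iff)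
  have "(\<Sum>g\<in>carrier G. \<bar>p g - uniform_mass G g\<bar>)
      = (\<Sum>g\<in>carrier G. \<bar>\<bar>p g / uniform_mass G g - 1\<bar> * sqrt (1 / ?N)\<bar> * \<bar>sqrt (1 / ?N)\<bar>)"
  proof (intro sum.cong refl)
    fix g
    have "\<bar>\<bar>p g / uniform_mass G g - 1\<bar> * sqrt (1 / ?N)\<bar> * \<bar>sqrt (1 / ?N)\<bar> = \<bar>p g * ?N - 1\<bar> * (1 / ?N)"
      using N by (simp add: uniform_mass_def abs_mult real_sqrt_divide)
    also have "\<dots> = \<bar>(p g * ?N - 1) * (1 / ?N)\<bar>" by (simp add: abs_mult)
    also have "(p g * ?N - 1) * (1 / ?N) = p g - uniform_mass G g"
      using N by (simp add: uniform_mass_def field_simps)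
    finally show "\<bar>p g - uniform_mass G g\<bar> = \<bar>\<bar>p g / uniform_mass G g - 1\<bar> * sqrt (1 / ?N)\<bar> * \<bar>sqrt (1 / ?N)\<bar>" ..
  qed
  also have "\<dots> \<le> L2_set (\<lambda>g. \<bar>p g / uniform_mass G g - 1\<bar> * sqrt (1 / ?N)) (carrier G) * L2_set (\<lambda>_. sqrt (1 / ?N)) (carrier G)"
    by (rule L2_set_mult_ineq)
  also have "L2_set (\<lambda>_. sqrt (1 / ?N)) (carrier G) = 1"
    using N by (simp add: L2_set_constant order_def real_sqrt_divide)
  also have "L2_set (\<lambda>g. \<bar>p g / uniform_mass G g - 1\<bar> * sqrt (1 / ?N)) (carrier G) = l2_dist G p (uniform_mass G)"
    unfolding L2_set_def l2_dist_def using N by (simp add: power_mult_distrib uniform_mass_def)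
  finally show ?thesis by (simp add: tv_dist_def)
qed

text \<open>The thresholds 1 / e and 1 / (2 e) differ by exactly the factor in
  \<open>tv_dist_le_l2_dist\<close>, so no time is lost.\<close>

lemma mix_time_tv_le_mix_time_l2:
  assumes "finite (carrier G)" "carrier G \<noteq> {}"
  shows "mix_time_tv G q \<le> mix_time_l2 G q"
  unfolding mix_time_tv_def mix_time_l2_def
proof (intro Inf_superset_mono image_mono Collect_mono impI)
  fix m assume "l2_dist G (conv_power G q m) (uniform_mass G) \<le> 1 / exp 1"
  then show "tv_dist G (conv_power G q m) (uniform_mass G) \<le> 1 / (2 * exp 1)"
    using tv_dist_le_l2_dist[OF assms, of "conv_power G q m"] by simp
qed

lemma Inf_enat_image_le: "m \<in> S \<Longrightarrow> Inf (enat ` S) \<le> enat m"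
  by (rule Inf_lower) simp

lemma ereal_le_Inf_enat_image:
  assumes "\<And>m. m \<in> S \<Longrightarrow> x \<le> real m"
  shows "ereal x \<le> ereal_of_enat (Inf (enat ` S))"
proof (cases "S = {}")
  case True
  then show ?thesis by (simp add: top_enat_def)
next
  case False
  then have "Inf (enat ` S) \<in> enat ` S"
    unfolding Inf_enat_def by (auto intro: LeastI)
  then show ?thesis using assms by auto
qed

lemma order_sym_group: "order (sym_group n) = fact n"
  using card_permutations[of "{1..n}" n] by (simp add: order_def sym_group_def)

lemma carrier_sym_group: "carrier (sym_group n) = (perms {1..n})"
  by (simp add: sym_group_def)

lemma finite_carrier_sym_group: "finite (carrier (sym_group n))"
  by (simp add: carrier_sym_group finite_permutations)

lemma carrier_sym_group_nonempty: "carrier (sym_group n) \<noteq> {}"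
  unfolding carrier_sym_group using permutes_id by blast

lemma l2_dist_sym_group:
  assumes "\<And>s. s permutes {1..n} \<Longrightarrow> q (inv' s) = q s"
  shows "l2_dist (sym_group n) (conv_power (sym_group n) q m) (uniform_mass (sym_group n))
    = sqrt (fact n) * L2_set (\<lambda>\<sigma>. (walk {1..n} q ^^ m) id_mass \<sigma> - 1 / fact n) (perms {1..n})"
proof -
  let ?p = "(walk {1..n} q ^^ m) id_mass"
  have "l2_dist (sym_group n) (conv_power (sym_group n) q m) (uniform_mass (sym_group n))
    = sqrt (\<Sum>\<sigma> | \<sigma> permutes {1..n}. \<bar>?p \<sigma> / (1 / fact n) - 1\<bar>\<^sup>2 * (1 / fact n))"
    unfolding l2_dist_def carrier_sym_group uniform_mass_def order_sym_group
    using conv_power_eq_walk[of n q, OF assms]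
    by (intro arg_cong[of _ _ sqrt] sum.cong) auto
  also have "\<dots> = sqrt (\<Sum>\<sigma> | \<sigma> permutes {1..n}. fact n * (?p \<sigma> - 1 / fact n)\<^sup>2)"
  proof (intro arg_cong[of _ _ sqrt] sum.cong refl)
    fix \<sigma>
    have "?p \<sigma> / (1 / fact n) - 1 = fact n * (?p \<sigma> - 1 / fact n)" by (simp add: algebra_simps)
    then show "\<bar>?p \<sigma> / (1 / fact n) - 1\<bar>\<^sup>2 * (1 / fact n) = fact n * (?p \<sigma> - 1 / fact n)\<^sup>2"
      by (simp only: power2_abs power_mult_distrib) (simp add: power2_eq_square)
  qed
  finally show ?thesis by (simp add: L2_set_def real_sqrt_mult flip: sum_distrib_left)
qed

section \<open>The symmetrized shuffle as a walk on positions\<close>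

abbreviation shuffle_walk :: "nat \<Rightarrow> nat \<Rightarrow> ((nat \<Rightarrow> nat) \<Rightarrow> real) \<Rightarrow> (nat \<Rightarrow> nat) \<Rightarrow> real" where
  "shuffle_walk n k \<equiv> walk {1..n} (sym_top_to_bottom_k n k)"

abbreviation shuffle_tv :: "nat \<Rightarrow> nat \<Rightarrow> nat \<Rightarrow> real" where
  "shuffle_tv n k m \<equiv> tv_dist (sym_group n) (conv_power (sym_group n) (sym_top_to_bottom_k n k) m) (uniform_mass (sym_group n))"

abbreviation shuffle_l2 :: "nat \<Rightarrow> nat \<Rightarrow> nat \<Rightarrow> real" where
  "shuffle_l2 n k m \<equiv> l2_dist (sym_group n) (conv_power (sym_group n) (sym_top_to_bottom_k n k) m) (uniform_mass (sym_group n))"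

lemma sym_top_to_bottom_k_eq:
  assumes "s permutes {1..n}"
  shows "sym_top_to_bottom_k n k s = (top_to_bottom_k n k s + top_to_bottom_k n k (inv' s)) / 2"
  using assms by (simp add: sym_top_to_bottom_k_def additive_symmetrization_def reversed_def sym_group_carrier)

lemma sym_top_to_bottom_k_inv:
  assumes "s permutes {1..n}"
  shows "sym_top_to_bottom_k n k (inv' s) = sym_top_to_bottom_k n k s"
  using assms by (simp add: sym_top_to_bottom_k_eq permutes_inv permutes_inv_inv)

lemma l2_dist_shuffle:
  "shuffle_l2 n k m
    = sqrt (fact n) * L2_set (\<lambda>\<sigma>. (shuffle_walk n k ^^ m) id_mass \<sigma> - 1 / fact n)
        (perms {1..n})"
  by (rule l2_dist_sym_group) (rule sym_top_to_bottom_k_inv)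

lemma sum_top_to_bottom_k:
  assumes "1 < k" "k \<le> n"
  shows "(\<Sum>s | s permutes {1..n}. top_to_bottom_k n k s * F s) = (\<Sum>l=n-k+1..n. F (top_cycle l)) / real k"
proof -
  let ?L = "{n - k + 1..n}"
  have sub: "top_cycle ` ?L \<subseteq> (perms {1..n})"
    using top_cycle_permutes by auto
  have "(\<Sum>s | s permutes {1..n}. top_to_bottom_k n k s * F s)
      = (\<Sum>s\<in>top_cycle ` ?L. top_to_bottom_k n k s * F s)"
    by (rule sum.mono_neutral_right[OF finite_permutations sub]) (auto simp: top_to_bottom_k_def)
  also have "\<dots> = (\<Sum>s\<in>top_cycle ` ?L. F s / real k)"
    by (rule sum.cong) (auto simp: top_to_bottom_k_def)
  also have "\<dots> = (\<Sum>l\<in>?L. F (top_cycle l) / real k)"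
    by (subst sum.reindex) (auto intro: inj_on_subset[OF inj_on_top_cycle])
  finally show ?thesis by (simp add: sum_divide_distrib)
qed

text \<open>The two halves of the measure are reindexed separately. This accounts for a cycle that
  is its own inverse, such as the one of length 2, whose two masses add.\<close>

lemma sum_sym_top_to_bottom_k:
  assumes "1 < k" "k \<le> n"
  shows "(\<Sum>s | s permutes {1..n}. sym_top_to_bottom_k n k s * F s)
    = (\<Sum>l=n-k+1..n. F (top_cycle l) + F (inv' (top_cycle l))) / (2 * real k)"
proof -
  let ?q = "top_to_bottom_k n k"
  have "(\<Sum>s | s permutes {1..n}. sym_top_to_bottom_k n k s * F s)
     = (\<Sum>s | s permutes {1..n}. ?q s * F s / 2 + ?q (inv' s) * F s / 2)"
    by (intro sum.cong refl) (simp add: sym_top_to_bottom_k_eq algebra_simps)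
  also have "\<dots> = (\<Sum>s | s permutes {1..n}. ?q s * F s) / 2 + (\<Sum>s | s permutes {1..n}. ?q (inv' s) * F s) / 2"
    by (simp add: sum.distrib sum_divide_distrib)
  also have "(\<Sum>s | s permutes {1..n}. ?q (inv' s) * F s) = (\<Sum>s | s permutes {1..n}. ?q (inv' (inv' s)) * F (inv' s))"
    by (rule sum_permutes_inv[symmetric])
  also have "\<dots> = (\<Sum>s | s permutes {1..n}. ?q s * F (inv' s))"
    by (intro sum.cong refl) (simp add: permutes_inv_inv)
  finally show ?thesis
    unfolding sum_top_to_bottom_k[OF assms] by (simp add: sum.distrib add_divide_distrib)
qed

lemma sum_sym_top_to_bottom_k_1:
  assumes "1 < k" "k \<le> n"
  shows "(\<Sum>s | s permutes {1..n}. sym_top_to_bottom_k n k s) = 1"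
  using sum_sym_top_to_bottom_k[OF assms, of "\<lambda>_. 1"] assms by simp

lemma shuffle_T_le_T2: "shuffle_T n k \<le> shuffle_T2 n k"
  unfolding shuffle_T_def shuffle_T2_def
  by (rule mix_time_tv_le_mix_time_l2[OF finite_carrier_sym_group carrier_sym_group_nonempty])

lemma shuffle_T2_le:
  assumes "1 < k" "k \<le> n"
    and contr: "\<And>r f. 1 \<le> r \<Longrightarrow> r < n \<Longrightarrow> sym_null {1..n} (Suc (n - r)) f \<Longrightarrow>
      L2_set (shuffle_walk n k f) (perms {1..n})
        \<le> exp (- \<kappa> * real r) * L2_set f (perms {1..n})"
    and m: "real n * exp (- \<kappa> * real m) \<le> 1 / 16"
  shows "shuffle_T2 n k \<le> enat m"
  unfolding shuffle_T2_def mix_time_l2_def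
proof (rule Inf_enat_image_le, rule CollectI)
  have "shuffle_l2 n k m \<le> 2 / 15"
    unfolding l2_dist_shuffle
    using assms by (intro walk_L2_bound[where \<kappa> = \<kappa>] sum_sym_top_to_bottom_k_1) auto
  also have "\<dots> \<le> 1 / exp 1" using exp_le by (simp add: field_simps)
  finally show "shuffle_l2 n k m \<le> 1 / exp 1" .
qed

text \<open>The summand 1 is the rounding to a whole number of steps.\<close>

lemma shuffle_T2_le_real:
  assumes "1 < k" "k \<le> n" "0 < \<kappa>"
    and contr: "\<And>r f. 1 \<le> r \<Longrightarrow> r < n \<Longrightarrow> sym_null {1..n} (Suc (n - r)) f \<Longrightarrow>
      L2_set (shuffle_walk n k f) (perms {1..n})
        \<le> exp (- \<kappa> * real r) * L2_set f (perms {1..n})"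
  shows "ereal_of_enat (shuffle_T2 n k) \<le> ereal (ln (16 * real n) / \<kappa> + 1)"
proof -
  define m where "m = nat \<lceil>ln (16 * real n) / \<kappa>\<rceil>"
  have "0 \<le> ln (16 * real n) / \<kappa>" using assms by (intro divide_nonneg_pos ln_ge_zero) auto
  then have m: "ln (16 * real n) / \<kappa> \<le> real m" "real m \<le> ln (16 * real n) / \<kappa> + 1"
    unfolding m_def by linarith+
  have "ln (16 * real n) \<le> \<kappa> * real m" using m(1) assms(3) by (simp add: field_simps)
  then have "exp (- \<kappa> * real m) \<le> exp (- ln (16 * real n))" by simp
  also have "\<dots> = 1 / (16 * real n)" using assms(1,2) by (simp add: exp_minus inverse_eq_divide)
  finally have "real n * exp (- \<kappa> * real m) \<le> real n * (1 / (16 * real n))" by (rule mult_left_mono) simp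
  also have "\<dots> = 1 / 16" using assms(1,2) by simp
  finally have "shuffle_T2 n k \<le> enat m" by (intro shuffle_T2_le[OF assms(1,2) contr])
  then have "ereal_of_enat (shuffle_T2 n k) \<le> ereal (real m)"
    by (metis ereal_of_enat_le_iff ereal_of_enat_simps(1))
  also have "\<dots> \<le> ereal (ln (16 * real n) / \<kappa> + 1)" using m(2) by simp
  finally show ?thesis .
qed

subsection \<open>Comparison with random transpositions\<close>

lemma top_cycle_pow:
  assumes "1 \<le> i" "i \<le> l" "j \<le> l"
  shows "(top_cycle l ^^ j) i = (if i + j \<le> l then i + j else i + j - l)"
  using assms
proof (induction j)
  case (Suc j)
  then have "(top_cycle l ^^ j) i = (if i + j \<le> l then i + j else i + j - l)" by simp
  then have "(top_cycle l ^^ Suc j) i = top_cycle l (if i + j \<le> l then i + j else i + j - l)" by simp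
  also have "\<dots> = (if i + Suc j \<le> l then i + Suc j else i + Suc j - l)"
    using Suc.prems by (auto simp: top_cycle_def)
  finally show ?case .
qed simp

lemma top_cycle_pow_fixed:
  assumes "1 \<le> l" "i = 0 \<or> l < i"
  shows "(top_cycle l ^^ j) i = i"
  using assms by (induction j) (auto simp: top_cycle_def)

lemma top_cycle_pow_self:
  assumes "1 \<le> l"
  shows "(top_cycle l ^^ l) = id"
proof
  show "(top_cycle l ^^ l) i = id i" for i
    using top_cycle_pow[of i l l] top_cycle_pow_fixed[of l i l] assms by (cases "i = 0 \<or> l < i") simp_all
qed

lemma permutes_funpow: "s permutes A \<Longrightarrow> (s ^^ j) permutes A"
proof (induction j)
  case 0
  show ?case unfolding funpow.simps(1) by (rule permutes_id)
next
  case (Suc j)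
  then show ?case unfolding funpow.simps(2) by (intro permutes_compose)
qed

text \<open>Conjugation by s moves the pair (u, v) to (s u, s v) at the price of one s and one
  inverse. Most comparison words below are obtained by moving a pair in this way.\<close>

lemma disp_transpose_conj:
  assumes "s permutes A" "u \<in> A" "v \<in> A"
  shows "disp A (transpose u v) f \<le> 2 * disp A s f + disp A (transpose (s u) (s v)) f"
proof -
  have t: "transpose (s u) (s v) permutes A"
    using assms by (intro permutes_swap_id) (auto simp: permutes_in_image)
  have "transpose u v = inv' s \<circ> (s \<circ> transpose u v)"
    unfolding comp_assoc[symmetric] permutes_inv_o(2)[OF assms(1)] by simp
  also have "s \<circ> transpose u v = transpose (s u) (s v) \<circ> s"
    using transpose_comp_eq[OF permutes_bij[OF assms(1)], of "s u" "s v"]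
    by (simp add: permutes_inverses[OF assms(1)])
  finally have eq: "transpose u v = inv' s \<circ> (transpose (s u) (s v) \<circ> s)" .
  have "disp A (transpose u v) f \<le> disp A (inv' s) f + disp A (transpose (s u) (s v) \<circ> s) f"
    unfolding eq by (rule disp_comp[OF permutes_inv[OF assms(1)]])
  also have "\<dots> \<le> disp A (inv' s) f + (disp A (transpose (s u) (s v)) f + disp A s f)"
    by (intro add_left_mono disp_comp t)
  finally show ?thesis by (simp add: disp_inv[OF assms(1)])
qed

lemma disp_transpose_triangle:
  assumes "u \<in> A" "v \<in> A" "d \<in> A"
  shows "disp A (transpose u v) f \<le> 2 * disp A (transpose u d) f + disp A (transpose v d) f"
proof (cases "v = d \<or> v = u")
  case True
  then show ?thesis
  proof
    assume "v = u"
    then have "transpose u v = id" by simp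
    then show ?thesis by simp
  qed simp
next
  case False
  then show ?thesis
    using disp_transpose_conj[OF permutes_swap_id[OF assms(1,3)] assms(1,2), of f]
    by (auto simp: transpose_def transpose_commute[of v d])
qed

text \<open>Turn with the cycle of length l until b sits at l, then with the cycle of length l - 1,
  which fixes l, until the other position is l - 1. The adjacent transposition that remains is a
  quotient of the two cycles.\<close>

lemma disp_transpose_le_two_cycles:
  assumes "1 \<le> a" "a < b" "b \<le> l" "l \<le> n"
  shows "disp {1..n} (transpose a b) f \<le> 2 * real n * (disp {1..n} (top_cycle l) f + disp {1..n} (top_cycle (l - 1)) f)"
proof -
  let ?A = "{1..n}" and ?x = "top_cycle l" and ?y = "top_cycle (l - 1)"
  define j where "j = l - b"
  define i where "i = l - 1 - (a + j)"
  have px: "?x permutes ?A" by (rule top_cycle_permutes) (use assms in auto)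
  have py: "?y permutes ?A" by (rule top_cycle_permutes) (use assms in auto)
  have xa: "(?x ^^ j) a = a + j" and xb: "(?x ^^ j) b = l"
    using top_cycle_pow[of a l j] top_cycle_pow[of b l j] assms by (auto simp: j_def)
  have ya: "(?y ^^ i) (a + j) = l - 1"
    using top_cycle_pow[of "a + j" "l - 1" i] assms by (auto simp: i_def j_def)
  have yl: "(?y ^^ i) l = l" using assms by (intro top_cycle_pow_fixed) auto
  have adj: "transpose (l - 1) l = inv' ?y \<circ> ?x"
  proof -
    obtain p where l: "l = Suc p" "1 \<le> p" using assms by (cases l) auto
    have "?y \<circ> transpose (l - 1) l = ?x"
    proof
      fix i
      consider "i = p" | "i = Suc p" | "i \<noteq> p" "i \<noteq> Suc p" by blast
      then show "(?y \<circ> transpose (l - 1) l) i = ?x i"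
        using l by cases (auto simp: top_cycle_def)
    qed
    then have "inv' ?y \<circ> (?y \<circ> transpose (l - 1) l) = inv' ?y \<circ> ?x" by simp
    then show ?thesis unfolding comp_assoc[symmetric] permutes_inv_o(2)[OF py] by simp
  qed
  have "disp ?A (transpose a b) f \<le> 2 * disp ?A (?x ^^ j) f + disp ?A (transpose (a + j) l) f"
    using disp_transpose_conj[OF permutes_funpow[OF px, of j], of a b f] assms xa xb by simp
  moreover have "disp ?A (transpose (a + j) l) f \<le> 2 * disp ?A (?y ^^ i) f + disp ?A (transpose (l - 1) l) f"
  proof -
    have "a + j \<in> ?A" "l \<in> ?A" using assms by (auto simp: j_def)
    from disp_transpose_conj[OF permutes_funpow[OF py, of i] this, of f] show ?thesis
      unfolding ya yl .
  qed
  moreover have "disp ?A (transpose (l - 1) l) f \<le> disp ?A ?y f + disp ?A ?x f"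
    unfolding adj using disp_comp[OF permutes_inv[OF py], of ?x f] by (simp only: disp_inv[OF py])
  moreover have "disp ?A (?x ^^ j) f \<le> real j * disp ?A ?x f" by (rule disp_power[OF px])
  moreover have "disp ?A (?y ^^ i) f \<le> real i * disp ?A ?y f" by (rule disp_power[OF py])
  ultimately have "disp ?A (transpose a b) f
     \<le> (2 * real j + 1) * disp ?A ?x f + (2 * real i + 1) * disp ?A ?y f"
    unfolding distrib_right mult_1 mult.assoc by linarith
  also have "\<dots> \<le> (2 * real n) * disp ?A ?x f + (2 * real n) * disp ?A ?y f"
    using assms by (intro add_mono mult_right_mono) (auto simp: j_def i_def)
  finally show ?thesis by (simp add: algebra_simps)
qed

lemma square_add_le: "(a + b)\<^sup>2 \<le> 2 * a\<^sup>2 + 2 * (b::real)\<^sup>2"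
  using zero_le_power2[of "a - b"] by (simp add: power2_eq_square algebra_simps)

lemma sum_shift_pred:
  fixes g :: "nat \<Rightarrow> real"
  assumes "\<And>l. 0 \<le> g l" "m \<le> n"
  shows "(\<Sum>l=m+1..n. g l + g (l - 1)) \<le> 2 * (\<Sum>l=m..n. g l)"
proof -
  have "(\<Sum>l=m+1..n. g l) \<le> (\<Sum>l=m..n. g l)"
    using assms by (intro sum_mono2) auto
  moreover have "(\<Sum>l=m+1..n. g (l - 1)) \<le> (\<Sum>l=m..n. g l)"
  proof -
    have "(\<Sum>l=m+1..n. g (l - 1)) = (\<Sum>l\<in>(\<lambda>l. l - 1) ` {m+1..n}. g l)"
      by (subst sum.reindex) (auto simp: inj_on_def)
    also have "\<dots> \<le> (\<Sum>l=m..n. g l)" using assms by (intro sum_mono2) auto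
    finally show ?thesis .
  qed
  ultimately show ?thesis by (simp add: sum.distrib)
qed

text \<open>For positions up to m + 1 the word in two cycles is available for every l from m + 1 to
  n, and averaging over these k - 1 values gains the factor 1 / k. Other pairs are first carried
  there by one or two single cycles.\<close>

lemma disp_transpose_le:
  fixes n k :: nat
  assumes k: "1 < k" "k \<le> n" and ab: "1 \<le> a" "a \<le> n" "1 \<le> b" "b \<le> n"
  shows "(disp {1..n} (transpose a b) f)\<^sup>2
    \<le> 100 * real n ^ 2 / real k * (\<Sum>l=n-k+1..n. (disp {1..n} (top_cycle l) f)\<^sup>2)"
proof -
  let ?A = "{1..n}"
  define m where "m = n - k + 1"
  define d where "d l = disp ?A (top_cycle l) f" for l
  define M where "M = (\<Sum>l=m..n. (d l)\<^sup>2)"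
  \<comment> \<open>R dominates every single d l, crudely because k is at most n^2, and also the
    averaged bound up to the factor 6.\<close>
  define R where "R = sqrt (real n ^ 2 * M / real k)"
  have M0: "0 \<le> M" by (simp add: M_def sum_nonneg)
  have R0: "0 \<le> R" and R2: "R\<^sup>2 = real n ^ 2 * M / real k"
    using M0 by (auto simp: R_def)
  have m: "1 \<le> m" "m + 1 \<le> n" "real (n - m) = real k - 1" using k by (auto simp: m_def)
  have dM: "d l \<le> R" if "m \<le> l" "l \<le> n" for l
  proof -
    have "(d l)\<^sup>2 \<le> M" unfolding M_def using that by (intro member_le_sum) auto
    also have "M = M * real k / real k" using k by simp
    also have "\<dots> \<le> M * (real n)\<^sup>2 / real k"
    proof -
      have "real k \<le> real n ^ 1" using k by simp
      also have "\<dots> \<le> real n ^ 2" using k by (intro power_increasing) auto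
      finally show ?thesis using M0 by (intro divide_right_mono mult_left_mono) auto
    qed
    also have "\<dots> = R\<^sup>2" by (simp add: R2)
    finally show ?thesis using R0 by (rule power2_le_imp_le)
  qed
  have small: "disp ?A (transpose u v) f \<le> 6 * R" if "1 \<le> u" "u < v" "v \<le> m + 1" for u v
  proof -
    have "(\<Sum>l=m+1..n. (disp ?A (transpose u v) f)\<^sup>2) \<le> (\<Sum>l=m+1..n. 8 * real n ^ 2 * ((d l)\<^sup>2 + (d (l - 1))\<^sup>2))"
    proof (intro sum_mono)
      fix l assume "l \<in> {m+1..n}"
      then have "disp ?A (transpose u v) f \<le> 2 * real n * (d l + d (l - 1))"
        unfolding d_def using that by (intro disp_transpose_le_two_cycles) auto
      then have "(disp ?A (transpose u v) f)\<^sup>2 \<le> (2 * real n * (d l + d (l - 1)))\<^sup>2"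
        by (rule power_mono) simp
      also have "\<dots> = 4 * real n ^ 2 * (d l + d (l - 1))\<^sup>2" by (simp add: power_mult_distrib)
      also have "\<dots> \<le> 4 * real n ^ 2 * (2 * (d l)\<^sup>2 + 2 * (d (l - 1))\<^sup>2)"
        by (intro mult_left_mono square_add_le) simp
      finally show "(disp ?A (transpose u v) f)\<^sup>2 \<le> 8 * real n ^ 2 * ((d l)\<^sup>2 + (d (l - 1))\<^sup>2)"
        by (simp add: algebra_simps)
    qed
    also have "\<dots> = 8 * real n ^ 2 * (\<Sum>l=m+1..n. (d l)\<^sup>2 + (d (l - 1))\<^sup>2)"
      by (simp only: sum_distrib_left)
    also have "\<dots> \<le> 8 * real n ^ 2 * (2 * M)"
      unfolding M_def using m by (intro mult_left_mono sum_shift_pred) auto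
    finally have "(real k - 1) * (disp ?A (transpose u v) f)\<^sup>2 \<le> 16 * real n ^ 2 * M"
      using m(3) by simp
    moreover have "real k / 2 * (disp ?A (transpose u v) f)\<^sup>2 \<le> (real k - 1) * (disp ?A (transpose u v) f)\<^sup>2"
      using k by (intro mult_right_mono) auto
    ultimately have "real k / 2 * (disp ?A (transpose u v) f)\<^sup>2 \<le> 16 * real n ^ 2 * M" by linarith
    then have "(disp ?A (transpose u v) f)\<^sup>2 \<le> 32 * R\<^sup>2"
      using k by (simp add: R2 field_simps)
    also have "\<dots> \<le> (6 * R)\<^sup>2"
      unfolding power_mult_distrib by (rule mult_right_mono) simp_all
    finally show ?thesis by (rule power2_le_imp_le) (use R0 in simp)
  qed
  \<comment> \<open>The cycle of length v carries (u, v) to (u + 1, 1); if that is still too far,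
    the cycle of length u + 1 carries 1 and u + 1 to 2 and 1. Each move costs 2 R, hence 6 + 2 +
    2.\<close>
  have gen: "disp ?A (transpose u v) f \<le> 10 * R" if uv: "1 \<le> u" "u < v" "v \<le> n" for u v
  proof (cases "v \<le> m + 1")
    case True
    then show ?thesis using small[OF uv(1,2)] R0 by simp
  next
    case False
    have pv: "top_cycle v permutes ?A" using uv by (intro top_cycle_permutes) auto
    have "disp ?A (transpose u v) f \<le> 2 * d v + disp ?A (transpose (u + 1) 1) f"
      using disp_transpose_conj[OF pv, of u v f] uv by (simp add: d_def top_cycle_def)
    moreover have "d v \<le> R" using False uv by (intro dM) auto
    moreover have "disp ?A (transpose 1 (u + 1)) f \<le> 8 * R"
    proof (cases "u + 1 \<le> m + 1")
      case True
      then show ?thesis using small[of 1 "u + 1"] uv R0 by simp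
    next
      case False
      have pu: "top_cycle (u + 1) permutes ?A" using uv by (intro top_cycle_permutes) auto
      have "disp ?A (transpose 1 (u + 1)) f \<le> 2 * d (u + 1) + disp ?A (transpose 2 1) f"
        using disp_transpose_conj[OF pu, of 1 "u + 1" f] uv by (simp add: d_def top_cycle_def numeral_2_eq_2)
      moreover have "d (u + 1) \<le> R" using False uv by (intro dM) auto
      moreover have "disp ?A (transpose 1 2) f \<le> 6 * R" using m by (intro small) auto
      ultimately show ?thesis by (simp add: transpose_commute)
    qed
    ultimately show ?thesis by (simp add: transpose_commute)
  qed
  have "disp ?A (transpose a b) f \<le> 10 * R"
  proof (cases a b rule: linorder_cases)
    case equal
    then have "transpose a b = id" by simp
    then show ?thesis using R0 by simp
  next
    case less
    then show ?thesis using ab by (intro gen) auto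
  next
    case greater
    then show ?thesis unfolding transpose_commute[of a b] using ab by (intro gen) auto
  qed
  then have "(disp ?A (transpose a b) f)\<^sup>2 \<le> (10 * R)\<^sup>2" by (rule power_mono) simp
  also have "\<dots> = 100 * real n ^ 2 / real k * M" by (simp add: power_mult_distrib R2)
  finally show ?thesis by (simp add: M_def d_def m_def)
qed

section \<open>From quadratic forms to norms, and the upper bound for every k\<close>

lemma sym_null_lincomb:
  "sym_null A j f \<Longrightarrow> sym_null A j g \<Longrightarrow> sym_null A j (\<lambda>\<sigma>. f \<sigma> + c * g \<sigma>)"
  by (simp add: sym_null_def symz_def sum.distrib flip: sum_distrib_left)

lemma walk_lincomb: "walk A q (\<lambda>\<sigma>. f \<sigma> + c * g \<sigma>) = (\<lambda>\<sigma>. walk A q f \<sigma> + c * walk A q g \<sigma>)"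
  by (simp add: walk_def fun_eq_iff algebra_simps sum.distrib sum_distrib_left)

text \<open>A symmetric operator has norm equal to its numerical radius. Polarization between f and
  its image proves this inside \<open>sym_null\<close>, without diagonalization.\<close>

lemma L2_set_walk_le_of_numerical_range:
  assumes sym: "\<And>s. s permutes A \<Longrightarrow> q (inv' s) = q s" and finA: "finite A"
    and bound: "\<And>f. sym_null A j f \<Longrightarrow> \<bar>ip (perms A) (walk A q f) f\<bar> \<le> c * ip (perms A) f f"
    and f: "sym_null A j f"
  shows "L2_set (walk A q f) (perms A) \<le> c * L2_set f (perms A)"
proof -
  let ?G = "perms A"
  define a where "a = L2_set f ?G"
  define b where "b = L2_set (walk A q f) ?G"
  have finG: "finite ?G" using finA by (rule finite_permutations)
  show ?thesis
  proof (cases "a = 0 \<or> b = 0")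
    case True
    moreover have "b = 0" if "a = 0"
    proof -
      have "f \<sigma> = 0" if "\<sigma> \<in> ?G" for \<sigma> using \<open>a = 0\<close> that finG by (simp add: a_def L2_set_eq_0_iff)
      then have "walk A q f \<sigma> = 0" if "\<sigma> \<in> ?G" for \<sigma>
        using that walk_cong[of \<sigma> A f "\<lambda>_. 0" q] by (simp add: walk_def)
      then show ?thesis by (simp add: b_def L2_set_0')
    qed
    moreover have "0 \<le> c * a"
    proof (cases "a = 0")
      case False
      then have "0 < a\<^sup>2" by simp
      moreover have "0 \<le> c * a\<^sup>2" using bound[OF f] by (simp add: a_def L2_set_power2)
      ultimately have "0 \<le> c" by (simp add: zero_le_mult_iff)
      then show ?thesis by (simp add: a_def)
    qed simp
    ultimately show ?thesis by (auto simp: a_def b_def)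
  next
    case False
    then have ab: "a > 0" "b > 0" by (auto simp: a_def b_def order_less_le)
    \<comment> \<open>This gives t g the same norm as f, which makes the polarized inequality
      sharp.\<close>
    define t where "t = a / b"
    define g where "g = walk A q f"
    have g: "sym_null A j g" unfolding g_def by (rule sym_null_walk[OF f])
    have "4 * t * ip ?G g g = ip ?G (walk A q (\<lambda>\<sigma>. f \<sigma> + t * g \<sigma>)) (\<lambda>\<sigma>. f \<sigma> + t * g \<sigma>)
       - ip ?G (walk A q (\<lambda>\<sigma>. f \<sigma> + (- t) * g \<sigma>)) (\<lambda>\<sigma>. f \<sigma> + (- t) * g \<sigma>)"
    proof -
      have "ip ?G (walk A q g) f = ip ?G g g"
        unfolding g_def using ip_walk[of A q g f, OF sym] by (simp add: g_def ip_commute)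
      then show ?thesis unfolding walk_lincomb ip_linear
        by (simp add: algebra_simps flip: g_def)
    qed
    also have "\<dots> \<le> c * ip ?G (\<lambda>\<sigma>. f \<sigma> + t * g \<sigma>) (\<lambda>\<sigma>. f \<sigma> + t * g \<sigma>)
       + c * ip ?G (\<lambda>\<sigma>. f \<sigma> + (- t) * g \<sigma>) (\<lambda>\<sigma>. f \<sigma> + (- t) * g \<sigma>)"
      using bound[OF sym_null_lincomb[OF f g, of t]] bound[OF sym_null_lincomb[OF f g, of "- t"]] by linarith
    also have "\<dots> = 2 * c * (ip ?G f f + t\<^sup>2 * ip ?G g g)"
      unfolding ip_linear by (simp add: algebra_simps power2_eq_square)
    also have "ip ?G f f = a\<^sup>2" by (simp add: a_def L2_set_power2)
    also have "ip ?G g g = b\<^sup>2" by (simp add: b_def g_def L2_set_power2)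
    finally have "4 * (a * b) \<le> 4 * (c * a * a)"
      using ab by (simp add: t_def power2_eq_square algebra_simps)
    then show ?thesis using ab by (simp add: a_def b_def)
  qed
qed

lemma ip_diff_walk:
  fixes n k :: nat
  assumes "1 < k" "k \<le> n"
  shows "ip (perms {1..n}) f f - ip (perms {1..n}) (shuffle_walk n k f) f
    = (\<Sum>l=n-k+1..n. (disp {1..n} (top_cycle l) f)\<^sup>2) / (2 * real k)"
proof -
  let ?G = "perms {1..n}" and ?q = "sym_top_to_bottom_k n k"
  have "ip ?G f f - ip ?G (shuffle_walk n k f) f
     = (\<Sum>s\<in>?G. ?q s * ip ?G f f) - (\<Sum>s\<in>?G. ?q s * ip ?G (\<lambda>\<sigma>. f (\<sigma> \<circ> s)) f)"
    unfolding walk_def ip_sum_left ip_scale_left sum_distrib_right[symmetric] sum_sym_top_to_bottom_k_1[OF assms] by simp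
  also have "\<dots> = (\<Sum>s\<in>?G. ?q s * ((disp {1..n} s f)\<^sup>2 / 2))"
    unfolding sum_subtractf[symmetric]
    by (intro sum.cong refl) (simp add: disp_power2 algebra_simps)
  also have "\<dots> = (\<Sum>l=n-k+1..n. (disp {1..n} (top_cycle l) f)\<^sup>2 / 2 + (disp {1..n} (inv' (top_cycle l)) f)\<^sup>2 / 2) / (2 * real k)"
    by (rule sum_sym_top_to_bottom_k[OF assms])
  also have "\<dots> = (\<Sum>l=n-k+1..n. (disp {1..n} (top_cycle l) f)\<^sup>2) / (2 * real k)"
  proof (intro arg_cong2[where f = "(/)"] sum.cong refl)
    fix l assume "l \<in> {n-k+1..n}"
    then have "top_cycle l permutes {1..n}" by (intro top_cycle_permutes) auto
    then show "(disp {1..n} (top_cycle l) f)\<^sup>2 / 2 + (disp {1..n} (inv' (top_cycle l)) f)\<^sup>2 / 2 = (disp {1..n} (top_cycle l) f)\<^sup>2"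
      by (simp only: disp_inv)
  qed
  finally show ?thesis .
qed

text \<open>With alternating signs along the powers of s the differences telescope to 2 f after an
  odd number j of steps with s^j = id, and each power costs one copy of f + f \<circ> s. So f cannot
  nearly change sign under s.\<close>

lemma L2_set_le_of_odd_order:
  assumes s: "s permutes A" and j: "(s ^^ j) = id" "odd j"
  shows "2 * L2_set f (perms A) \<le> real j * L2_set (\<lambda>\<sigma>. f \<sigma> + f (\<sigma> \<circ> s)) (perms A)"
proof -
  let ?G = "perms A"
  have "L2_set (\<lambda>\<sigma>. f \<sigma> - (-1) ^ i * f (\<sigma> \<circ> (s ^^ i))) ?G \<le> real i * L2_set (\<lambda>\<sigma>. f \<sigma> + f (\<sigma> \<circ> s)) ?G" for i
  proof (induction i)
    case 0
    have "L2_set (\<lambda>\<sigma>. f \<sigma> - (-1) ^ 0 * f (\<sigma> \<circ> (s ^^ 0))) ?G = 0"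
      unfolding funpow.simps(1) by (rule L2_set_0') simp
    then show ?case by simp
  next
    case (Suc i)
    define h where "h \<sigma> = f \<sigma> + f (\<sigma> \<circ> s)" for \<sigma>
    have "f \<sigma> - (-1) ^ Suc i * f (\<sigma> \<circ> (s ^^ Suc i))
        = (f \<sigma> - (-1) ^ i * f (\<sigma> \<circ> (s ^^ i))) + (-1) ^ i * h (\<sigma> \<circ> (s ^^ i))" for \<sigma>
      unfolding h_def funpow_Suc_right comp_assoc by (simp add: algebra_simps)
    then have "L2_set (\<lambda>\<sigma>. f \<sigma> - (-1) ^ Suc i * f (\<sigma> \<circ> (s ^^ Suc i))) ?G
      \<le> L2_set (\<lambda>\<sigma>. f \<sigma> - (-1) ^ i * f (\<sigma> \<circ> (s ^^ i))) ?G + L2_set (\<lambda>\<sigma>. (-1) ^ i * h (\<sigma> \<circ> (s ^^ i))) ?G"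
      by (simp only: L2_set_triangle_ineq)
    also have "L2_set (\<lambda>\<sigma>. (-1) ^ i * h (\<sigma> \<circ> (s ^^ i))) ?G = L2_set h ?G"
      unfolding L2_set_scale L2_set_comp_right[OF permutes_funpow[OF s]] by (simp add: power_abs)
    also have "L2_set (\<lambda>\<sigma>. f \<sigma> - (-1) ^ i * f (\<sigma> \<circ> (s ^^ i))) ?G + L2_set h ?G \<le> real i * L2_set h ?G + L2_set h ?G"
      using Suc unfolding h_def[abs_def] by (rule add_right_mono)
    also have "real i * L2_set h ?G + L2_set h ?G = real (Suc i) * L2_set h ?G" by (simp add: algebra_simps)
    finally show ?case unfolding h_def[abs_def] .
  qed
  from this[of j] have "L2_set (\<lambda>\<sigma>. 2 * f \<sigma>) ?G \<le> real j * L2_set (\<lambda>\<sigma>. f \<sigma> + f (\<sigma> \<circ> s)) ?G"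
    using j by simp
  then show ?thesis unfolding L2_set_scale by simp
qed

text \<open>Keeps the eigenvalues away from -1. Of two consecutive cycle lengths one is odd, so a
  fixed fraction of the generators satisfies \<open>L2_set_le_of_odd_order\<close>; k > 1 provides
  at least one such pair.\<close>

lemma ip_add_walk_ge:
  fixes n k :: nat
  assumes k: "1 < k" "k \<le> n"
  shows "ip (perms {1..n}) f f + ip (perms {1..n}) (shuffle_walk n k f) f
    \<ge> ip (perms {1..n}) f f / (2 * real n ^ 2)"
proof -
  let ?G = "perms {1..n}" and ?q = "sym_top_to_bottom_k n k"
  define m where "m = n - k + 1"
  define E where "E s = ip ?G (\<lambda>\<sigma>. f \<sigma> + f (\<sigma> \<circ> s)) (\<lambda>\<sigma>. f \<sigma> + f (\<sigma> \<circ> s))" for s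
  define X where "X = ip ?G f f / real n ^ 2"
  have E: "E s = 2 * (ip ?G f f + ip ?G (\<lambda>\<sigma>. f (\<sigma> \<circ> s)) f)" if "s permutes {1..n}" for s
  proof -
    have "ip ?G (\<lambda>\<sigma>. f (\<sigma> \<circ> s)) (\<lambda>\<sigma>. f (\<sigma> \<circ> s)) = ip ?G f f"
      using L2_set_comp_right[OF that, of f] by (simp flip: L2_set_power2)
    then show ?thesis
      unfolding E_def ip_linear using ip_commute[of ?G f "\<lambda>\<sigma>. f (\<sigma> \<circ> s)"] by simp
  qed
  have Einv: "E (inv' s) = E s" if "s permutes {1..n}" for s
    unfolding E[OF that] E[OF permutes_inv[OF that]]
      ip_comp_right[OF that, of f f] ip_commute[of ?G f "\<lambda>\<sigma>. f (\<sigma> \<circ> inv' s)"] ..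
  have E0: "0 \<le> E s" for s unfolding E_def by (rule ip_self_nonneg)
  have pm: "top_cycle l permutes {1..n}" if "1 \<le> l" "l \<le> n" for l using that by (rule top_cycle_permutes)
  have odd: "4 * X \<le> E (top_cycle l)" if "odd l" "l \<le> n" for l
  proof -
    have l: "1 \<le> l" using that by (cases l) auto
    have "(2 * L2_set f ?G)\<^sup>2 \<le> (real l * L2_set (\<lambda>\<sigma>. f \<sigma> + f (\<sigma> \<circ> top_cycle l)) ?G)\<^sup>2"
      by (intro power_mono L2_set_le_of_odd_order[OF pm[OF l that(2)] top_cycle_pow_self[OF l] that(1)]) simp
    then have "4 * ip ?G f f \<le> (real l)\<^sup>2 * E (top_cycle l)"
      by (simp add: power_mult_distrib L2_set_power2 E_def)
    also have "\<dots> \<le> (real n)\<^sup>2 * E (top_cycle l)"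
      using that E0 by (intro mult_right_mono power_mono) auto
    finally show ?thesis using l that by (simp add: X_def field_simps)
  qed
  have "(\<Sum>l=m+1..n. 4 * X) \<le> (\<Sum>l=m+1..n. E (top_cycle l) + E (top_cycle (l - 1)))"
  proof (intro sum_mono)
    fix l assume l: "l \<in> {m+1..n}"
    then have "odd l \<or> odd (l - 1)" by (cases l) auto
    then have "4 * X \<le> E (top_cycle l) \<or> 4 * X \<le> E (top_cycle (l - 1))"
      using odd[of l] odd[of "l - 1"] l by (meson atLeastAtMost_iff diff_le_self order_trans)
    then show "4 * X \<le> E (top_cycle l) + E (top_cycle (l - 1))"
      using E0[of "top_cycle l"] E0[of "top_cycle (l - 1)"] by linarith
  qed
  also have "\<dots> \<le> 2 * (\<Sum>l=m..n. E (top_cycle l))"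
    using sum_shift_pred[of "\<lambda>l. E (top_cycle l)" m n] E0 k by (simp add: m_def)
  finally have "(real k - 1) * (4 * X) \<le> 2 * (\<Sum>l=m..n. E (top_cycle l))"
    using k by (simp add: m_def of_nat_diff)
  moreover have "0 \<le> X" by (simp add: X_def ip_self_nonneg)
  then have "real k / 2 * (4 * X) \<le> (real k - 1) * (4 * X)" using k by (intro mult_right_mono) auto
  ultimately have main: "real k * X \<le> (\<Sum>l=m..n. E (top_cycle l))" by linarith
  have "ip ?G f f + ip ?G (shuffle_walk n k f) f
     = (\<Sum>s\<in>?G. ?q s * ip ?G f f) + (\<Sum>s\<in>?G. ?q s * ip ?G (\<lambda>\<sigma>. f (\<sigma> \<circ> s)) f)"
    unfolding walk_def ip_sum_left ip_scale_left sum_distrib_right[symmetric] sum_sym_top_to_bottom_k_1[OF k] by simp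
  also have "\<dots> = (\<Sum>s\<in>?G. ?q s * (E s / 2))"
    unfolding sum.distrib[symmetric]
    by (intro sum.cong refl) (simp add: E algebra_simps)
  also have "\<dots> = (\<Sum>l=n-k+1..n. E (top_cycle l) / 2 + E (inv' (top_cycle l)) / 2) / (2 * real k)"
    by (rule sum_sym_top_to_bottom_k[OF k])
  also have "\<dots> = (\<Sum>l=m..n. E (top_cycle l)) / (2 * real k)"
    unfolding m_def
  proof (intro arg_cong2[where f = "(/)"] sum.cong refl)
    fix l assume "l \<in> {n-k+1..n}"
    then have "top_cycle l permutes {1..n}" by (intro top_cycle_permutes) auto
    then show "E (top_cycle l) / 2 + E (inv' (top_cycle l)) / 2 = E (top_cycle l)"
      by (simp only: Einv)
  qed
  also have "\<dots> \<ge> X / 2" using main k by (simp add: field_simps)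
  finally show ?thesis by (simp add: X_def)
qed

lemma ln_16_times_le:
  assumes "2 \<le> (x::real)"
  shows "ln (16 * x) \<le> 5 * ln x"
proof -
  have "16 * x \<le> x ^ 4 * x" using power_mono[OF assms, of 4] assms by (intro mult_right_mono) auto
  also have "\<dots> = x ^ 5" by (simp add: eval_nat_numeral)
  finally have "ln (16 * x) \<le> ln (x ^ 5)" using assms by simp
  then show ?thesis using assms by (simp add: ln_realpow)
qed

lemma half_le_ln:
  assumes "2 \<le> (x::real)"
  shows "1 / 2 \<le> ln x"
  using ln_ge_iff[of x "1/2"] assms exp_half_le2 by linarith

lemma shuffle_T2_le_cubic:
  assumes k: "1 < k" "k \<le> n"
  shows "ereal_of_enat (shuffle_T2 n k) \<le> ereal (502 * real n ^ 3 * ln (real n))"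
proof -
  let ?G = "perms {1..n}" and ?q = "sym_top_to_bottom_k n k"
  \<comment> \<open>By the transposition gap, 2 n r |f|^2 is at most n^2 times the bound 100 n^2 M /
    k for one transposition, while M / (2 k) is the Dirichlet form of the shuffle.\<close>
  define \<kappa> where "\<kappa> = 1 / (100 * real n ^ 3)"
  have n: "real n \<ge> 2" using k by simp
  have \<kappa>: "\<kappa> > 0" using n by (simp add: \<kappa>_def)
  have range: "\<bar>ip ?G (shuffle_walk n k f) f\<bar> \<le> exp (- \<kappa> * real r) * ip ?G f f"
    if r: "1 \<le> r" "r < n" and f: "sym_null {1..n} (Suc (n - r)) f" for r f
  proof -
    define M where "M = (\<Sum>l=n-k+1..n. (disp {1..n} (top_cycle l) f)\<^sup>2)"
    have "2 * real n * real r * ip ?G f f \<le> (\<Sum>a\<in>{1..n}. \<Sum>b\<in>{1..n}. (disp {1..n} (transpose a b) f)\<^sup>2)"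
      using transposition_gap[of "{1..n}" r f] r f by simp
    also have "\<dots> \<le> (\<Sum>a\<in>{1..n}. \<Sum>b\<in>{1..n}. 100 * real n ^ 2 / real k * M)"
      unfolding M_def using k by (intro sum_mono disp_transpose_le) auto
    also have "\<dots> = real n * (200 * real n ^ 3) * (M / (2 * real k))"
      by (simp add: power2_eq_square power3_eq_cube)
    finally have "real n * (2 * real r * ip ?G f f) \<le> real n * (200 * real n ^ 3 * (M / (2 * real k)))"
      by (simp only: mult_ac)
    then have "2 * real r * ip ?G f f \<le> 200 * real n ^ 3 * (M / (2 * real k))"
      using n by (simp only: mult_le_cancel_left_pos)
    then have "(2 * real r * ip ?G f f) / (200 * real n ^ 3) \<le> (200 * real n ^ 3 * (M / (2 * real k))) / (200 * real n ^ 3)"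
      by (rule divide_right_mono) simp
    then have "\<kappa> * real r * ip ?G f f \<le> M / (2 * real k)" using n by (simp add: \<kappa>_def)
    then have up: "ip ?G (shuffle_walk n k f) f \<le> (1 - \<kappa> * real r) * ip ?G f f"
      using ip_diff_walk[OF k, of f] unfolding M_def[symmetric] left_diff_distrib mult_1 by linarith
    \<comment> \<open>The gap at the negative end does not grow with r, but at 1 / (2 n^2) it
      exceeds \<kappa> n.\<close>
    have "\<kappa> * real r \<le> \<kappa> * real n" using r \<kappa> by simp
    also have "\<dots> = 1 / (100 * real n ^ 2)" using n by (simp add: \<kappa>_def power2_eq_square power3_eq_cube)
    also have "\<dots> \<le> 1 / (2 * real n ^ 2)" using n by (intro divide_left_mono) auto
    finally have "\<kappa> * real r * ip ?G f f \<le> 1 / (2 * real n ^ 2) * ip ?G f f"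
      by (intro mult_right_mono ip_self_nonneg)
    then have down: "- ip ?G (shuffle_walk n k f) f \<le> (1 - \<kappa> * real r) * ip ?G f f"
      using ip_add_walk_ge[OF k, of f] by (simp add: algebra_simps)
    have "(1 - \<kappa> * real r) * ip ?G f f \<le> exp (- \<kappa> * real r) * ip ?G f f"
      using exp_ge_add_one_self[of "- \<kappa> * real r"] by (intro mult_right_mono ip_self_nonneg) simp
    then show ?thesis using up down by linarith
  qed
  have "L2_set (shuffle_walk n k f) ?G \<le> exp (- \<kappa> * real r) * L2_set f ?G"
    if "1 \<le> r" "r < n" "sym_null {1..n} (Suc (n - r)) f" for r f
  proof (rule L2_set_walk_le_of_numerical_range[OF _ finite_atLeastAtMost _ that(3)])
    show "?q (inv' s) = ?q s" if "s permutes {1..n}" for s using that by (rule sym_top_to_bottom_k_inv)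
    show "\<bar>ip ?G (shuffle_walk n k f) f\<bar> \<le> exp (- \<kappa> * real r) * ip ?G f f"
      if "sym_null {1..n} (Suc (n - r)) f" for f
      by (rule range[OF \<open>1 \<le> r\<close> \<open>r < n\<close> that])
  qed
  then have "ereal_of_enat (shuffle_T2 n k) \<le> ereal (ln (16 * real n) / \<kappa> + 1)"
    by (rule shuffle_T2_le_real[OF k \<kappa>])
  \<comment> \<open>Here 500 is 5 times 100, and 2 n^3 ln n absorbs the rounding.\<close>
  also have "ln (16 * real n) / \<kappa> + 1 \<le> 502 * real n ^ 3 * ln (real n)"
  proof -
    note l = ln_16_times_le[OF n]
    have "1 \<le> 2 * real n ^ 3 * ln (real n)"
    proof -
      note half_le_ln[OF n]
      moreover have "1 \<le> real n ^ 3" using n by simp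
      ultimately have "1 * (1/2) \<le> real n ^ 3 * ln (real n)" by (intro mult_mono) auto
      then show ?thesis by simp
    qed
    moreover have "ln (16 * real n) / \<kappa> = 100 * real n ^ 3 * ln (16 * real n)" by (simp add: \<kappa>_def)
    moreover have "100 * real n ^ 3 * ln (16 * real n) \<le> 100 * real n ^ 3 * (5 * ln (real n))"
      using l by (intro mult_left_mono) auto
    ultimately show ?thesis by (simp add: algebra_simps)
  qed
  finally show ?thesis by simp
qed

section \<open>Two-step words and the upper bound for k close to n\<close>

definition pair_energy :: "nat \<Rightarrow> nat \<Rightarrow> ((nat \<Rightarrow> nat) \<Rightarrow> real) \<Rightarrow> real" where
  "pair_energy m n f = (\<Sum>l=m..n. \<Sum>l'=m..n. (disp {1..n} (inv' (top_cycle l) \<circ> top_cycle l') f)\<^sup>2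
     + (disp {1..n} (top_cycle l \<circ> top_cycle l') f)\<^sup>2)"

text \<open>The squared norm of the image of f is the form of the two-step walk at f. Of the four
  kinds of two-step words only the two in \<open>pair_energy\<close> are kept; each pair has weight
  1 / (2 k)^2 and contributes half a squared displacement.\<close>

lemma L2_set_walk_power2_le:
  fixes n k :: nat
  assumes k: "1 < k" "k \<le> n"
  shows "(L2_set (shuffle_walk n k f) (perms {1..n}))\<^sup>2
    \<le> ip (perms {1..n}) f f - pair_energy (n - k + 1) n f / (8 * real k ^ 2)"
proof -
  let ?G = "perms {1..n}" and ?q = "sym_top_to_bottom_k n k"
  define m where "m = n - k + 1"
  define D where "D s = (disp {1..n} s f)\<^sup>2 / 2" for s
  have D0: "0 \<le> D s" for s by (simp add: D_def)
  define F where "F s = (\<Sum>l=m..n. D (s \<circ> top_cycle l) + D (s \<circ> inv' (top_cycle l))) / (2 * real k)" for s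
  have "(L2_set (shuffle_walk n k f) ?G)\<^sup>2 = ip ?G (shuffle_walk n k (shuffle_walk n k f)) f"
    unfolding L2_set_power2 by (rule ip_walk[symmetric]) (rule sym_top_to_bottom_k_inv)
  also have "\<dots> = (\<Sum>s\<in>?G. ?q s * (\<Sum>t\<in>?G. ?q t * ip ?G (\<lambda>\<sigma>. f (\<sigma> \<circ> (s \<circ> t))) f))"
    unfolding walk_def ip_sum_left ip_scale_left comp_assoc ..
  finally have "ip ?G f f - (L2_set (shuffle_walk n k f) ?G)\<^sup>2
     = (\<Sum>s\<in>?G. ?q s * (\<Sum>t\<in>?G. ?q t * ip ?G f f)) - (\<Sum>s\<in>?G. ?q s * (\<Sum>t\<in>?G. ?q t * ip ?G (\<lambda>\<sigma>. f (\<sigma> \<circ> (s \<circ> t))) f))"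
    unfolding sum_distrib_right[symmetric] sum_sym_top_to_bottom_k_1[OF k] by simp
  also have "\<dots> = (\<Sum>s\<in>?G. ?q s * (\<Sum>t\<in>?G. ?q t * D (s \<circ> t)))"
  proof -
    have D: "ip ?G f f - ip ?G (\<lambda>\<sigma>. f (\<sigma> \<circ> (s \<circ> t))) f = D (s \<circ> t)" if "s \<in> ?G" "t \<in> ?G" for s t
      using disp_power2[of "s \<circ> t" "{1..n}" f] that by (simp add: D_def permutes_compose)
    show ?thesis
      unfolding sum_subtractf[symmetric] right_diff_distrib[symmetric]
      by (intro sum.cong refl arg_cong2[where f = "(*)"] D)
  qed
  also have "\<dots> = (\<Sum>s\<in>?G. ?q s * F s)"
    unfolding F_def m_def by (intro sum.cong refl arg_cong2[where f = "(*)"] sum_sym_top_to_bottom_k k)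
  also have "\<dots> = (\<Sum>l=m..n. F (top_cycle l) + F (inv' (top_cycle l))) / (2 * real k)"
    unfolding m_def by (rule sum_sym_top_to_bottom_k[OF k])
  also have "\<dots> \<ge> (\<Sum>l=m..n. (\<Sum>l'=m..n. D (top_cycle l \<circ> top_cycle l')) / (2 * real k)
      + (\<Sum>l'=m..n. D (inv' (top_cycle l) \<circ> top_cycle l')) / (2 * real k)) / (2 * real k)"
    unfolding F_def using D0 by (intro divide_right_mono sum_mono add_mono) auto
  also have "(\<Sum>l=m..n. (\<Sum>l'=m..n. D (top_cycle l \<circ> top_cycle l')) / (2 * real k)
      + (\<Sum>l'=m..n. D (inv' (top_cycle l) \<circ> top_cycle l')) / (2 * real k)) / (2 * real k)
     = pair_energy m n f / (8 * real k ^ 2)"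
    unfolding pair_energy_def D_def
    by (simp only: sum.distrib sum_divide_distrib[symmetric] add_divide_distrib[symmetric])
       (simp add: power2_eq_square add.commute)
  finally show ?thesis by (simp add: m_def)
qed

text \<open>Write t for \<open>top_cycle\<close>. The quotient of t b by t (b - 1) is
  \<open>transpose 1 b\<close>, and t a conjugates it to \<open>transpose a b\<close>; regrouping
  the factors gives two words of two steps. When a is at least m, so are all cycle lengths that
  occur.\<close>

lemma disp_transpose_le_pair:
  assumes "1 \<le> a" "a < b" "b \<le> n"
  shows "disp {1..n} (transpose a b) f \<le> disp {1..n} (inv' (top_cycle a) \<circ> top_cycle b) f
    + disp {1..n} (inv' (top_cycle (b - 1)) \<circ> top_cycle a) f"
proof -
  let ?A = "{1..n}" and ?t = top_cycle
  have pa: "?t a permutes ?A" by (rule top_cycle_permutes) (use assms in auto)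
  have pb: "?t b permutes ?A" by (rule top_cycle_permutes) (use assms in auto)
  have pb': "?t (b - 1) permutes ?A" by (rule top_cycle_permutes) (use assms in auto)
  obtain p where b: "b = Suc p" "1 \<le> p" using assms by (cases b) auto
  have "transpose 1 b \<circ> ?t (b - 1) = ?t b"
  proof
    fix i
    consider "i = p" | "i = Suc p" | "i \<noteq> p" "i \<noteq> Suc p" by blast
    then show "(transpose 1 b \<circ> ?t (b - 1)) i = ?t b i"
      using b by cases (auto simp: top_cycle_def transpose_def)
  qed
  then have "?t b \<circ> inv' (?t (b - 1)) = transpose 1 b \<circ> (?t (b - 1) \<circ> inv' (?t (b - 1)))"
    by (metis comp_assoc)
  then have star: "?t b \<circ> inv' (?t (b - 1)) = transpose 1 b"
    unfolding permutes_inv_o(1)[OF pb'] by simp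
  have "transpose 1 b \<circ> ?t a = ?t a \<circ> transpose a b"
  proof -
    have "?t a a = 1" "?t a b = b" using assms by (auto simp: top_cycle_def)
    then show ?thesis
      using transpose_comp_eq[OF permutes_bij[OF pa], of "?t a a" "?t a b"]
      unfolding permutes_inverses[OF pa] by simp
  qed
  then have "inv' (?t a) \<circ> (transpose 1 b \<circ> ?t a) = (inv' (?t a) \<circ> ?t a) \<circ> transpose a b"
    by (simp only: comp_assoc)
  then have "transpose a b = (inv' (?t a) \<circ> ?t b) \<circ> (inv' (?t (b - 1)) \<circ> ?t a)"
    unfolding permutes_inv_o(2)[OF pa] star[symmetric] id_o comp_assoc by (rule sym)
  then show ?thesis
    using disp_comp[OF permutes_compose[OF pb permutes_inv[OF pa]], of "inv' (?t (b - 1)) \<circ> ?t a" f] by (simp only:)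
qed

text \<open>The words for different pairs a < b overlap only boundedly often, so the sum over all of
  them costs no factor depending on n or m.\<close>

lemma sum_disp_transpose_upper_le:
  assumes "1 \<le> m"
  shows "(\<Sum>a=m..n. \<Sum>b=m..n. (disp {1..n} (transpose a b) f)\<^sup>2) \<le> 8 * pair_energy m n f"
proof -
  define T where "T a b = (disp {1..n} (transpose a b) f)\<^sup>2" for a b
  define p where "p l l' = (disp {1..n} (inv' (top_cycle l) \<circ> top_cycle l') f)\<^sup>2" for l l'
  define g where "g a b = (if a < b then 2 * p a b + 2 * p (b - 1) a else 0)" for a b
  define P where "P = (\<Sum>l=m..n. \<Sum>l'=m..n. p l l')"
  have p0: "0 \<le> p l l'" for l l' by (simp add: p_def)
  have Tg: "T a b \<le> g a b" if "a < b" "1 \<le> a" "b \<le> n" for a b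
  proof -
    have "T a b \<le> (disp {1..n} (inv' (top_cycle a) \<circ> top_cycle b) f
       + disp {1..n} (inv' (top_cycle (b - 1)) \<circ> top_cycle a) f)\<^sup>2"
      unfolding T_def using that by (intro power_mono disp_transpose_le_pair) auto
    also have "\<dots> \<le> 2 * p a b + 2 * p (b - 1) a" unfolding p_def by (rule square_add_le)
    finally show ?thesis using that by (simp add: g_def)
  qed
  have g0: "0 \<le> g a b" for a b using p0 by (simp add: g_def)
  have Tg': "T a b \<le> g a b + g b a" if "a \<in> {m..n}" "b \<in> {m..n}" for a b
  proof (cases a b rule: linorder_cases)
    case equal
    then have "transpose a b = id" by simp
    then have "T a b = 0" unfolding T_def by simp
    then show ?thesis using g0[of a b] g0[of b a] by simp
  next
    case less
    then show ?thesis using Tg[of a b] g0[of b a] that assms by simp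
  next
    case greater
    then show ?thesis using Tg[of b a] g0[of a b] that assms unfolding T_def transpose_commute[of a b] by simp
  qed
  have "(\<Sum>a=m..n. \<Sum>b=m..n. T a b) \<le> (\<Sum>a=m..n. \<Sum>b=m..n. g a b + g b a)"
    by (intro sum_mono Tg')
  also have "\<dots> = (\<Sum>a=m..n. \<Sum>b=m..n. g a b) + (\<Sum>a=m..n. \<Sum>b=m..n. g b a)"
    by (simp add: sum.distrib)
  also have "(\<Sum>a=m..n. \<Sum>b=m..n. g b a) = (\<Sum>a=m..n. \<Sum>b=m..n. g a b)"
    by (rule sum.swap)
  also have "(\<Sum>a=m..n. \<Sum>b=m..n. g a b) + (\<Sum>a=m..n. \<Sum>b=m..n. g a b) = 2 * (\<Sum>a=m..n. \<Sum>b=m..n. g a b)" by simp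
  also have "(\<Sum>a=m..n. \<Sum>b=m..n. g a b) \<le> (\<Sum>a=m..n. 2 * (\<Sum>b=m..n. p a b) + 2 * (\<Sum>b=m..n. p b a))"
  proof (intro sum_mono)
    fix a assume a: "a \<in> {m..n}"
    have "(\<Sum>b=m..n. g a b) \<le> (\<Sum>b=m..n. 2 * p a b + (if a < b then 2 * p (b - 1) a else 0))"
      using p0 by (intro sum_mono) (auto simp: g_def)
    also have "\<dots> = 2 * (\<Sum>b=m..n. p a b) + (\<Sum>b=m..n. if a < b then 2 * p (b - 1) a else 0)"
      by (simp add: sum.distrib sum_distrib_left)
    also have "(\<Sum>b=m..n. if a < b then 2 * p (b - 1) a else 0) = (\<Sum>b=a+1..n. 2 * p (b - 1) a)"
      using a by (intro sum.mono_neutral_cong_right) auto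
    also have "\<dots> = (\<Sum>l\<in>(\<lambda>b. b - 1) ` {a+1..n}. 2 * p l a)"
      by (subst sum.reindex) (auto simp: inj_on_def)
    also have "\<dots> \<le> (\<Sum>l=m..n. 2 * p l a)" using a p0 by (intro sum_mono2) auto
    finally show "(\<Sum>b=m..n. g a b) \<le> 2 * (\<Sum>b=m..n. p a b) + 2 * (\<Sum>b=m..n. p b a)"
      by (simp add: sum_distrib_left)
  qed
  also have "(\<Sum>a=m..n. 2 * (\<Sum>b=m..n. p a b) + 2 * (\<Sum>b=m..n. p b a)) = 2 * P + 2 * P"
    unfolding P_def sum.distrib sum_distrib_left[symmetric] by (subst (2) sum.swap) simp
  also have "P \<le> pair_energy m n f"
    unfolding P_def pair_energy_def p_def by (intro sum_mono) simp
  finally show ?thesis by (simp add: T_def)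
qed

lemma pair_energy_nonneg: "0 \<le> pair_energy m n f"
  unfolding pair_energy_def by (intro sum_nonneg) simp

text \<open>At most about 2 m n transpositions meet the positions below m, so O(S / n) for each of
  them is enough, S being the energy. Two averages give this: over an intermediate position d for
  pairs in the range from m on, and over the length d of a squared cycle for pairs that must first
  be moved into that range.\<close>

lemma sum_disp_transpose_le:
  assumes m: "1 \<le> m" and nm: "6 * m \<le> n"
  shows "(\<Sum>a=1..n. \<Sum>b=1..n. (disp {1..n} (transpose a b) f)\<^sup>2)
    \<le> (8 + 20 * real m * (16 * real m ^ 2 + 640)) * pair_energy m n f"
proof -
  define T where "T a b = (disp {1..n} (transpose a b) f)\<^sup>2" for a b
  define S where "S = pair_energy m n f"
  define K where "K = 16 * real m ^ 2 + 640"
  define k where "k = real (n - m + 1)"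
  have T0: "0 \<le> T a b" for a b by (simp add: T_def)
  have S0: "0 \<le> S" unfolding S_def by (rule pair_energy_nonneg)
  have k: "k \<ge> real n / 2" "k \<le> real n" using m nm by (auto simp: k_def)
  have n0: "real n > 0" using m nm by simp
  have upper: "(\<Sum>a=m..n. \<Sum>b=m..n. T a b) \<le> 8 * S"
    unfolding T_def S_def by (rule sum_disp_transpose_upper_le[OF m])
  have row: "(\<Sum>d=m..n. T u d) \<le> 8 * S" if "u \<in> {m..n}" for u
  proof -
    have "(\<Sum>d=m..n. T u d) \<le> (\<Sum>a=m..n. \<Sum>b=m..n. T a b)"
      using that T0 by (intro member_le_sum[of u _ "\<lambda>a. \<Sum>d=m..n. T a d"]) (auto intro: sum_nonneg)
    then show ?thesis using upper by linarith
  qed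
  have tri: "T u v \<le> 8 * T u d + 2 * T v d" if "u \<in> {1..n}" "v \<in> {1..n}" "d \<in> {1..n}" for u v d
  proof -
    have "T u v \<le> (2 * disp {1..n} (transpose u d) f + disp {1..n} (transpose v d) f)\<^sup>2"
      unfolding T_def using disp_transpose_triangle[OF that] by (rule power_mono) simp
    also have "\<dots> \<le> 2 * (2 * disp {1..n} (transpose u d) f)\<^sup>2 + 2 * (disp {1..n} (transpose v d) f)\<^sup>2"
      by (rule square_add_le)
    finally show ?thesis by (simp add: T_def power_mult_distrib)
  qed
  have single: "real n * T u v \<le> 160 * S" if uv: "u \<in> {m..n}" "v \<in> {m..n}" for u v
  proof -
    have "(\<Sum>d=m..n. T u v) \<le> (\<Sum>d=m..n. 8 * T u d + 2 * T v d)"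
      using uv m by (intro sum_mono tri) auto
    also have "\<dots> = 8 * (\<Sum>d=m..n. T u d) + 2 * (\<Sum>d=m..n. T v d)"
      by (simp add: sum.distrib sum_distrib_left)
    also have "\<dots> \<le> 80 * S" using row[OF uv(1)] row[OF uv(2)] by linarith
    finally have "k * T u v \<le> 80 * S" using nm by (simp add: k_def Suc_diff_le)
    moreover have "real n / 2 * T u v \<le> k * T u v" using k T0 by (intro mult_right_mono)
    ultimately show ?thesis by simp
  qed
  have base: "real n * T a m \<le> K * S" if a: "a \<in> {1..n}" for a
  proof (cases "a < m")
    case False
    then have "real n * T a m \<le> 160 * S" using a nm by (intro single) auto
    also have "\<dots> \<le> K * S" using S0 by (intro mult_right_mono) (auto simp: K_def)
    finally show ?thesis .
  next
    case True
    define u where "u = T (a + 2 * m) (3 * m)"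
    define w where "w d = (disp {1..n} (top_cycle d \<circ> top_cycle d) f)\<^sup>2" for d
    have w0: "0 \<le> w d" for d by (simp add: w_def)
    have "(\<Sum>d=3*m..n. T a m) \<le> (\<Sum>d=3*m..n. 8 * real m ^ 2 * w d + 2 * u)"
    proof (intro sum_mono)
      fix d assume d: "d \<in> {3*m..n}"
      let ?x = "top_cycle d"
      have pd: "?x permutes {1..n}" by (rule top_cycle_permutes) (use d m in auto)
      have pdd: "?x \<circ> ?x permutes {1..n}" by (rule permutes_compose[OF pd pd])
      \<comment> \<open>Only the square of a cycle is a two-step word. Its m-th power shifts by 2 m,
        which takes a and m into the range from m on; d at least 3 m excludes wrapping
        around.\<close>
      have x2: "(?x \<circ> ?x) ^^ m = ?x ^^ (2 * m)"
        using funpow_mult[of m 2 ?x] by (simp add: numeral_2_eq_2)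
      have xa: "((?x \<circ> ?x) ^^ m) a = a + 2 * m" and xm: "((?x \<circ> ?x) ^^ m) m = 3 * m"
        unfolding x2 using top_cycle_pow[of a d "2 * m"] top_cycle_pow[of m d "2 * m"] d a m True by auto
      have am: "a \<in> {1..n}" "m \<in> {1..n}" using a m nm by auto
      have "disp {1..n} (transpose a m) f \<le> 2 * disp {1..n} ((?x \<circ> ?x) ^^ m) f + disp {1..n} (transpose (a + 2 * m) (3 * m)) f"
        using disp_transpose_conj[OF permutes_funpow[OF pdd, of m] am, of f] unfolding xa xm .
      moreover have "disp {1..n} ((?x \<circ> ?x) ^^ m) f \<le> real m * disp {1..n} (?x \<circ> ?x) f"
        by (rule disp_power[OF pdd])
      ultimately have "disp {1..n} (transpose a m) f \<le> 2 * (real m * disp {1..n} (?x \<circ> ?x) f) + disp {1..n} (transpose (a + 2 * m) (3 * m)) f"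
        by linarith
      then have "T a m \<le> (2 * (real m * disp {1..n} (?x \<circ> ?x) f) + disp {1..n} (transpose (a + 2 * m) (3 * m)) f)\<^sup>2"
        unfolding T_def by (rule power_mono) simp
      also have "\<dots> \<le> 2 * (2 * (real m * disp {1..n} (?x \<circ> ?x) f))\<^sup>2 + 2 * (disp {1..n} (transpose (a + 2 * m) (3 * m)) f)\<^sup>2"
        by (rule square_add_le)
      finally show "T a m \<le> 8 * real m ^ 2 * w d + 2 * u"
        unfolding w_def u_def T_def power_mult_distrib by simp
    qed
    also have "\<dots> = 8 * real m ^ 2 * (\<Sum>d=3*m..n. w d) + real (n + 1 - 3 * m) * (2 * u)"
      by (simp add: sum.distrib sum_distrib_left)
    also have "\<dots> \<le> 8 * real m ^ 2 * S + real n * (2 * u)"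
    proof (intro add_mono mult_left_mono mult_right_mono)
      have "(\<Sum>d=3*m..n. w d) \<le> (\<Sum>l=m..n. w l)" using w0 by (intro sum_mono2) auto
      also have "\<dots> \<le> (\<Sum>l=m..n. \<Sum>l'=m..n. (disp {1..n} (top_cycle l \<circ> top_cycle l') f)\<^sup>2)"
      proof (intro sum_mono)
        fix l assume "l \<in> {m..n}"
        then show "w l \<le> (\<Sum>l'=m..n. (disp {1..n} (top_cycle l \<circ> top_cycle l') f)\<^sup>2)"
          unfolding w_def by (intro member_le_sum[of l _ "\<lambda>l'. (disp {1..n} (top_cycle l \<circ> top_cycle l') f)\<^sup>2"]) auto
      qed
      also have "\<dots> \<le> S" unfolding S_def pair_energy_def by (intro sum_mono) simp
      finally show "(\<Sum>d=3*m..n. w d) \<le> S" .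
      show "real (n + 1 - 3 * m) \<le> real n" using m by simp
    qed (simp_all add: u_def T0)
    also have "\<dots> \<le> 8 * real m ^ 2 * S + 320 * S"
      using single[of "a + 2 * m" "3 * m"] m nm True by (simp add: u_def)
    finally have "real (n + 1 - 3 * m) * T a m \<le> 8 * real m ^ 2 * S + 320 * S" by simp
    \<comment> \<open>With 6 m at most n, at least half of all lengths d take part in the
      average.\<close>
    moreover have "real n / 2 * T a m \<le> real (n + 1 - 3 * m) * T a m"
      using nm T0 by (intro mult_right_mono) auto
    ultimately have "real n / 2 * T a m \<le> 8 * real m ^ 2 * S + 320 * S" by linarith
    then show ?thesis by (simp add: K_def algebra_simps)
  qed
  \<comment> \<open>The triangle through m costs 8 + 2 times the base bound.\<close>
  define X where "X = 10 * K * S / real n"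
  have X0: "0 \<le> X" using S0 by (simp add: X_def K_def)
  have any: "T a b \<le> X" if ab: "a \<in> {1..n}" "b \<in> {1..n}" for a b
  proof -
    have "real n * T a b \<le> real n * (8 * T a m + 2 * T b m)"
      using ab m nm by (intro mult_left_mono tri) auto
    also have "\<dots> = 8 * (real n * T a m) + 2 * (real n * T b m)" by (simp add: algebra_simps)
    also have "\<dots> \<le> 10 * K * S" using base[OF ab(1)] base[OF ab(2)] by linarith
    finally show ?thesis using n0 by (simp add: X_def pos_le_divide_eq mult.commute)
  qed
  have split: "(\<Sum>a=1..n. g a) = (\<Sum>a=1..<m. g a) + (\<Sum>a=m..n. g a)" for g :: "nat \<Rightarrow> real"
  proof -
    have "{1..n} = {1..<m} \<union> {m..n}" using m nm by auto
    then show ?thesis by (simp only:) (rule sum.union_disjoint, auto)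
  qed
  have row_split: "(\<Sum>b=1..n. T a b) = (\<Sum>b=1..<m. T a b) + (\<Sum>b=m..n. T a b)" for a by (rule split)
  have "(\<Sum>a=1..n. \<Sum>b=1..n. T a b) = (\<Sum>a=1..<m. \<Sum>b=1..n. T a b) + (\<Sum>a=m..n. \<Sum>b=1..n. T a b)"
    by (rule split)
  also have "(\<Sum>a=m..n. \<Sum>b=1..n. T a b) = (\<Sum>a=m..n. \<Sum>b=1..<m. T a b) + (\<Sum>a=m..n. \<Sum>b=m..n. T a b)"
    by (simp only: row_split sum.distrib)
  finally have total: "(\<Sum>a=1..n. \<Sum>b=1..n. T a b) = (\<Sum>a=1..<m. \<Sum>b=1..n. T a b)
     + ((\<Sum>a=m..n. \<Sum>b=1..<m. T a b) + (\<Sum>a=m..n. \<Sum>b=m..n. T a b))" .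
  have "(\<Sum>a=1..<m. \<Sum>b=1..n. T a b) \<le> (\<Sum>a=1..<m. \<Sum>b=1..n. X)"
    using nm by (intro sum_mono any) auto
  also have "\<dots> = real (m - 1) * (real n * X)" by simp
  also have "\<dots> \<le> real m * (real n * X)" using X0 by (intro mult_right_mono) auto
  finally have 1: "(\<Sum>a=1..<m. \<Sum>b=1..n. T a b) \<le> real m * (real n * X)" .
  have "(\<Sum>a=m..n. \<Sum>b=1..<m. T a b) \<le> (\<Sum>a=m..n. \<Sum>b=1..<m. X)"
    using nm m by (intro sum_mono any) auto
  also have "\<dots> = real (m - 1) * (k * X)"
    using nm by (simp add: k_def Suc_diff_le algebra_simps)
  also have "\<dots> \<le> real m * (real n * X)"
  proof (intro mult_mono)
    show "0 \<le> k * X" using X0 by (simp add: k_def)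
  qed (use X0 k in auto)
  finally have 2: "(\<Sum>a=m..n. \<Sum>b=1..<m. T a b) \<le> real m * (real n * X)" .
  have nX: "real n * X = 10 * K * S" using n0 by (simp add: X_def)
  have "(\<Sum>a=1..n. \<Sum>b=1..n. T a b) \<le> 2 * (real m * (10 * K * S)) + 8 * S"
    using total 1[unfolded nX] 2[unfolded nX] upper by linarith
  also have "\<dots> = (8 + 20 * real m * K) * S" by (simp add: algebra_simps)
  finally show ?thesis by (simp only: T_def S_def K_def)
qed

lemma shuffle_T2_le_n_ln_n:
  fixes n k :: nat
  assumes k: "1 < k" "k \<le> n" and M: "real (n - k + 1) \<le> M" "6 * M \<le> real n"
  shows "ereal_of_enat (shuffle_T2 n k) \<le> ereal ((40 * (8 + 20 * M * (16 * M ^ 2 + 640)) + 2) * real n * ln (real n))"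
proof -
  let ?G = "perms {1..n}"
  define m where "m = n - k + 1"
  define W where "W = 8 + 20 * M * (16 * M ^ 2 + 640)"
  \<comment> \<open>From 2 n r |f|^2 at most W S and the denominator 8 k^2, with k at most n, the
    squared norm shrinks by the factor 1 - 2 \<kappa> r; taking the root halves the
    exponent.\<close>
  define \<kappa> where "\<kappa> = 1 / (8 * W * real n)"
  have n: "real n \<ge> 2" using k by simp
  have M0: "0 \<le> M" using M(1) by linarith
  have W: "W \<ge> 8" using M0 by (simp add: W_def)
  have \<kappa>: "\<kappa> > 0" using n W by (simp add: \<kappa>_def)
  have mM: "8 + 20 * real m * (16 * real m ^ 2 + 640) \<le> W"
    unfolding W_def using M(1) M0 by (intro add_left_mono mult_mono power_mono add_right_mono) (auto simp: m_def)
  have nm: "6 * m \<le> n" using M by (simp add: m_def)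
  have contr: "L2_set (shuffle_walk n k f) ?G \<le> exp (- \<kappa> * real r) * L2_set f ?G"
    if r: "1 \<le> r" "r < n" and f: "sym_null {1..n} (Suc (n - r)) f" for r f
  proof -
    define S where "S = pair_energy m n f"
    have S0: "0 \<le> S" unfolding S_def by (rule pair_energy_nonneg)
    have "2 * real n * real r * ip ?G f f \<le> (\<Sum>a\<in>{1..n}. \<Sum>b\<in>{1..n}. (disp {1..n} (transpose a b) f)\<^sup>2)"
      using transposition_gap[of "{1..n}" r f] r f by simp
    also have "\<dots> \<le> (8 + 20 * real m * (16 * real m ^ 2 + 640)) * S"
      unfolding S_def using nm by (intro sum_disp_transpose_le) (auto simp: m_def)
    also have "\<dots> \<le> W * S" using mM S0 by (rule mult_right_mono)
    finally have "(2 * real n * real r * ip ?G f f) / (8 * W * real n ^ 2) \<le> W * S / (8 * W * real n ^ 2)"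
      using W by (intro divide_right_mono) auto
    also have "W * S / (8 * W * real n ^ 2) = S / (8 * real n ^ 2)" using W by simp
    also have "\<dots> \<le> S / (8 * real k ^ 2)"
      using k S0 by (intro divide_left_mono mult_left_mono power_mono) auto
    finally have "2 * \<kappa> * real r * ip ?G f f \<le> S / (8 * real k ^ 2)"
      using n by (simp add: \<kappa>_def power2_eq_square)
    then have "(L2_set (shuffle_walk n k f) ?G)\<^sup>2 \<le> (1 - 2 * \<kappa> * real r) * ip ?G f f"
      using L2_set_walk_power2_le[OF k, of f] unfolding S_def m_def left_diff_distrib mult_1 by linarith
    also have "\<dots> \<le> exp (- 2 * \<kappa> * real r) * ip ?G f f"
      using exp_ge_add_one_self[of "- 2 * \<kappa> * real r"] by (intro mult_right_mono ip_self_nonneg) simp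
    also have "\<dots> = (exp (- \<kappa> * real r) * L2_set f ?G)\<^sup>2"
      by (simp add: power_mult_distrib L2_set_power2 flip: exp_double)
    finally show ?thesis by (rule power2_le_imp_le) simp
  qed
  have "ereal_of_enat (shuffle_T2 n k) \<le> ereal (ln (16 * real n) / \<kappa> + 1)"
    by (rule shuffle_T2_le_real[OF k \<kappa> contr])
  also have "ln (16 * real n) / \<kappa> + 1 \<le> (40 * W + 2) * real n * ln (real n)"
  proof -
    note l = ln_16_times_le[OF n]
    have "1 \<le> 2 * real n * ln (real n)"
    proof -
      note half_le_ln[OF n]
      then have "1 * (1/2) \<le> real n * ln (real n)" using n by (intro mult_mono) auto
      then show ?thesis by simp
    qed
    moreover have "ln (16 * real n) / \<kappa> = 8 * W * real n * ln (16 * real n)" by (simp add: \<kappa>_def)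
    moreover have "8 * W * real n * ln (16 * real n) \<le> 8 * W * real n * (5 * ln (real n))"
      using l W by (intro mult_left_mono) auto
    ultimately show ?thesis by (simp add: algebra_simps)
  qed
  finally show ?thesis by (simp add: W_def)
qed

subsection \<open>Lower bounds\<close>

lemma sum_permutes_apply:
  assumes finA: "finite A" and a: "a \<in> A"
  shows "real (card A) * (\<Sum>\<sigma> | \<sigma> permutes A. g (\<sigma> a)) = fact (card A) * (\<Sum>x\<in>A. g x :: real)"
proof -
  let ?G = "perms A"
  have eq: "(\<Sum>\<sigma>\<in>?G. g (\<sigma> b)) = (\<Sum>\<sigma>\<in>?G. g (\<sigma> a))" if "b \<in> A" for b
    using sum_permutes_comp_right[OF permutes_swap_id[OF a that], of "\<lambda>\<sigma>. g (\<sigma> b)"] by simp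
  have "real (card A) * (\<Sum>\<sigma>\<in>?G. g (\<sigma> a)) = (\<Sum>b\<in>A. \<Sum>\<sigma>\<in>?G. g (\<sigma> b))"
    by (simp add: eq)
  also have "\<dots> = (\<Sum>\<sigma>\<in>?G. \<Sum>b\<in>A. g (\<sigma> b))" by (rule sum.swap)
  also have "\<dots> = (\<Sum>\<sigma>\<in>?G. \<Sum>x\<in>A. g x)"
  proof (rule sum.cong[OF refl])
    fix \<sigma> assume "\<sigma> \<in> ?G"
    then show "(\<Sum>b\<in>A. g (\<sigma> b)) = (\<Sum>x\<in>A. g x)"
      using sum.permute[of \<sigma> A g] by (simp add: o_def)
  qed
  also have "\<dots> = fact (card A) * (\<Sum>x\<in>A. g x)"
    using card_permutations[OF refl finA] by simp
  finally show ?thesis .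
qed

lemma funpow_Suc_apply: "(f ^^ Suc m) x = f ((f ^^ m) x)"
  by simp

lemma walk_comp_left: "walk A q (\<lambda>\<tau>. f (\<sigma> \<circ> \<tau>)) = (\<lambda>\<tau>. walk A q f (\<sigma> \<circ> \<tau>))"
  unfolding walk_def[abs_def] comp_assoc ..

lemma walk_power_comp_left:
  "(walk A q ^^ m) (\<lambda>\<tau>. f (\<sigma> \<circ> \<tau>)) = (\<lambda>\<tau>. (walk A q ^^ m) f (\<sigma> \<circ> \<tau>))"
proof (induction m)
  case (Suc m)
  then show ?case unfolding funpow_Suc_apply by (simp only: walk_comp_left)
qed (simp only: funpow_0)

lemma ip_walk_power:
  assumes "\<And>s. s permutes A \<Longrightarrow> q (inv' s) = q s"
  shows "ip (perms A) ((walk A q ^^ m) f) g = ip (perms A) f ((walk A q ^^ m) g)"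
proof (induction m arbitrary: f)
  case (Suc m)
  have "ip (perms A) ((walk A q ^^ Suc m) f) g = ip (perms A) ((walk A q ^^ m) (walk A q f)) g"
    by (simp add: funpow_swap1)
  also have "\<dots> = ip (perms A) (walk A q f) ((walk A q ^^ m) g)" by (rule Suc)
  also have "\<dots> = ip (perms A) f ((walk A q ^^ Suc m) g)"
    unfolding funpow_Suc_apply by (rule ip_walk) (rule assms)
  finally show ?case .
qed simp

lemma ip_id_mass:
  assumes "finite A"
  shows "ip (perms A) id_mass g = g id"
proof -
  have "ip (perms A) id_mass g = (\<Sum>\<sigma> | \<sigma> permutes A. if \<sigma> = id then g \<sigma> else 0)"
    unfolding ip_def id_mass_def by (intro sum.cong) auto
  then show ?thesis
    using finite_permutations[OF assms] permutes_id[of A] by (simp add: sum.delta)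
qed

text \<open>The value at \<sigma> is the mean of f (\<sigma> \<circ> \<tau>) for \<tau> distributed
  as the m-fold convolution. Self-adjointness moves the powers to the unit mass.\<close>

lemma walk_power_apply:
  assumes "\<And>s. s permutes A \<Longrightarrow> q (inv' s) = q s" "finite A"
  shows "(walk A q ^^ m) f \<sigma> = ip (perms A) ((walk A q ^^ m) id_mass) (\<lambda>\<tau>. f (\<sigma> \<circ> \<tau>))"
proof -
  have "ip (perms A) ((walk A q ^^ m) id_mass) (\<lambda>\<tau>. f (\<sigma> \<circ> \<tau>))
      = ip (perms A) id_mass (\<lambda>\<tau>. (walk A q ^^ m) f (\<sigma> \<circ> \<tau>))"
    unfolding walk_power_comp_left[symmetric] by (rule ip_walk_power) (rule assms(1))
  also have "\<dots> = (walk A q ^^ m) f (\<sigma> \<circ> id)" by (rule ip_id_mass[OF assms(2)])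
  finally show ?thesis unfolding comp_id by (rule HOL.sym)
qed

text \<open>Self-adjointness and Cauchy-Schwarz make the norms along the walk log-convex, so the
  ratio of consecutive norms never falls below its first value, which is at least c. This replaces
  Jensen's inequality for a spectral measure.\<close>

lemma L2_set_walk_power_ge:
  assumes sym: "\<And>s. s permutes A \<Longrightarrow> q (inv' s) = q s" and c: "0 < c"
    and v: "c * ip (perms A) v v \<le> ip (perms A) (walk A q v) v"
  shows "c ^ m * L2_set v (perms A) \<le> L2_set ((walk A q ^^ m) v) (perms A)"
proof -
  let ?G = "perms A"
  define a where "a m = L2_set ((walk A q ^^ m) v) ?G" for m
  have a0: "0 \<le> a m" for m by (simp add: a_def)
  show ?thesis
  proof (cases "a 0 = 0")
    case True
    then show ?thesis using a0[of m] by (simp add: a_def)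
  next
    case False
    then have pos: "a 0 > 0" using a0[of 0] by simp
    have conv: "(a (Suc m))\<^sup>2 \<le> a (Suc (Suc m)) * a m" for m
    proof -
      have "(a (Suc m))\<^sup>2 = ip ?G ((walk A q ^^ Suc (Suc m)) v) ((walk A q ^^ m) v)"
        unfolding a_def L2_set_power2 funpow_Suc_apply by (rule ip_walk[symmetric]) (rule sym)
      also have "\<dots> \<le> a (Suc (Suc m)) * a m"
        unfolding a_def using ip_le_L2_set abs_le_D1 by blast
      finally show ?thesis .
    qed
    have step: "0 < a m \<and> c * a m \<le> a (Suc m)" for m
    proof (induction m)
      case 0
      have "c * (a 0)\<^sup>2 \<le> ip ?G (walk A q v) v" using v by (simp add: a_def L2_set_power2)
      also have "\<dots> \<le> a 1 * a 0" unfolding a_def using ip_le_L2_set[of ?G "walk A q v" v] by simp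
      finally show ?case using pos by (simp add: power2_eq_square)
    next
      case (Suc m)
      then have p: "0 < a (Suc m)" using c by (meson mult_pos_pos order_less_le_trans)
      have "(c * a m) * a (Suc m) \<le> a (Suc m) * a (Suc m)"
        using Suc p by (intro mult_right_mono) auto
      also have "\<dots> \<le> a (Suc (Suc m)) * a m" using conv[of m] by (simp add: power2_eq_square)
      finally have "(c * a (Suc m)) * a m \<le> a (Suc (Suc m)) * a m" by (simp add: mult_ac)
      then show ?case using Suc p by (simp add: mult_le_cancel_right)
    qed
    have "c ^ m * a 0 \<le> a m"
    proof (induction m)
      case (Suc m)
      have "c ^ Suc m * a 0 \<le> c * a m" using Suc c by (simp add: mult.assoc)
      then show ?case using step[of m] by linarith
    qed simp
    then show ?thesis by (simp add: a_def)
  qed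
qed

section \<open>Waves in the cyclic distance of two cards\<close>

lemma sum_cis_multiples:
  fixes c n :: nat
  assumes "0 < c" "c < n"
  shows "(\<Sum>y=1..n. cis (2 * pi * real c / real n * real y)) = 0"
proof -
  define t where "t = 2 * pi * real c / real n"
  define z where "z = cis t"
  have tn: "t * real n = 2 * pi * real c" using assms by (simp add: t_def)
  have zn: "z ^ n = 1"
    unfolding z_def Complex.DeMoivre using tn cis_multiple_2pi[of "real c"] by (simp add: mult_ac)
  have z1: "z \<noteq> 1"
  proof
    assume "z = 1"
    then have "cos t = 1" by (simp add: z_def complex_eq_iff)
    then obtain j :: int where j: "t = of_int j * 2 * pi" using cos_one_2pi_int by auto
    then have "2 * pi * (real c / real n) = 2 * pi * of_int j" by (simp add: t_def)
    then have "real c / real n = of_int j" unfolding mult_cancel_left using pi_neq_zero by simp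
    moreover have "0 < real c / real n" "real c / real n < 1" using assms by auto
    ultimately have "(0::real) < of_int j" "of_int j < (1::real)" by simp_all
    then show False by simp
  qed
  have "(\<Sum>y=1..n. cis (t * real y)) = (\<Sum>y=1..n. z ^ y)"
    unfolding z_def Complex.DeMoivre by (simp add: mult.commute)
  also have "\<dots> = z * (\<Sum>y<n. z ^ y)"
    unfolding sum_distrib_left
    by (rule sum.reindex_bij_witness[of _ Suc "\<lambda>y. y - 1"]) (auto simp flip: power_Suc)
  also have "(\<Sum>y<n. z ^ y) = 0" using z1 zn by (simp add: geometric_sum)
  finally show ?thesis by (simp add: t_def)
qed

lemma sum_sin_differences:
  assumes "2 \<le> (n::nat)"
  shows "(\<Sum>y=1..n. sin (2 * pi / real n * (real x - real y))) = 0"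
proof -
  define t where "t = 2 * pi / real n"
  have "(\<Sum>y=1..n. cis (t * (real x - real y))) = cis (t * real x) * cnj (\<Sum>y=1..n. cis (t * real y))"
    by (simp add: sum_distrib_left cis_cnj cis_mult algebra_simps)
  also have "(\<Sum>y=1..n. cis (t * real y)) = 0"
    using sum_cis_multiples[of 1 n] assms by (simp add: t_def)
  finally have "Im (\<Sum>y=1..n. cis (t * (real x - real y))) = 0" by simp
  then show ?thesis by (simp add: t_def)
qed

text \<open>Squaring doubles the frequency, and 2 must stay below n for the full-period sum to
  vanish.\<close>

lemma sum_sin_differences_power2:
  assumes "3 \<le> (n::nat)"
  shows "(\<Sum>y=1..n. (sin (2 * pi / real n * (real x - real y)))\<^sup>2) = real n / 2"
proof -
  define t where "t = 2 * pi / real n"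
  have "(\<Sum>y=1..n. cis (2 * t * (real x - real y))) = cis (2 * t * real x) * cnj (\<Sum>y=1..n. cis (2 * t * real y))"
    by (simp add: sum_distrib_left cis_cnj cis_mult algebra_simps)
  also have "(\<Sum>y=1..n. cis (2 * t * real y)) = 0"
    using sum_cis_multiples[of 2 n] assms by (simp add: t_def mult_ac)
  finally have "Re (\<Sum>y=1..n. cis (2 * t * (real x - real y))) = 0" by simp
  then have z: "(\<Sum>y=1..n. cos (2 * (t * (real x - real y)))) = 0" by (simp add: mult.assoc)
  have "(\<Sum>y=1..n. (sin (t * (real x - real y)))\<^sup>2) = (\<Sum>y=1..n. 1 / 2 - cos (2 * (t * (real x - real y))) / 2)"
    by (intro sum.cong refl) (simp add: cos_double_sin diff_divide_distrib)
  also have "\<dots> = real n / 2" using z by (simp add: sum_subtractf flip: sum_divide_distrib)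
  finally show ?thesis by (simp add: t_def)
qed

text \<open>\<open>inv' \<sigma> j\<close> is the position of card j. The sine vanishes at the
  omitted index j = 1, so sums over j = 2, ..., n run over a full period; a cosine would leave a
  remainder.\<close>

definition pos_wave :: "nat \<Rightarrow> nat \<Rightarrow> (nat \<Rightarrow> nat) \<Rightarrow> real" where
  "pos_wave n j \<sigma> = sin (2 * pi / real n * (real (inv' \<sigma> 1) - real (inv' \<sigma> j)))"

lemma inv_comp_apply:
  assumes "\<sigma> permutes A" "\<tau> permutes A"
  shows "inv' (\<sigma> \<circ> \<tau>) x = inv' \<tau> (inv' \<sigma> x)"
  using o_inv_distrib[OF permutes_bij[OF assms(1)] permutes_bij[OF assms(2)]] by simp

lemma pos_wave_transpose:
  assumes "\<sigma> permutes {1..n}" "j \<in> {2..n}" "l \<in> {2..n}"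
  shows "pos_wave n i (transpose j l \<circ> \<sigma>) = pos_wave n (transpose j l i) \<sigma>"
proof -
  have t: "transpose j l permutes {1..n}" using assms by (intro permutes_swap_id) auto
  have "transpose j l 1 = 1" using assms by (intro transpose_apply_other) auto
  then show ?thesis unfolding pos_wave_def inv_comp_apply[OF t assms(1)] inv_transpose_eq by simp
qed

lemma ip_pos_wave_transpose:
  assumes "j \<in> {2..n}" "l \<in> {2..n}"
  shows "ip (perms {1..n}) (pos_wave n (transpose j l i)) (pos_wave n (transpose j l i'))
    = ip (perms {1..n}) (pos_wave n i) (pos_wave n i')"
proof -
  have t: "transpose j l permutes {1..n}" using assms by (intro permutes_swap_id) auto
  have "ip (perms {1..n}) (pos_wave n i) (pos_wave n i')
     = (\<Sum>\<sigma> | \<sigma> permutes {1..n}. pos_wave n i (transpose j l \<circ> \<sigma>) * pos_wave n i' (transpose j l \<circ> \<sigma>))"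
    unfolding ip_def by (rule sum_permutes_comp_left[OF t, symmetric])
  also have "\<dots> = ip (perms {1..n}) (pos_wave n (transpose j l i)) (pos_wave n (transpose j l i'))"
    unfolding ip_def using assms by (intro sum.cong refl) (simp add: pos_wave_transpose)
  finally show ?thesis ..
qed

lemma sum_inv_permutes:
  fixes g :: "nat \<Rightarrow> real"
  assumes "\<sigma> permutes {1..n}" "1 \<le> n"
  shows "(\<Sum>j=2..n. g (inv' \<sigma> j)) = (\<Sum>y=1..n. g y) - g (inv' \<sigma> 1)"
proof -
  have "(\<Sum>y=1..n. g y) = (\<Sum>j=1..n. g (inv' \<sigma> j))"
    using sum.permute[OF permutes_inv[OF assms(1)], of g] by (simp add: o_def)
  also have "\<dots> = g (inv' \<sigma> 1) + (\<Sum>j=2..n. g (inv' \<sigma> j))"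
    using assms(2) by (simp add: sum.atLeast_Suc_atMost numeral_2_eq_2)
  finally show ?thesis by simp
qed

lemma sum_pos_wave:
  assumes "\<sigma> permutes {1..n}" "2 \<le> n"
  shows "(\<Sum>j=2..n. pos_wave n j \<sigma>) = 0"
  using sum_inv_permutes[OF assms(1), of "\<lambda>y. sin (2 * pi / real n * (real (inv' \<sigma> 1) - real y))"]
    sum_sin_differences[of n "inv' \<sigma> 1"] assms(2) unfolding pos_wave_def by simp

lemma sum_pos_wave_power2:
  assumes "\<sigma> permutes {1..n}" "3 \<le> n"
  shows "(\<Sum>j=2..n. (pos_wave n j \<sigma>)\<^sup>2) = real n / 2"
  using sum_inv_permutes[OF assms(1), of "\<lambda>y. (sin (2 * pi / real n * (real (inv' \<sigma> 1) - real y)))\<^sup>2"]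
    sum_sin_differences_power2[of n "inv' \<sigma> 1"] assms(2) unfolding pos_wave_def by simp

lemma ip_pos_wave_self:
  assumes n: "3 \<le> n" and j: "j \<in> {2..n}"
  shows "real (n - 1) * ip (perms {1..n}) (pos_wave n j) (pos_wave n j) = fact n * real n / 2"
proof -
  let ?G = "perms {1..n}"
  have "ip ?G (pos_wave n l) (pos_wave n l) = ip ?G (pos_wave n j) (pos_wave n j)" if "l \<in> {2..n}" for l
    using ip_pos_wave_transpose[OF j that, of j j] by simp
  then have "real (n - 1) * ip ?G (pos_wave n j) (pos_wave n j) = (\<Sum>l=2..n. ip ?G (pos_wave n l) (pos_wave n l))"
    using n by (simp add: of_nat_diff)
  also have "\<dots> = (\<Sum>\<sigma>\<in>?G. \<Sum>l=2..n. (pos_wave n l \<sigma>)\<^sup>2)"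
    unfolding ip_def power2_eq_square by (rule sum.swap)
  also have "\<dots> = (\<Sum>\<sigma>\<in>?G. real n / 2)"
    using sum_pos_wave_power2[OF _ n] by (intro sum.cong refl) simp
  also have "\<dots> = fact n * real n / 2"
    using card_permutations[of "{1..n}" n] by simp
  finally show ?thesis .
qed

text \<open>Relabelling the cards 2, ..., n makes all products of two different waves equal, and the
  waves sum to 0. So their Gram matrix is that of a regular simplex with n - 1 vertices.\<close>

lemma ip_pos_wave_off_diagonal:
  assumes n: "3 \<le> n" and j: "j \<in> {2..n}" and l: "l \<in> {2..n}" "l \<noteq> j"
  shows "real (n - 2) * ip (perms {1..n}) (pos_wave n j) (pos_wave n l)
    = - ip (perms {1..n}) (pos_wave n j) (pos_wave n j)"
proof -
  let ?G = "perms {1..n}"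
  have "ip ?G (pos_wave n j) (pos_wave n i) = ip ?G (pos_wave n j) (pos_wave n l)" if "i \<in> {2..n} - {j}" for i
  proof -
    have "transpose l i j = j" using that l by (intro transpose_apply_other) auto
    then show ?thesis using ip_pos_wave_transpose[of l n i j l] that l by simp
  qed
  then have "(\<Sum>i\<in>{2..n} - {j}. ip ?G (pos_wave n j) (pos_wave n i)) = real (n - 2) * ip ?G (pos_wave n j) (pos_wave n l)"
    using n j by (simp add: of_nat_diff)
  moreover have "(\<Sum>i=2..n. ip ?G (pos_wave n j) (pos_wave n i)) = 0"
  proof -
    have "(\<Sum>i=2..n. ip ?G (pos_wave n j) (pos_wave n i)) = ip ?G (pos_wave n j) (\<lambda>\<sigma>. \<Sum>i=2..n. pos_wave n i \<sigma>)"
      by (rule ip_sum_right[symmetric])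
    also have "\<dots> = ip ?G (pos_wave n j) (\<lambda>_. 0)"
      using sum_pos_wave n by (intro ip_cong) auto
    finally show ?thesis by (simp add: ip_def)
  qed
  moreover have "(\<Sum>i=2..n. ip ?G (pos_wave n j) (pos_wave n i))
     = ip ?G (pos_wave n j) (pos_wave n j) + (\<Sum>i\<in>{2..n} - {j}. ip ?G (pos_wave n j) (pos_wave n i))"
    using j by (simp add: sum.remove)
  ultimately show ?thesis by linarith
qed

text \<open>On coefficient vectors of sum 0 the Gram matrix of the simplex is the scalar V (n - 1) /
  (n - 2). The coefficients c j have sum 0 because the waves do, so Cauchy-Schwarz for h and the
  combination w with these coefficients suffices.\<close>

lemma pos_wave_bessel:
  assumes n: "3 \<le> n"
  shows "(\<Sum>j=2..n. (ip (perms {1..n}) (pos_wave n j) h)\<^sup>2)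
    \<le> real (n - 1) / real (n - 2) * ip (perms {1..n}) (pos_wave n 2) (pos_wave n 2) * ip (perms {1..n}) h h"
proof -
  let ?G = "perms {1..n}"
  define c where "c j = ip ?G (pos_wave n j) h" for j
  define V where "V = ip ?G (pos_wave n 2) (pos_wave n 2)"
  define w where "w \<sigma> = (\<Sum>j=2..n. c j * pos_wave n j \<sigma>)" for \<sigma>
  define X where "X = (\<Sum>j=2..n. (c j)\<^sup>2)"
  have X0: "0 \<le> X" by (simp add: X_def sum_nonneg)
  have n2: "real (n - 2) > 0" using n by simp
  have V: "ip ?G (pos_wave n j) (pos_wave n j) = V" if "j \<in> {2..n}" for j
    using ip_pos_wave_transpose[of 2 n j 2 2] that n by (simp add: V_def)
  have off: "ip ?G (pos_wave n j) (pos_wave n l) = - V / real (n - 2)" if "j \<in> {2..n}" "l \<in> {2..n}" "l \<noteq> j" for j l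
  proof -
    have "ip ?G (pos_wave n j) (pos_wave n l) = (real (n - 2) * ip ?G (pos_wave n j) (pos_wave n l)) / real (n - 2)"
      using n2 by simp
    then show ?thesis unfolding ip_pos_wave_off_diagonal[OF n that] V[OF that(1)] .
  qed
  have sum_c: "(\<Sum>j=2..n. c j) = 0"
  proof -
    have "(\<Sum>j=2..n. c j) = ip ?G (\<lambda>\<sigma>. \<Sum>j=2..n. pos_wave n j \<sigma>) h"
      unfolding c_def by (rule ip_sum_left[symmetric])
    also have "\<dots> = ip ?G (\<lambda>_. 0) h" using sum_pos_wave n by (intro ip_cong) auto
    finally show ?thesis by (simp add: ip_def)
  qed
  have wj: "ip ?G w (pos_wave n j) = real (n - 1) / real (n - 2) * V * c j" if j: "j \<in> {2..n}" for j
  proof -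
    have "ip ?G w (pos_wave n j) = (\<Sum>l=2..n. c l * ip ?G (pos_wave n l) (pos_wave n j))"
      unfolding w_def[abs_def] ip_sum_left ip_scale_left ..
    also have "\<dots> = (\<Sum>l=2..n. c l * (- V / real (n - 2)) + (if l = j then c l * (V + V / real (n - 2)) else 0))"
    proof (intro sum.cong refl)
      fix l assume l: "l \<in> {2..n}"
      show "c l * ip ?G (pos_wave n l) (pos_wave n j) = c l * (- V / real (n - 2)) + (if l = j then c l * (V + V / real (n - 2)) else 0)"
      proof (cases "l = j")
        case True
        then show ?thesis unfolding True V[OF j] by (simp add: distrib_left)
      next
        case False
        then show ?thesis unfolding off[OF l j False[symmetric]] by simp
      qed
    qed
    also have "\<dots> = c j * (V + V / real (n - 2))"
      unfolding sum.distrib sum_distrib_right[symmetric] sum_c using j by (simp add: sum.delta)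
    also have "V + V / real (n - 2) = real (n - 1) / real (n - 2) * V"
      using n n2 by (simp add: of_nat_diff field_simps)
    finally show ?thesis by (simp add: mult_ac)
  qed
  have "ip ?G w w = (\<Sum>j=2..n. c j * ip ?G w (pos_wave n j))"
    by (subst (2) w_def[abs_def]) (simp only: ip_sum_right ip_scale_right)
  also have "\<dots> = (\<Sum>j=2..n. real (n - 1) / real (n - 2) * V * (c j)\<^sup>2)"
  proof (intro sum.cong refl)
    fix j assume "j \<in> {2..n}"
    then show "c j * ip ?G w (pos_wave n j) = real (n - 1) / real (n - 2) * V * (c j)\<^sup>2"
      by (simp only: wj) (simp add: power2_eq_square)
  qed
  also have "\<dots> = real (n - 1) / real (n - 2) * V * X"
    by (simp only: X_def sum_distrib_left)
  finally have ww: "ip ?G w w = real (n - 1) / real (n - 2) * V * X" .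
  have "ip ?G w h = X"
    unfolding w_def[abs_def] ip_sum_left ip_scale_left X_def by (simp add: c_def power2_eq_square)
  then have X2: "X\<^sup>2 \<le> real (n - 1) / real (n - 2) * V * X * ip ?G h h"
    using ip_power2_le[of ?G w h] ww by simp
  define Y where "Y = real (n - 1) / real (n - 2) * V * ip ?G h h"
  have "X * X \<le> X * Y" using X2 by (simp add: Y_def power2_eq_square mult_ac)
  moreover have "0 \<le> Y"
    unfolding Y_def by (intro mult_nonneg_nonneg) (auto simp: V_def ip_self_nonneg)
  ultimately have "X \<le> Y"
    using X0 mult_le_cancel_left_pos[of X X Y] by (cases "X = 0") auto
  then show ?thesis by (simp add: X_def c_def V_def Y_def)
qed

text \<open>At a fixed \<sigma> the evolved waves are the inner products of the waves with one
  translate of h, the deviation from uniformity, so the Bessel inequality applies pointwise. Summing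
  over \<sigma> produces the squared distance. The n - 1 comparable terms on the left are the source
  of the logarithm.\<close>

lemma sum_L2_set_walk_power_pos_wave_le:
  assumes sym: "\<And>s. s permutes {1..n} \<Longrightarrow> q (inv' s) = q s" and n: "3 \<le> n"
  shows "(\<Sum>j=2..n. (L2_set ((walk {1..n} q ^^ m) (pos_wave n j)) (perms {1..n}))\<^sup>2)
    \<le> real (n - 1) / real (n - 2) * ip (perms {1..n}) (pos_wave n 2) (pos_wave n 2)
      * (sqrt (fact n) * L2_set (\<lambda>\<sigma>. (walk {1..n} q ^^ m) id_mass \<sigma> - 1 / fact n) (perms {1..n}))\<^sup>2"
proof -
  let ?G = "perms {1..n}" and ?P = "walk {1..n} q ^^ m"
  define h where "h \<sigma> = ?P id_mass \<sigma> - 1 / fact n" for \<sigma>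
  define \<Lambda> where "\<Lambda> = real (n - 1) / real (n - 2) * ip ?G (pos_wave n 2) (pos_wave n 2)"
  \<comment> \<open>By relabelling, all waves have the same mean, and they sum to 0.\<close>
  have mean: "ip ?G (\<lambda>_. c) (pos_wave n j) = 0" if j: "j \<in> {2..n}" for c j
  proof -
    have eq: "ip ?G (\<lambda>_. c) (pos_wave n l) = ip ?G (\<lambda>_. c) (pos_wave n j)" if "l \<in> {2..n}" for l
    proof -
      have t: "transpose j l permutes {1..n}" using j that by (intro permutes_swap_id) auto
      have "ip ?G (\<lambda>_. c) (pos_wave n j) = (\<Sum>\<sigma>\<in>?G. c * pos_wave n j (transpose j l \<circ> \<sigma>))"
        unfolding ip_def by (rule sum_permutes_comp_left[OF t, symmetric])
      also have "\<dots> = ip ?G (\<lambda>_. c) (pos_wave n l)"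
        unfolding ip_def
      proof (intro sum.cong refl)
        fix \<sigma> assume "\<sigma> \<in> ?G"
        then show "c * pos_wave n j (transpose j l \<circ> \<sigma>) = c * pos_wave n l \<sigma>"
          using pos_wave_transpose[OF _ j that, of \<sigma> j] by simp
      qed
      finally show ?thesis ..
    qed
    have "real (n - 1) * ip ?G (\<lambda>_. c) (pos_wave n j) = (\<Sum>l=2..n. ip ?G (\<lambda>_. c) (pos_wave n l))"
      using n by (subst sum.cong[OF refl eq]) (simp_all add: of_nat_diff)
    also have "\<dots> = ip ?G (\<lambda>_. c) (\<lambda>\<sigma>. \<Sum>l=2..n. pos_wave n l \<sigma>)" by (rule ip_sum_right[symmetric])
    also have "\<dots> = ip ?G (\<lambda>_. c) (\<lambda>_. 0)" using sum_pos_wave n by (intro ip_cong) auto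
    finally show ?thesis using n by (simp add: ip_def)
  qed
  have "(\<Sum>j=2..n. (?P (pos_wave n j) \<sigma>)\<^sup>2) \<le> \<Lambda> * ip ?G h h" if \<sigma>: "\<sigma> permutes {1..n}" for \<sigma>
  proof -
    define h' where "h' \<tau> = h (inv' \<sigma> \<circ> \<tau>)" for \<tau>
    have "?P (pos_wave n j) \<sigma> = ip ?G (pos_wave n j) h'" if j: "j \<in> {2..n}" for j
    proof -
      have "?P (pos_wave n j) \<sigma> = ip ?G (?P id_mass) (\<lambda>\<tau>. pos_wave n j (\<sigma> \<circ> \<tau>))"
        by (rule walk_power_apply[OF _ finite_atLeastAtMost]) (rule sym)
      also have "\<dots> = ip ?G (\<lambda>\<tau>. h \<tau> + 1 / fact n) (\<lambda>\<tau>. pos_wave n j (\<sigma> \<circ> \<tau>))"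
        by (simp add: h_def)
      also have "\<dots> = ip ?G (\<lambda>\<tau>. pos_wave n j (\<sigma> \<circ> \<tau>)) h + ip ?G (\<lambda>\<tau>. pos_wave n j (\<sigma> \<circ> \<tau>)) (\<lambda>_. 1 / fact n)"
        unfolding ip_add_left by (simp only: ip_commute)
      also have "ip ?G (\<lambda>\<tau>. pos_wave n j (\<sigma> \<circ> \<tau>)) h = ip ?G (pos_wave n j) h'"
        unfolding h'_def by (rule ip_comp_left[OF \<sigma>])
      also have "ip ?G (\<lambda>\<tau>. pos_wave n j (\<sigma> \<circ> \<tau>)) (\<lambda>_. 1 / fact n) = ip ?G (pos_wave n j) (\<lambda>_. 1 / fact n)"
        by (rule ip_comp_left[OF \<sigma>])
      also have "\<dots> = 0" unfolding ip_commute[of _ "pos_wave n j"] by (rule mean[OF j])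
      finally show ?thesis by simp
    qed
    then have "(\<Sum>j=2..n. (?P (pos_wave n j) \<sigma>)\<^sup>2) = (\<Sum>j=2..n. (ip ?G (pos_wave n j) h')\<^sup>2)" by simp
    also have "\<dots> \<le> \<Lambda> * ip ?G h' h'" unfolding \<Lambda>_def by (rule pos_wave_bessel[OF n])
    also have "ip ?G h' h' = ip ?G h h"
      unfolding ip_def h'_def by (rule sum_permutes_comp_left[OF permutes_inv[OF \<sigma>]])
    finally show ?thesis .
  qed
  then have "(\<Sum>\<sigma>\<in>?G. \<Sum>j=2..n. (?P (pos_wave n j) \<sigma>)\<^sup>2) \<le> (\<Sum>\<sigma>\<in>?G. \<Lambda> * ip ?G h h)"
    by (intro sum_mono) simp
  also have "\<dots> = \<Lambda> * (fact n * ip ?G h h)"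
    using card_permutations[of "{1..n}" n] by simp
  also have "fact n * ip ?G h h = (sqrt (fact n) * L2_set h ?G)\<^sup>2"
    by (simp add: power_mult_distrib L2_set_power2)
  also have "(\<Sum>\<sigma>\<in>?G. \<Sum>j=2..n. (?P (pos_wave n j) \<sigma>)\<^sup>2) = (\<Sum>j=2..n. (L2_set (?P (pos_wave n j)) ?G)\<^sup>2)"
    unfolding L2_set_power2 unfolding ip_def power2_eq_square by (rule sum.swap)
  finally show ?thesis unfolding \<Lambda>_def h_def[abs_def] .
qed

lemma abs_sin_diff_le: "\<bar>sin x - sin y\<bar> \<le> \<bar>x - (y::real)\<bar>"
proof -
  have "sin x - sin y = 2 * sin ((x - y) / 2) * cos ((x + y) / 2)" by (rule sin_diff_sin)
  then have "\<bar>sin x - sin y\<bar> = 2 * (\<bar>sin ((x - y) / 2)\<bar> * \<bar>cos ((x + y) / 2)\<bar>)" by (simp add: abs_mult)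
  also have "\<dots> \<le> 2 * (\<bar>(x - y) / 2\<bar> * 1)"
    by (intro mult_left_mono mult_mono abs_sin_x_le_abs_x abs_cos_le_one) auto
  finally show ?thesis by simp
qed

text \<open>Subtracting the common shift by one, the cycle \<open>top_cycle l\<close> moves a position below \<open>l\<close> by \<open>0\<close>,
  the position \<open>l\<close> by \<open>n - l\<close> modulo \<open>n\<close>, and a position above \<open>l\<close> by \<open>-1\<close>.\<close>

definition rel_shift :: "nat \<Rightarrow> nat \<Rightarrow> nat \<Rightarrow> real" where
  "rel_shift n l x = (if x < l then 0 else if x = l then real n - real l else - 1)"

lemma top_cycle_rel_shift:
  assumes "1 \<le> x" "1 \<le> l"
  shows "\<exists>i::int. real (top_cycle l x) = real x + 1 + rel_shift n l x - real n * of_int i"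
proof -
  consider "x < l" | "x = l" | "l < x" by linarith
  then show ?thesis
  proof cases
    case 1
    then show ?thesis using assms by (intro exI[of _ 0]) (simp add: top_cycle_def rel_shift_def)
  next
    case 2
    then show ?thesis using assms by (intro exI[of _ 1]) (simp add: top_cycle_def rel_shift_def)
  next
    case 3
    then show ?thesis using assms by (intro exI[of _ 0]) (simp add: top_cycle_def rel_shift_def)
  qed
qed

lemma sin_top_cycle_diff_le:
  assumes "1 \<le> x" "1 \<le> y" "1 \<le> l" "1 \<le> n"
  shows "(sin (2 * pi / real n * (real x - real y)) - sin (2 * pi / real n * (real (top_cycle l x) - real (top_cycle l y))))\<^sup>2
    \<le> 2 * (2 * pi / real n)\<^sup>2 * ((rel_shift n l x)\<^sup>2 + (rel_shift n l y)\<^sup>2)"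
proof -
  define t where "t = 2 * pi / real n"
  define D where "D = rel_shift n l x - rel_shift n l y"
  obtain i j :: int where i: "real (top_cycle l x) = real x + 1 + rel_shift n l x - real n * of_int i"
    and j: "real (top_cycle l y) = real y + 1 + rel_shift n l y - real n * of_int j"
    using top_cycle_rel_shift[OF assms(1,3)] top_cycle_rel_shift[OF assms(2,3)] by metis
  have tn: "t * real n = 2 * pi" using assms by (simp add: t_def)
  \<comment> \<open>In the difference the common shift by 1 cancels, and multiples of n become
    multiples of the period.\<close>
  have eq: "t * (real (top_cycle l x) - real (top_cycle l y)) = t * (real x - real y + D) + (t * real n) * of_int (j - i)"
    unfolding i j D_def by (simp add: algebra_simps)
  have "sin (t * (real (top_cycle l x) - real (top_cycle l y))) = sin (t * (real x - real y + D))"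
    unfolding eq tn sin_add[of "t * (real x - real y + D)"] sin_int_2pin cos_int_2pin by simp
  then have "\<bar>sin (t * (real x - real y)) - sin (t * (real (top_cycle l x) - real (top_cycle l y)))\<bar>
      \<le> \<bar>t * (real x - real y) - t * (real x - real y + D)\<bar>"
    using abs_sin_diff_le by simp
  also have "\<dots> = \<bar>t * D\<bar>" by (simp add: algebra_simps)
  finally have "(sin (t * (real x - real y)) - sin (t * (real (top_cycle l x) - real (top_cycle l y))))\<^sup>2 \<le> (t * D)\<^sup>2"
    by (simp only: abs_le_square_iff)
  also have "\<dots> = t\<^sup>2 * (rel_shift n l x + - rel_shift n l y)\<^sup>2" by (simp add: D_def power_mult_distrib)
  also have "\<dots> \<le> t\<^sup>2 * (2 * (rel_shift n l x)\<^sup>2 + 2 * (- rel_shift n l y)\<^sup>2)"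
    by (intro mult_left_mono square_add_le) simp
  finally show ?thesis by (simp add: t_def algebra_simps)
qed

lemma sum_rel_shift_power2:
  assumes "1 \<le> l" "l \<le> n"
  shows "(\<Sum>x=1..n. (rel_shift n l x)\<^sup>2) = (real n - real l)\<^sup>2 + (real n - real l)"
proof -
  have "(\<Sum>x=1..n. (rel_shift n l x)\<^sup>2) = (\<Sum>x=l..n. (rel_shift n l x)\<^sup>2)"
    using assms by (intro sum.mono_neutral_right) (auto simp: rel_shift_def)
  also have "\<dots> = (rel_shift n l l)\<^sup>2 + (\<Sum>x=Suc l..n. (rel_shift n l x)\<^sup>2)"
    using assms by (simp add: sum.atLeast_Suc_atMost)
  also have "(\<Sum>x=Suc l..n. (rel_shift n l x)\<^sup>2) = (\<Sum>x=Suc l..n. 1)"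
    by (intro sum.cong) (auto simp: rel_shift_def)
  finally show ?thesis using assms by (simp add: rel_shift_def of_nat_diff)
qed

text \<open>The position of a fixed card is uniform, so its mean squared relative shift is the sum
  over positions divided by n. That sum is (n - l)^2 + (n - l), which is at most k (k - 1).\<close>

lemma disp_pos_wave_le:
  fixes n k :: nat
  assumes k: "1 < k" "k \<le> n" and l: "n - k + 1 \<le> l" "l \<le> n" and j: "j \<in> {2..n}"
  shows "real n * (disp {1..n} (top_cycle l) (pos_wave n j))\<^sup>2 \<le> 4 * (2 * pi / real n)\<^sup>2 * fact n * real k ^ 2"
proof -
  let ?G = "perms {1..n}"
  define t where "t = 2 * pi / real n"
  define r where "r x = (rel_shift n l x)\<^sup>2" for x
  have pl: "top_cycle l permutes {1..n}" by (rule top_cycle_permutes) (use l in auto)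
  \<comment> \<open>Right multiplication by the inverse cycle moves the positions of the cards by
    the cycle itself, for which \<open>rel_shift\<close> is available.\<close>
  have "(disp {1..n} (top_cycle l) (pos_wave n j))\<^sup>2 = (disp {1..n} (inv' (top_cycle l)) (pos_wave n j))\<^sup>2"
    by (simp only: disp_inv[OF pl])
  also have "\<dots> = (\<Sum>\<sigma>\<in>?G. (pos_wave n j \<sigma> - pos_wave n j (\<sigma> \<circ> inv' (top_cycle l)))\<^sup>2)"
    unfolding disp_def L2_set_power2 ip_def by (simp only: power2_eq_square)
  also have "\<dots> \<le> (\<Sum>\<sigma>\<in>?G. 2 * t\<^sup>2 * (r (inv' \<sigma> 1) + r (inv' \<sigma> j)))"
  proof (intro sum_mono)
    fix \<sigma> assume "\<sigma> \<in> ?G"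
    then have \<sigma>: "\<sigma> permutes {1..n}" by simp
    have in_A: "inv' \<sigma> i \<in> {1..n}" if "i \<in> {1..n}" for i
      using permutes_in_image[OF permutes_inv[OF \<sigma>], of i] that by simp
    have "1 \<le> inv' \<sigma> 1" "1 \<le> inv' \<sigma> j" using in_A[of 1] in_A[of j] j k by auto
    moreover have "pos_wave n j (\<sigma> \<circ> inv' (top_cycle l))
       = sin (t * (real (top_cycle l (inv' \<sigma> 1)) - real (top_cycle l (inv' \<sigma> j))))"
      unfolding pos_wave_def t_def inv_comp_apply[OF \<sigma> permutes_inv[OF pl]] permutes_inv_inv[OF pl] ..
    ultimately show "(pos_wave n j \<sigma> - pos_wave n j (\<sigma> \<circ> inv' (top_cycle l)))\<^sup>2 \<le> 2 * t\<^sup>2 * (r (inv' \<sigma> 1) + r (inv' \<sigma> j))"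
      unfolding t_def r_def using k l by (simp only: pos_wave_def) (rule sin_top_cycle_diff_le, auto)
  qed
  finally have "real n * (disp {1..n} (top_cycle l) (pos_wave n j))\<^sup>2
     \<le> real n * (\<Sum>\<sigma>\<in>?G. 2 * t\<^sup>2 * (r (inv' \<sigma> 1) + r (inv' \<sigma> j)))" by (rule mult_left_mono) simp
  also have "\<dots> = 2 * t\<^sup>2 * (real n * (\<Sum>\<sigma>\<in>?G. r (inv' \<sigma> 1)) + real n * (\<Sum>\<sigma>\<in>?G. r (inv' \<sigma> j)))"
    by (simp only: sum_distrib_left[symmetric] sum.distrib) (simp add: algebra_simps)
  also have "(\<Sum>\<sigma>\<in>?G. r (inv' \<sigma> 1)) = (\<Sum>\<sigma>\<in>?G. r (\<sigma> 1))" by (rule sum_permutes_inv[of "\<lambda>\<sigma>. r (\<sigma> 1)"])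
  also have "(\<Sum>\<sigma>\<in>?G. r (inv' \<sigma> j)) = (\<Sum>\<sigma>\<in>?G. r (\<sigma> j))" by (rule sum_permutes_inv[of "\<lambda>\<sigma>. r (\<sigma> j)"])
  also have "real n * (\<Sum>\<sigma>\<in>?G. r (\<sigma> 1)) = fact n * (\<Sum>x=1..n. r x)"
    using sum_permutes_apply[of "{1..n}" 1 r] k by simp
  also have "real n * (\<Sum>\<sigma>\<in>?G. r (\<sigma> j)) = fact n * (\<Sum>x=1..n. r x)"
    using sum_permutes_apply[of "{1..n}" j r] j by simp
  also have "(\<Sum>x=1..n. r x) = (real n - real l)\<^sup>2 + (real n - real l)"
    unfolding r_def using l by (intro sum_rel_shift_power2) auto
  also have "2 * t\<^sup>2 * (fact n * ((real n - real l)\<^sup>2 + (real n - real l)) + fact n * ((real n - real l)\<^sup>2 + (real n - real l)))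
     = 4 * t\<^sup>2 * fact n * ((real n - real l)\<^sup>2 + (real n - real l))" by (simp add: algebra_simps)
  also have "\<dots> \<le> 4 * t\<^sup>2 * fact n * real k ^ 2"
  proof (intro mult_left_mono)
    have d: "0 \<le> real n - real l" "real n - real l \<le> real k - 1" using l k by linarith+
    then have "(real n - real l) * (real n - real l + 1) \<le> real k * real k" by (intro mult_mono) auto
    then show "(real n - real l)\<^sup>2 + (real n - real l) \<le> real k ^ 2" by (simp add: power2_eq_square algebra_simps)
  qed simp
  finally show ?thesis by (simp add: t_def)
qed

text \<open>The squared norm V satisfies (n - 1) V = n! n / 2, hence is at least n! / 2; dividing
  the Dirichlet form by it gives the relative loss 16 pi^2 k^2 / n^3.\<close>

lemma ip_walk_pos_wave_ge:
  fixes n k :: nat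
  assumes k: "1 < k" "k \<le> n" and n: "3 \<le> n" and j: "j \<in> {2..n}"
  shows "(1 - 16 * pi\<^sup>2 * real k ^ 2 / real n ^ 3) * ip (perms {1..n}) (pos_wave n j) (pos_wave n j)
    \<le> ip (perms {1..n}) (shuffle_walk n k (pos_wave n j)) (pos_wave n j)"
proof -
  let ?G = "perms {1..n}"
  define V where "V = ip ?G (pos_wave n j) (pos_wave n j)"
  define c where "c = 4 * (2 * pi / real n)\<^sup>2 * fact n * real k ^ 2 / real n"
  have V0: "0 \<le> V" unfolding V_def by (rule ip_self_nonneg)
  have "fact n * real n / 2 = real (n - 1) * V" unfolding V_def by (rule ip_pos_wave_self[OF n j, symmetric])
  also have "\<dots> \<le> real n * V" using V0 by (intro mult_right_mono) auto
  finally have V: "fact n \<le> 2 * V" using n by simp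
  have "(\<Sum>l=n-k+1..n. (disp {1..n} (top_cycle l) (pos_wave n j))\<^sup>2) \<le> (\<Sum>l=n-k+1..n. c)"
  proof (intro sum_mono)
    fix l assume "l \<in> {n-k+1..n}"
    then show "(disp {1..n} (top_cycle l) (pos_wave n j))\<^sup>2 \<le> c"
      using disp_pos_wave_le[OF k _ _ j, of l] n by (simp add: c_def pos_le_divide_eq mult.commute)
  qed
  also have "\<dots> = real k * c" using k by simp
  finally have "(\<Sum>l=n-k+1..n. (disp {1..n} (top_cycle l) (pos_wave n j))\<^sup>2) / (2 * real k) \<le> (real k * c) / (2 * real k)"
    by (rule divide_right_mono) simp
  also have "\<dots> = 8 * pi\<^sup>2 * real k ^ 2 / real n ^ 3 * fact n"
    using k by (simp add: c_def power_divide power_mult_distrib power2_eq_square power3_eq_cube mult_ac)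
  also have "\<dots> \<le> 8 * pi\<^sup>2 * real k ^ 2 / real n ^ 3 * (2 * V)"
    using V by (intro mult_left_mono) auto
  also have "\<dots> = 16 * pi\<^sup>2 * real k ^ 2 / real n ^ 3 * V" by simp
  finally show ?thesis
    using ip_diff_walk[OF k, of "pos_wave n j"] unfolding V_def left_diff_distrib mult_1 by linarith
qed

text \<open>Each of the n - 1 waves keeps the fraction (1 - \<epsilon>)^(2 m) of its squared norm V,
  while their total is at most V (n - 1) / (n - 2) times the squared distance; V cancels.\<close>

lemma l2_dist_ge_of_walk:
  fixes n k m :: nat
  assumes k: "1 < k" "k \<le> n" and n: "3 \<le> n" and \<epsilon>: "\<epsilon> = 16 * pi\<^sup>2 * real k ^ 2 / real n ^ 3" "\<epsilon> < 1"
  shows "real (n - 2) * (1 - \<epsilon>) ^ (2 * m)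
    \<le> (shuffle_l2 n k m)\<^sup>2"
proof -
  let ?G = "perms {1..n}" and ?q = "sym_top_to_bottom_k n k"
  define V where "V = ip ?G (pos_wave n 2) (pos_wave n 2)"
  define D where "D = shuffle_l2 n k m"
  have "real (n - 1) * V = fact n * real n / 2"
    unfolding V_def using n by (intro ip_pos_wave_self) auto
  moreover have "0 < fact n * real n / (2::real)" using n by simp
  ultimately have "0 < real (n - 1) * V" by linarith
  then have V: "0 < V" by (simp add: zero_less_mult_iff)
  have "(1 - \<epsilon>) ^ (2 * m) * V \<le> (L2_set ((shuffle_walk n k ^^ m) (pos_wave n j)) ?G)\<^sup>2" if j: "j \<in> {2..n}" for j
  proof -
    have "V = (L2_set (pos_wave n j) ?G)\<^sup>2"
      unfolding L2_set_power2 V_def using ip_pos_wave_transpose[of 2 n j 2 2] j n by simp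
    then have "(1 - \<epsilon>) ^ (2 * m) * V = ((1 - \<epsilon>) ^ m * L2_set (pos_wave n j) ?G)\<^sup>2"
      by (simp add: power_mult_distrib power_even_eq)
    also have "\<dots> \<le> (L2_set ((shuffle_walk n k ^^ m) (pos_wave n j)) ?G)\<^sup>2"
    proof (rule power_mono)
      show "(1 - \<epsilon>) ^ m * L2_set (pos_wave n j) ?G \<le> L2_set ((shuffle_walk n k ^^ m) (pos_wave n j)) ?G"
      proof (rule L2_set_walk_power_ge)
        show "?q (inv' s) = ?q s" if "s permutes {1..n}" for s using that by (rule sym_top_to_bottom_k_inv)
        show "(1 - \<epsilon>) * ip ?G (pos_wave n j) (pos_wave n j) \<le> ip ?G (shuffle_walk n k (pos_wave n j)) (pos_wave n j)"
          unfolding \<epsilon>(1) by (rule ip_walk_pos_wave_ge[OF k n j])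
      qed (use \<epsilon>(2) in simp)
      show "0 \<le> (1 - \<epsilon>) ^ m * L2_set (pos_wave n j) ?G" using \<epsilon>(2) by simp
    qed
    finally show ?thesis .
  qed
  then have "(\<Sum>j=2..n. (1 - \<epsilon>) ^ (2 * m) * V) \<le> (\<Sum>j=2..n. (L2_set ((shuffle_walk n k ^^ m) (pos_wave n j)) ?G)\<^sup>2)"
    by (rule sum_mono)
  also have "\<dots> \<le> real (n - 1) / real (n - 2) * V * D\<^sup>2"
    unfolding V_def D_def l2_dist_shuffle
    by (rule sum_L2_set_walk_power_pos_wave_le[OF _ n]) (rule sym_top_to_bottom_k_inv)
  finally have *: "real (n - 1) * ((1 - \<epsilon>) ^ (2 * m) * V) \<le> real (n - 1) / real (n - 2) * V * D\<^sup>2"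
    using n by (simp add: of_nat_diff)
  have n2: "0 < real (n - 2)" "0 < real (n - 1)" using n by simp_all
  have "(real (n - 1) * V) * (real (n - 2) * (1 - \<epsilon>) ^ (2 * m)) = real (n - 2) * (real (n - 1) * ((1 - \<epsilon>) ^ (2 * m) * V))"
    by (simp only: mult_ac)
  also have "\<dots> \<le> real (n - 2) * (real (n - 1) / real (n - 2) * V * D\<^sup>2)"
    using * by (rule mult_left_mono) simp
  also have "\<dots> = (real (n - 1) * V) * D\<^sup>2"
    using n2(1) by (simp only: times_divide_eq_right times_divide_eq_left) simp
  finally show ?thesis
    using n2 V unfolding D_def by (simp only: mult_le_cancel_left_pos mult_pos_pos)
qed

section \<open>Lower bounds in total variation from the motion of one card\<close>

lemma tv_dist_ge_event:
  assumes fin: "finite (carrier G)" and B: "B \<subseteq> carrier G"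
    and eq: "(\<Sum>g\<in>carrier G. p g) = (\<Sum>g\<in>carrier G. q g)"
  shows "(\<Sum>g\<in>B. p g) - (\<Sum>g\<in>B. q g) \<le> tv_dist G p q"
proof -
  have split: "(\<Sum>g\<in>carrier G. f g) = (\<Sum>g\<in>carrier G - B. f g) + (\<Sum>g\<in>B. f g)" for f :: "'a \<Rightarrow> real"
    by (rule sum.subset_diff[OF B fin])
  have "(\<Sum>g\<in>B. p g - q g) \<le> (\<Sum>g\<in>B. \<bar>p g - q g\<bar>)" by (intro sum_mono) simp
  moreover have "(\<Sum>g\<in>carrier G - B. q g - p g) \<le> (\<Sum>g\<in>carrier G - B. \<bar>p g - q g\<bar>)" by (intro sum_mono) simp
  ultimately show ?thesis
    using eq split[of p] split[of q] split[of "\<lambda>g. \<bar>p g - q g\<bar>"]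
    by (simp add: tv_dist_def sum_subtractf)
qed

lemma sum_walk_power_id_mass:
  assumes "\<And>s. s permutes A \<Longrightarrow> q (inv' s) = q s" "finite A" "(\<Sum>s | s permutes A. q s) = 1"
  shows "(\<Sum>\<sigma> | \<sigma> permutes A. (walk A q ^^ m) id_mass \<sigma>) = 1"
proof -
  have "ip (perms A) ((walk A q ^^ m) id_mass) (\<lambda>_. 1) = (walk A q ^^ m) (\<lambda>_. 1) id"
    by (rule walk_power_apply[symmetric, OF _ assms(2)]) (rule assms(1))
  then show ?thesis unfolding walk_power_const[OF assms(3)] by (simp add: ip_def)
qed

lemma walk_power_id_mass_nonneg:
  assumes "\<And>s. s permutes A \<Longrightarrow> 0 \<le> q s"
  shows "0 \<le> (walk A q ^^ m) id_mass \<sigma>"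
proof (induction m arbitrary: \<sigma>)
  case (Suc m)
  then show ?case unfolding funpow_Suc_apply walk_def[of A q "(walk A q ^^ m) id_mass"]
    using assms by (intro sum_nonneg mult_nonneg_nonneg) auto
qed (simp add: id_mass_def)

lemma walk_mono:
  assumes "\<And>s. s permutes A \<Longrightarrow> 0 \<le> q s" "\<And>\<sigma>. \<sigma> permutes A \<Longrightarrow> f \<sigma> \<le> g \<sigma>" "\<sigma> permutes A"
  shows "walk A q f \<sigma> \<le> walk A q g \<sigma>"
  unfolding walk_def using assms by (intro sum_mono mult_left_mono) (auto intro: permutes_compose)

lemma sym_top_to_bottom_k_nonneg:
  assumes "s permutes {1..n}"
  shows "0 \<le> sym_top_to_bottom_k n k s"
  unfolding sym_top_to_bottom_k_eq[OF assms] by (simp add: top_to_bottom_k_def)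

lemma tv_dist_shuffle_ge:
  fixes n k m :: nat
  assumes k: "1 < k" "k \<le> n" and B: "B \<subseteq> (perms {1..n})"
  shows "(\<Sum>\<sigma>\<in>B. (shuffle_walk n k ^^ m) id_mass \<sigma>) - real (card B) / fact n
    \<le> shuffle_tv n k m"
proof -
  let ?q = "sym_top_to_bottom_k n k"
  let ?p = "(shuffle_walk n k ^^ m) id_mass"
  have conv: "conv_power (sym_group n) ?q m \<sigma> = ?p \<sigma>" if "\<sigma> permutes {1..n}" for \<sigma>
    using that by (intro conv_power_eq_walk sym_top_to_bottom_k_inv)
  have "(\<Sum>\<sigma>\<in>carrier (sym_group n). conv_power (sym_group n) ?q m \<sigma>) = (\<Sum>\<sigma> | \<sigma> permutes {1..n}. ?p \<sigma>)"
    unfolding carrier_sym_group by (intro sum.cong refl conv) simp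
  also have "\<dots> = 1"
  proof (rule sum_walk_power_id_mass)
    show "?q (inv' s) = ?q s" if "s permutes {1..n}" for s using that by (rule sym_top_to_bottom_k_inv)
  qed (simp, rule sum_sym_top_to_bottom_k_1[OF k])
  also have "1 = (\<Sum>\<sigma>\<in>carrier (sym_group n). uniform_mass (sym_group n) \<sigma>)"
    using card_permutations[of "{1..n}" n] by (simp add: uniform_mass_def order_sym_group carrier_sym_group)
  finally have "(\<Sum>\<sigma>\<in>B. conv_power (sym_group n) ?q m \<sigma>) - (\<Sum>\<sigma>\<in>B. uniform_mass (sym_group n) \<sigma>)
     \<le> shuffle_tv n k m"
    using B by (intro tv_dist_ge_event finite_carrier_sym_group) (auto simp: carrier_sym_group)
  moreover have "(\<Sum>\<sigma>\<in>B. conv_power (sym_group n) ?q m \<sigma>) = (\<Sum>\<sigma>\<in>B. ?p \<sigma>)"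
    using B by (intro sum.cong refl conv) auto
  ultimately show ?thesis by (simp add: uniform_mass_def order_sym_group)
qed

lemma inverse_two_exp_one_le: "1 / (2 * exp 1) \<le> (1 / 4 :: real)"
  using exp_ge_add_one_self[of 1] by (simp add: field_simps)

text \<open>At time 0 the distance is at least 1 - 1 / n!. This disposes of the cases in which the
  claimed lower bound is at most 1.\<close>

lemma tv_threshold_pos:
  fixes n k m :: nat
  assumes k: "1 < k" "k \<le> n"
    and m: "shuffle_tv n k m \<le> 1 / (2 * exp 1)"
  shows "1 \<le> m"
proof (rule ccontr)
  assume "\<not> 1 \<le> m"
  then have m0: "m = 0" by simp
  have "1 - 1 / fact n \<le> shuffle_tv n k 0"
    using tv_dist_shuffle_ge[OF k, of "{id}" 0] permutes_id[of "{1..n}"] by (simp add: id_mass_def)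
  moreover have "1 / fact n \<le> (1 / 2 :: real)"
  proof -
    have "(2::real) \<le> fact n" using fact_mono[of 2 n, where 'a = real] k by (simp add: fact_2)
    then show ?thesis by (simp add: field_simps)
  qed
  ultimately show False using m[unfolded m0] inverse_two_exp_one_le by linarith
qed

text \<open>At distance less than L from L + 1 the position is one of 2, ..., 2 L, below every cycle
  length that occurs, so the card moves by +1 or -1 with equal probability and its squared distance
  grows by 1 on average. Elsewhere \<phi> has its maximal value: the truncation makes the estimate
  hold at every position.\<close>

lemma walk_truncated_square_le:
  fixes n k L x0 :: nat
  assumes k: "1 < k" "k \<le> n" and L: "1 \<le> L" "2 * L \<le> n - k" and \<sigma>: "\<sigma> permutes {1..n}"
  defines "\<phi> \<equiv> \<lambda>x. min ((real x - real (L + 1))\<^sup>2) (real L ^ 2)"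
  shows "shuffle_walk n k (\<lambda>\<sigma>. \<phi> (inv' \<sigma> (L + 1))) \<sigma> \<le> \<phi> (inv' \<sigma> (L + 1)) + 1"
proof -
  define x where "x = inv' \<sigma> (L + 1)"
  define F where "F \<sigma> = \<phi> (inv' \<sigma> (L + 1))" for \<sigma>
  have top: "\<phi> y \<le> real L ^ 2" for y by (simp add: \<phi>_def)
  have step: "\<phi> (inv' (top_cycle l) x) + \<phi> (top_cycle l x) \<le> 2 * \<phi> x + 2" if l: "l \<in> {n-k+1..n}" for l
  proof (cases "\<bar>real x - real (L + 1)\<bar> < real L")
    case True
    then have x: "2 \<le> x" "x \<le> n - k" using L by auto
    have pl: "top_cycle l permutes {1..n}" by (rule top_cycle_permutes) (use l in auto)
    have t: "top_cycle l x = x + 1" using x l by (simp add: top_cycle_def)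
    have "top_cycle l (x - 1) = x" using x l by (cases x) (auto simp: top_cycle_def)
    then have i: "inv' (top_cycle l) x = x - 1" by (simp add: permutes_inv_eq[OF pl])
    define d where "d = real x - real (L + 1)"
    have "d\<^sup>2 \<le> real L ^ 2" using True abs_le_square_iff[of d "real L"] by (simp add: d_def)
    then have "\<phi> x = d\<^sup>2" by (simp add: \<phi>_def d_def)
    moreover have "\<phi> (top_cycle l x) \<le> (d + 1)\<^sup>2"
      unfolding t \<phi>_def d_def by (rule min.coboundedI1) (simp add: algebra_simps)
    moreover have "\<phi> (inv' (top_cycle l) x) \<le> (d - 1)\<^sup>2"
      unfolding i \<phi>_def d_def using x by (intro min.coboundedI1) (simp add: algebra_simps)
    ultimately show ?thesis by (simp add: power2_eq_square algebra_simps)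
  next
    case False
    then have "real L ^ 2 \<le> (real x - real (L + 1))\<^sup>2" using abs_le_square_iff[of "real L" "real x - real (L + 1)"] by simp
    then have "\<phi> x = real L ^ 2" by (simp add: \<phi>_def)
    then show ?thesis using top[of "inv' (top_cycle l) x"] top[of "top_cycle l x"] by simp
  qed
  have "shuffle_walk n k F \<sigma> = (\<Sum>l=n-k+1..n. F (\<sigma> \<circ> top_cycle l) + F (\<sigma> \<circ> inv' (top_cycle l))) / (2 * real k)"
    unfolding walk_def by (rule sum_sym_top_to_bottom_k[OF k])
  also have "\<dots> = (\<Sum>l=n-k+1..n. \<phi> (inv' (top_cycle l) x) + \<phi> (top_cycle l x)) / (2 * real k)"
  proof (intro arg_cong2[where f = "(/)"] sum.cong refl)
    fix l assume l: "l \<in> {n-k+1..n}"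
    have pl: "top_cycle l permutes {1..n}" by (rule top_cycle_permutes) (use l in auto)
    show "F (\<sigma> \<circ> top_cycle l) + F (\<sigma> \<circ> inv' (top_cycle l)) = \<phi> (inv' (top_cycle l) x) + \<phi> (top_cycle l x)"
      unfolding F_def x_def inv_comp_apply[OF \<sigma> pl] inv_comp_apply[OF \<sigma> permutes_inv[OF pl]] permutes_inv_inv[OF pl] ..
  qed
  also have "\<dots> \<le> (\<Sum>l=n-k+1..n. 2 * \<phi> x + 2) / (2 * real k)"
    by (intro divide_right_mono sum_mono step) auto
  also have "\<dots> = \<phi> x + 1" using k by (simp add: field_simps)
  finally show ?thesis by (simp add: F_def[abs_def] x_def)
qed

text \<open>By Markov's inequality the card L + 1 is still within distance L of its start except
  with probability m / L^2. Under the uniform distribution this event B has probability (2 L - 1) /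
  n, at most 1 / 2.\<close>

lemma tv_dist_shuffle_ge_quadratic:
  fixes n k L m :: nat
  assumes k: "1 < k" "k \<le> n" and L: "1 \<le> L" "4 * L \<le> n - k"
  shows "1 / 2 - real m / real L ^ 2
    \<le> shuffle_tv n k m"
proof -
  let ?G = "perms {1..n}"
  let ?p = "(shuffle_walk n k ^^ m) id_mass"
  define \<phi> where "\<phi> x = min ((real x - real (L + 1))\<^sup>2) (real L ^ 2)" for x
  define F where "F \<sigma> = \<phi> (inv' \<sigma> (L + 1))" for \<sigma>
  define I where "I x = (if \<bar>real x - real (L + 1)\<bar> < real L then 1 else 0 :: real)" for x
  define B where "B = {\<sigma>\<in>?G. \<bar>real (inv' \<sigma> (L + 1)) - real (L + 1)\<bar> < real L}"
  have finG: "finite ?G" by (simp add: finite_permutations)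
  have L2: "2 * L \<le> n - k" using L by simp
  have p0: "0 \<le> ?p \<sigma>" for \<sigma>
    by (rule walk_power_id_mass_nonneg) (rule sym_top_to_bottom_k_nonneg)
  have mass: "(\<Sum>\<sigma>\<in>?G. ?p \<sigma>) = 1"
    by (rule sum_walk_power_id_mass) (rule sym_top_to_bottom_k_inv finite_atLeastAtMost sum_sym_top_to_bottom_k_1 k | assumption)+
  have "(shuffle_walk n k ^^ j) F \<sigma> \<le> F \<sigma> + real j" if "\<sigma> permutes {1..n}" for j \<sigma>
    using that
  proof (induction j arbitrary: \<sigma>)
    case (Suc j)
    have "(shuffle_walk n k ^^ Suc j) F \<sigma> \<le> shuffle_walk n k (\<lambda>\<sigma>. F \<sigma> - - real j) \<sigma>"
      unfolding funpow_Suc_apply using Suc sym_top_to_bottom_k_nonneg by (intro walk_mono) auto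
    also have "\<dots> = shuffle_walk n k F \<sigma> + real j"
      unfolding walk_diff walk_const[OF sum_sym_top_to_bottom_k_1[OF k]] by simp
    also have "shuffle_walk n k F \<sigma> \<le> F \<sigma> + 1"
      using walk_truncated_square_le[OF k L(1) L2 Suc.prems] unfolding F_def[abs_def] \<phi>_def[abs_def] .
    finally show ?case by simp
  qed simp
  then have "(shuffle_walk n k ^^ m) F id \<le> F id + real m" using permutes_id by blast
  moreover have "F id = 0" by (simp add: F_def \<phi>_def)
  moreover have "(shuffle_walk n k ^^ m) F id = ip ?G ?p F"
  proof -
    have "(shuffle_walk n k ^^ m) F id = ip ?G ?p (\<lambda>\<tau>. F (id \<circ> \<tau>))"
      by (rule walk_power_apply[OF _ finite_atLeastAtMost]) (rule sym_top_to_bottom_k_inv)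
    then show ?thesis unfolding id_comp .
  qed
  ultimately have EF: "ip ?G ?p F \<le> real m" by simp
  have "real L ^ 2 * (\<Sum>\<sigma>\<in>?G - B. ?p \<sigma>) = (\<Sum>\<sigma>\<in>?G - B. ?p \<sigma> * F \<sigma>)"
    unfolding sum_distrib_left
  proof (intro sum.cong refl)
    fix \<sigma> assume "\<sigma> \<in> ?G - B"
    then have "real L \<le> \<bar>real (inv' \<sigma> (L + 1)) - real (L + 1)\<bar>" by (auto simp: B_def)
    then have "real L ^ 2 \<le> (real (inv' \<sigma> (L + 1)) - real (L + 1))\<^sup>2"
      using abs_le_square_iff[of "real L" "real (inv' \<sigma> (L + 1)) - real (L + 1)"] by simp
    then have "F \<sigma> = real L ^ 2" unfolding F_def \<phi>_def by (rule min.absorb2)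
    then show "real L ^ 2 * ?p \<sigma> = ?p \<sigma> * F \<sigma>" by simp
  qed
  also have "\<dots> \<le> ip ?G ?p F"
    unfolding ip_def using finG p0 by (intro sum_mono2) (auto simp: F_def \<phi>_def)
  finally have "real L ^ 2 * (\<Sum>\<sigma>\<in>?G - B. ?p \<sigma>) \<le> real m" using EF by simp
  then have out: "(\<Sum>\<sigma>\<in>?G - B. ?p \<sigma>) \<le> real m / real L ^ 2"
    using L by (simp add: pos_le_divide_eq mult.commute)
  have sub: "B \<subseteq> ?G" by (auto simp: B_def)
  have inB: "(\<Sum>\<sigma>\<in>B. ?p \<sigma>) \<ge> 1 - real m / real L ^ 2"
    using sum.subset_diff[OF sub finG, of ?p] mass out by simp
  have cB: "real (card B) / fact n \<le> 1 / 2"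
  proof -
    have "real (card B) = (\<Sum>\<sigma>\<in>?G. if \<sigma> \<in> B then 1 else 0)"
      using sub finG by (simp add: sum.If_cases Int_absorb1)
    also have "\<dots> = (\<Sum>\<sigma>\<in>?G. I (inv' \<sigma> (L + 1)))"
      by (intro sum.cong refl) (auto simp: B_def I_def)
    also have "\<dots> = (\<Sum>\<sigma>\<in>?G. I (\<sigma> (L + 1)))" by (rule sum_permutes_inv[of "\<lambda>\<sigma>. I (\<sigma> (L + 1))"])
    finally have "real n * real (card B) = fact n * (\<Sum>x=1..n. I x)"
      using sum_permutes_apply[of "{1..n}" "L + 1" I] L by simp
    also have "(\<Sum>x=1..n. I x) \<le> (\<Sum>x=2..2*L. 1)"
    proof -
      have "(\<Sum>x=1..n. I x) \<le> (\<Sum>x\<in>{1..n}. if x \<in> {2..2*L} then 1 else 0)"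
        by (intro sum_mono) (auto simp: I_def)
      also have "\<dots> = (\<Sum>x\<in>{1..n} \<inter> {2..2*L}. 1)" by (rule sum.inter_restrict[symmetric]) simp
      also have "{1..n} \<inter> {2..2*L} = {2..2*L}" using L by auto
      finally show ?thesis .
    qed
    finally have "real n * real (card B) \<le> fact n * (\<Sum>x=2..2*L. 1)" by simp
    also have "\<dots> \<le> fact n * (real n / 2)" using L by (intro mult_left_mono) (auto simp: of_nat_diff)
    finally have "real (card B) \<le> fact n / 2" using k by simp
    then show ?thesis by (simp add: field_simps)
  qed
  show ?thesis using tv_dist_shuffle_ge[OF k sub, of m] inB cB by linarith
qed

lemma shuffle_T_ge_quadratic:
  fixes n k :: nat
  assumes c: "0 < c" "c < 1" and k: "1 < k" "k \<le> n" "real k \<le> c * real n"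
  shows "ereal ((1 - c)\<^sup>2 / 256 * real n ^ 2) \<le> ereal_of_enat (shuffle_T n k)"
  unfolding shuffle_T_def mix_time_tv_def
proof (rule ereal_le_Inf_enat_image, drule CollectD)
  fix m
  assume m: "shuffle_tv n k m \<le> 1 / (2 * exp 1)"
  define a where "a = real (n - k)"
  have a: "(1 - c) * real n \<le> a" using k by (simp add: a_def of_nat_diff algebra_simps)
  have "((1 - c) * real n)\<^sup>2 \<le> a\<^sup>2" using a c by (intro power_mono) auto
  then have main: "(1 - c)\<^sup>2 / 256 * real n ^ 2 \<le> a\<^sup>2 / 256" by (simp add: power_mult_distrib)
  have "a\<^sup>2 / 256 \<le> real m"
  proof (cases "4 \<le> n - k")
    case True
    \<comment> \<open>Rounding down still leaves L at least (n - k) / 8 when n - k is at least 4.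
      The margin 1 / 2 - 1 / 4 gives m at least L^2 / 4, hence the constant 256.\<close>
    define L where "L = (n - k) div 4"
    have eq: "n - k = 4 * L + (n - k) mod 4" unfolding L_def by simp
    have lt: "(n - k) mod 4 < 4" by simp
    have L1: "1 \<le> L" using eq lt True by linarith
    then have L: "1 \<le> L" "4 * L \<le> n - k" "n - k \<le> 8 * L" using eq lt by linarith+
    have aL: "a \<le> 8 * real L" using L(3) unfolding a_def by linarith
    have "1 / 2 - real m / real L ^ 2 \<le> 1 / 4"
      using tv_dist_shuffle_ge_quadratic[OF k(1,2) L(1,2), of m] m inverse_two_exp_one_le by linarith
    then have "real L ^ 2 / 4 \<le> real m" using L by (simp add: field_simps)
    moreover have "a\<^sup>2 \<le> (8 * real L)\<^sup>2" using aL by (intro power_mono) (auto simp: a_def)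
    ultimately show ?thesis by (simp add: power_mult_distrib)
  next
    case False
    \<comment> \<open>There is no room for a window, but the claimed bound is then below 1.\<close>
    then have "a \<le> 4" unfolding a_def by linarith
    then have "a\<^sup>2 \<le> 4\<^sup>2" by (intro power_mono) (auto simp: a_def)
    moreover have "1 \<le> m" by (rule tv_threshold_pos[OF k(1,2) m])
    ultimately show ?thesis by simp
  qed
  with main show "(1 - c)\<^sup>2 / 256 * real n ^ 2 \<le> real m" by linarith
qed

text \<open>The waves force n (1 - \<epsilon>)^(2 m) to be bounded, hence m to be of order ln n /
  \<epsilon>, provided that \<epsilon> stays away from 1. Otherwise k^2 is comparable to n^3, which
  bounds n because k is at most n.\<close>

lemma shuffle_T2_ge:
  fixes n k :: nat
  assumes k: "1 < k" "k \<le> n"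
  shows "ereal (1 / 8192 * (real n ^ 3 / real k ^ 2 * ln (real n))) \<le> ereal_of_enat (shuffle_T2 n k)"
  unfolding shuffle_T2_def mix_time_l2_def
proof (rule ereal_le_Inf_enat_image, drule CollectD)
  fix m
  let ?D = "shuffle_l2 n k m"
  assume m: "?D \<le> 1 / exp 1"
  define R where "R = real n ^ 3 / real k ^ 2"
  define \<epsilon> where "\<epsilon> = 16 * pi\<^sup>2 * real k ^ 2 / real n ^ 3"
  have n: "2 \<le> real n" using k by simp
  have R0: "0 < R" using k by (simp add: R_def)
  have ln0: "0 \<le> ln (real n)" using n by simp
  have pi2: "pi\<^sup>2 \<le> 16" "4 \<le> pi\<^sup>2"
    using power_mono[of pi 4 2] power_mono[of 2 pi 2] pi_less_4 pi_ge_two by auto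
  have eps: "\<epsilon> * R = 16 * pi\<^sup>2" using k by (simp add: \<epsilon>_def R_def)
  have eps0: "0 < \<epsilon>" using k by (simp add: \<epsilon>_def)
  \<comment> \<open>The case of small \<epsilon> yields 1 / 1024 and the bounded case 1 / 4608; the
    constant covers both.\<close>
  have "1 / 8192 * (R * ln (real n)) \<le> real m"
  proof (cases "\<epsilon> \<le> 1 / 2")
    case True
    have "real k ^ 2 * 32 * pi\<^sup>2 \<le> real n ^ 3" using True k by (simp add: \<epsilon>_def field_simps)
    moreover have "2 ^ 2 * 32 * 4 \<le> real k ^ 2 * 32 * pi\<^sup>2"
      using k pi2 by (intro mult_mono power_mono) auto
    ultimately have "2 ^ 2 * 32 * 4 \<le> real n ^ 3" by (rule order.trans[rotated])
    then have "2 ^ 3 < real n ^ 3" by simp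
    then have "2 < real n" by (rule power_less_imp_less_base) simp
    then have n3: "3 \<le> n" by simp
    have "exp (- (2 * \<epsilon>)) \<le> 1 - \<epsilon>"
    proof -
      \<comment> \<open>For \<epsilon> at most 1 / 2 the quadratic term of the logarithm bound is at
        most \<epsilon>.\<close>
      have "- (2 * \<epsilon>) \<le> - \<epsilon> - 2 * \<epsilon>\<^sup>2" using True eps0 by (simp add: power2_eq_square)
      also have "\<dots> \<le> ln (1 - \<epsilon>)" using True eps0 by (intro ln_one_minus_pos_lower_bound) auto
      finally show ?thesis using True by (subst (asm) ln_ge_iff) auto
    qed
    then have "exp (- (2 * \<epsilon>)) ^ (2 * m) \<le> (1 - \<epsilon>) ^ (2 * m)" by (rule power_mono) simp
    moreover have "exp (- (2 * \<epsilon>)) ^ (2 * m) = exp (- (4 * \<epsilon> * real m))"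
      by (simp add: mult_ac flip: exp_of_nat_mult)
    ultimately have "real (n - 2) * exp (- (4 * \<epsilon> * real m)) \<le> real (n - 2) * (1 - \<epsilon>) ^ (2 * m)"
      by (intro mult_left_mono) auto
    also have "\<dots> \<le> ?D\<^sup>2"
      using True by (intro l2_dist_ge_of_walk[OF k n3 \<epsilon>_def]) simp
    also have "\<dots> \<le> (1 / exp 1)\<^sup>2" using m by (intro power_mono) (auto simp: l2_dist_def uniform_mass_def intro!: sum_nonneg)
    also have "\<dots> \<le> (1 / 2)\<^sup>2" using exp_ge_add_one_self[of 1] by (intro power_mono) (auto simp: field_simps)
    finally have "4 * real (n - 2) * exp (- (4 * \<epsilon> * real m)) \<le> 1" by (simp add: power2_eq_square)
    moreover have "real n * exp (- (4 * \<epsilon> * real m)) \<le> 4 * real (n - 2) * exp (- (4 * \<epsilon> * real m))"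
      using n3 by (intro mult_right_mono) auto
    ultimately have "real n * exp (- (4 * \<epsilon> * real m)) \<le> 1" by linarith
    then have "real n \<le> exp (4 * \<epsilon> * real m)" by (simp add: exp_minus field_simps)
    then have "ln (real n) \<le> ln (exp (4 * \<epsilon> * real m))" using n by (subst ln_le_cancel_iff) auto
    then have "ln (real n) \<le> 4 * \<epsilon> * real m" by simp
    then have "R * ln (real n) \<le> R * (4 * \<epsilon> * real m)" using R0 by (intro mult_left_mono) auto
    also have "\<dots> = 4 * (\<epsilon> * R) * real m" by simp
    also have "\<dots> \<le> 4 * (16 * 16) * real m" unfolding eps using pi2 by (intro mult_right_mono mult_left_mono) auto
    finally show ?thesis by simp
  next
    case False
    \<comment> \<open>The product \<epsilon> R = 16 pi^2 is at most 256, so R is at most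
      512.\<close>
    have "1 / 2 * R \<le> \<epsilon> * R" using False R0 by (intro mult_right_mono) auto
    then have R: "R \<le> 512" using pi2 unfolding eps by simp
    have "real n \<le> R"
    proof -
      have "real n * real k ^ 2 \<le> real n * real n ^ 2" using k by (intro mult_left_mono power_mono) auto
      then show ?thesis using k by (simp add: R_def pos_le_divide_eq power3_eq_cube power2_eq_square)
    qed
    then have "ln (real n) \<le> ln (2 ^ 9)" using R n by simp
    also have "\<dots> = 9 * ln 2" by (simp only: ln_realpow)
    also have "\<dots> \<le> 9" using ln_2_less_1 by simp
    finally have "R * ln (real n) \<le> 512 * 9" using R R0 ln0 by (intro mult_mono) auto
    moreover have "1 \<le> m"
    proof -
      have "shuffle_tv n k m \<le> 1 / (2 * exp 1)"
        using tv_dist_le_l2_dist[OF finite_carrier_sym_group carrier_sym_group_nonempty, of n "conv_power (sym_group n) (sym_top_to_bottom_k n k) m"] m by simp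
      then show ?thesis by (rule tv_threshold_pos[OF k])
    qed
    ultimately show ?thesis by simp
  qed
  then show "1 / 8192 * (real n ^ 3 / real k ^ 2 * ln (real n)) \<le> real m" by (simp add: R_def)
qed

text \<open>For n below 6 M the cubic bound suffices: it exceeds n ln n by the factor 502 n^2, and
  502 times 36 is 18072. The choice of \<open>M\<close> dominates n - k + 1 and is at least 1 for
  every real C.\<close>

lemma shuffle_T2_le_n_ln_n_near_n:
  fixes n k :: nat
  assumes k: "1 < k" "k \<le> n" and C: "real n - C \<le> real k"
  defines "M \<equiv> \<bar>C\<bar> + 1"
  shows "ereal_of_enat (shuffle_T2 n k)
    \<le> ereal ((40 * (8 + 20 * M * (16 * M ^ 2 + 640)) + 2 + 18072 * M ^ 2) * real n * ln (real n))"
proof -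
  define B1 where "B1 = 40 * (8 + 20 * M * (16 * M ^ 2 + 640)) + 2"
  have M: "1 \<le> M" "real (n - k + 1) \<le> M" using C k by (auto simp: M_def of_nat_diff)
  have B1: "0 \<le> B1" using M by (simp add: B1_def)
  have x0: "0 \<le> real n * ln (real n)" using k by simp
  show ?thesis
  proof (cases "6 * M \<le> real n")
    case True
    have "ereal_of_enat (shuffle_T2 n k) \<le> ereal (B1 * real n * ln (real n))"
      unfolding B1_def by (rule shuffle_T2_le_n_ln_n[OF k M(2) True])
    also have "B1 * real n * ln (real n) \<le> (B1 + 18072 * M ^ 2) * real n * ln (real n)"
      using mult_right_mono[of B1 "B1 + 18072 * M ^ 2", OF _ x0] by (simp add: mult.assoc)
    finally show ?thesis by (simp add: B1_def)
  next
    case False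
    have "ereal_of_enat (shuffle_T2 n k) \<le> ereal (502 * real n ^ 3 * ln (real n))" by (rule shuffle_T2_le_cubic[OF k])
    also have "502 * real n ^ 3 * ln (real n) = (502 * real n ^ 2) * (real n * ln (real n))"
      by (simp add: power3_eq_cube power2_eq_square)
    also have "\<dots> \<le> (B1 + 18072 * M ^ 2) * (real n * ln (real n))"
    proof (intro mult_right_mono x0)
      have "real n ^ 2 \<le> (6 * M)\<^sup>2" using False by (intro power_mono) auto
      then show "502 * real n ^ 2 \<le> B1 + 18072 * M ^ 2" using B1 by (simp add: power_mult_distrib)
    qed
    finally show ?thesis by (simp add: B1_def mult.assoc)
  qed
qed

theorem theorem1p2:
  shows
    "(\<forall>C::real. \<exists>B::real. 0 < B \<and>
        (\<forall>n k::nat. 1 < k \<and> k \<le> n \<and> real k \<ge> real n - C \<longrightarrow>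
           shuffle_T n k \<le> shuffle_T2 n k \<and>
           ereal_of_enat (shuffle_T2 n k) \<le> ereal (B * real n * ln (real n))))
     \<and>
     (\<forall>c::real. 0 < c \<and> c < 1 \<longrightarrow> (\<exists>A::real. 0 < A \<and>
        (\<forall>n k::nat. 1 < k \<and> k \<le> n \<and> real k \<le> c * real n \<longrightarrow>
           shuffle_T2 n k \<ge> shuffle_T n k \<and>
           ereal_of_enat (shuffle_T n k) \<ge> ereal (A * real n ^ 2) \<and>
           ereal_of_enat (shuffle_T2 n k) \<ge>
             ereal (A * real n ^ 3 / real k ^ 2 * ln (real n)))))
     \<and>
     (\<exists>B::real. 0 < B \<and>
        (\<forall>n k::nat. 1 < k \<and> k \<le> n \<longrightarrow>
           shuffle_T n k \<le> shuffle_T2 n k \<and>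
           ereal_of_enat (shuffle_T2 n k) \<le> ereal (B * real n ^ 3 * ln (real n))) \<and>
        (\<forall>C::real. \<exists>A::real. 0 < A \<and>
           (\<forall>n k::nat. 1 < k \<and> k \<le> n \<and> real k \<le> C \<longrightarrow>
              ereal (A * real n ^ 3 * ln (real n)) \<le> ereal_of_enat (shuffle_T2 n k) \<and>
              ereal_of_enat (shuffle_T2 n k) \<le> ereal (B * real n ^ 3 * ln (real n)))))"
proof (intro conjI allI impI)
  fix C :: real
  define M where "M = \<bar>C\<bar> + 1"
  define B where "B = 40 * (8 + 20 * M * (16 * M ^ 2 + 640)) + 2 + 18072 * M ^ 2"
  have "0 < B" by (simp add: B_def M_def add_pos_nonneg)
  then show "\<exists>B::real. 0 < B \<and>
        (\<forall>n k::nat. 1 < k \<and> k \<le> n \<and> real k \<ge> real n - C \<longrightarrow>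
           shuffle_T n k \<le> shuffle_T2 n k \<and>
           ereal_of_enat (shuffle_T2 n k) \<le> ereal (B * real n * ln (real n)))"
    using shuffle_T_le_T2 shuffle_T2_le_n_ln_n_near_n[of _ _ C] unfolding B_def M_def by blast
next
  fix c :: real
  assume "0 < c \<and> c < 1"
  then have c: "0 < c" "c < 1" by auto
  define A where "A = min ((1 - c)\<^sup>2 / 256) (1 / 8192)"
  have A: "0 < A" "A \<le> (1 - c)\<^sup>2 / 256" "A \<le> 1 / 8192" using c by (auto simp: A_def)
  have "ereal (A * real n ^ 2) \<le> ereal_of_enat (shuffle_T n k) \<and>
      ereal (A * real n ^ 3 / real k ^ 2 * ln (real n)) \<le> ereal_of_enat (shuffle_T2 n k)"
    if k: "1 < k" "k \<le> n" "real k \<le> c * real n" for n k :: nat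
  proof
    have "A * real n ^ 2 \<le> (1 - c)\<^sup>2 / 256 * real n ^ 2" using A by (intro mult_right_mono) auto
    then have "ereal (A * real n ^ 2) \<le> ereal ((1 - c)\<^sup>2 / 256 * real n ^ 2)" by simp
    also have "\<dots> \<le> ereal_of_enat (shuffle_T n k)" by (rule shuffle_T_ge_quadratic[OF c k])
    finally show "ereal (A * real n ^ 2) \<le> ereal_of_enat (shuffle_T n k)" .
    have "A * (real n ^ 3 / real k ^ 2 * ln (real n)) \<le> 1 / 8192 * (real n ^ 3 / real k ^ 2 * ln (real n))"
      using A k by (intro mult_right_mono) auto
    then have "ereal (A * real n ^ 3 / real k ^ 2 * ln (real n)) \<le> ereal (1 / 8192 * (real n ^ 3 / real k ^ 2 * ln (real n)))"
      by simp
    also have "\<dots> \<le> ereal_of_enat (shuffle_T2 n k)" by (rule shuffle_T2_ge[OF k(1,2)])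
    finally show "ereal (A * real n ^ 3 / real k ^ 2 * ln (real n)) \<le> ereal_of_enat (shuffle_T2 n k)" .
  qed
  then show "\<exists>A::real. 0 < A \<and>
        (\<forall>n k::nat. 1 < k \<and> k \<le> n \<and> real k \<le> c * real n \<longrightarrow>
           shuffle_T2 n k \<ge> shuffle_T n k \<and>
           ereal_of_enat (shuffle_T n k) \<ge> ereal (A * real n ^ 2) \<and>
           ereal_of_enat (shuffle_T2 n k) \<ge>
             ereal (A * real n ^ 3 / real k ^ 2 * ln (real n)))"
    using A(1) shuffle_T_le_T2 by blast
next
  have lower: "\<exists>A::real. 0 < A \<and>
           (\<forall>n k::nat. 1 < k \<and> k \<le> n \<and> real k \<le> C \<longrightarrow>
              ereal (A * real n ^ 3 * ln (real n)) \<le> ereal_of_enat (shuffle_T2 n k) \<and>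
              ereal_of_enat (shuffle_T2 n k) \<le> ereal (502 * real n ^ 3 * ln (real n)))" for C :: real
  \<comment> \<open>The general lower bound n^3 / k^2 with k at most |C| + 1; the added 1 keeps the
    witness positive for every real C.\<close>
  proof (intro exI[of _ "1 / (8192 * (\<bar>C\<bar> + 1)\<^sup>2)"] conjI allI impI)
    show "0 < 1 / (8192 * (\<bar>C\<bar> + 1)\<^sup>2)"
      using zero_less_power[of "\<bar>C\<bar> + 1" 2] by simp
    fix n k :: nat
    assume "1 < k \<and> k \<le> n \<and> real k \<le> C"
    then have k: "1 < k" "k \<le> n" "real k \<le> C" by auto
    have "real n ^ 3 / (\<bar>C\<bar> + 1)\<^sup>2 \<le> real n ^ 3 / real k ^ 2"
      using k by (intro divide_left_mono power_mono) auto
    then have "real n ^ 3 / (\<bar>C\<bar> + 1)\<^sup>2 * ln (real n) \<le> real n ^ 3 / real k ^ 2 * ln (real n)"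
      using k by (intro mult_right_mono) auto
    then have "ereal (1 / (8192 * (\<bar>C\<bar> + 1)\<^sup>2) * real n ^ 3 * ln (real n))
        \<le> ereal (1 / 8192 * (real n ^ 3 / real k ^ 2 * ln (real n)))" by simp
    also have "\<dots> \<le> ereal_of_enat (shuffle_T2 n k)" by (rule shuffle_T2_ge[OF k(1,2)])
    finally show "ereal (1 / (8192 * (\<bar>C\<bar> + 1)\<^sup>2) * real n ^ 3 * ln (real n)) \<le> ereal_of_enat (shuffle_T2 n k)" .
    show "ereal_of_enat (shuffle_T2 n k) \<le> ereal (502 * real n ^ 3 * ln (real n))"
      by (rule shuffle_T2_le_cubic[OF k(1,2)])
  qed
  show "\<exists>B::real. 0 < B \<and>
        (\<forall>n k::nat. 1 < k \<and> k \<le> n \<longrightarrow>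
           shuffle_T n k \<le> shuffle_T2 n k \<and>
           ereal_of_enat (shuffle_T2 n k) \<le> ereal (B * real n ^ 3 * ln (real n))) \<and>
        (\<forall>C::real. \<exists>A::real. 0 < A \<and>
           (\<forall>n k::nat. 1 < k \<and> k \<le> n \<and> real k \<le> C \<longrightarrow>
              ereal (A * real n ^ 3 * ln (real n)) \<le> ereal_of_enat (shuffle_T2 n k) \<and>
              ereal_of_enat (shuffle_T2 n k) \<le> ereal (B * real n ^ 3 * ln (real n))))"
  proof (rule exI[of _ 502], intro conjI allI impI)
    fix C :: real
    show "\<exists>A::real. 0 < A \<and>
           (\<forall>n k::nat. 1 < k \<and> k \<le> n \<and> real k \<le> C \<longrightarrow>
              ereal (A * real n ^ 3 * ln (real n)) \<le> ereal_of_enat (shuffle_T2 n k) \<and>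
              ereal_of_enat (shuffle_T2 n k) \<le> ereal (502 * real n ^ 3 * ln (real n)))"
      by (rule lower)
  qed (use shuffle_T_le_T2 shuffle_T2_le_cubic in auto)
qed

end
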